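(* There is a finitely presented semigroup (and a finitely presented monoid) $P$ with polynomial space complete (PSPACE-complete) word problem and with polynomial space function.
   Context: Words and presentations. For an alphabet $A$, $A^*$ is the set of all words in $A$, $A^+$ the set of non-empty words, $|w|$ the length of $w$. A semigroup (resp. monoid) presentation $\langle A\mid R\rangle$ has $R\subset A^+\times A^+$ (resp. $R\subset A^*\times A^*$); it is finite if $A$ and $R$ are finite. The word problem of $P=\langle A\mid R\rangle$ asks, given two words over $A$, whether they are equal in $P$. Space function. Let $P=\langle A\mid R\rangle$ be finitely presented. A derivation from $w$ to $w'$ (words in $A^+$, resp. $A^*$) is a sequence $w=w_0\to w_1\to\dots\to w_t=w'$, $t\ge 0$, where for each $i<t$ one has $w_i=ur'v$, $w_{i+1}=ur''v$ for some words $u,v$ and $(r',r'')\in R$ or $(r'',r')\in R$. The space of the derivation is $\max_{0\le i\le t}|w_i|$. For words $w,w'$ equal in $P$, $\mathrm{space}_P(w,w')$ is the minimum of the spaces of derivations from $w$ to $w'$. The space function of $P$ is $s(n)=\max \mathrm{space}_P(w,w')$ over all pairs of words $w,w'$ equal in $P$ with $|w|,|w'|\le n$. Polynomial functions. For nondecreasing functions $f,g$ on $\mathbb N$, $f\preceq g$ means that there is a positive integer $c$ with $f(n)\le c\,g(cn)+cn$ for all $n\in\mathbb N$. A function $f$ is called polynomial if $f\preceq g$ for some polynomial $g$. *)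

theory Defs
  imports Complex_Main "HOL-Computational_Algebra.Polynomial"
begin

section \<open>Deterministic single-tape Turing machines\<close>

text \<open>
  States and tape symbols are natural numbers; the tape is infinite to the right, its cells are
  numbered from 0, and the symbol 0 is the blank.
\<close>

abbreviation blank :: nat where "blank \<equiv> 0"

datatype move = MoveLeft | MoveRight | Stay

record tm =
  states :: "nat set"
  tape_alphabet :: "nat set"
  delta :: "nat \<Rightarrow> nat \<Rightarrow> nat \<times> nat \<times> move"
  start :: nat
  accept :: nat
  reject :: nat

definition wf_tm :: "nat set \<Rightarrow> tm \<Rightarrow> bool" where
  "wf_tm \<Sigma> M \<longleftrightarrow>
     finite (states M) \<and> finite (tape_alphabet M) \<and>
     {start M, accept M, reject M} \<subseteq> states M \<and> accept M \<noteq> reject M \<and>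
     blank \<in> tape_alphabet M \<and> \<Sigma> \<subseteq> tape_alphabet M - {blank} \<and>
     (\<forall>q \<in> states M - {accept M, reject M}. \<forall>a \<in> tape_alphabet M.
        delta M q a \<in> states M \<times> tape_alphabet M \<times> UNIV)"

record config =
  state :: nat
  head :: nat
  tape :: "nat \<Rightarrow> nat"

definition halted :: "tm \<Rightarrow> config \<Rightarrow> bool" where
  "halted M c \<longleftrightarrow> state c \<in> {accept M, reject M}"

text \<open>A left move in the leftmost cell leaves the head where it is (truncated subtraction).\<close>

fun move_head :: "move \<Rightarrow> nat \<Rightarrow> nat" where
  "move_head MoveLeft h = h - 1"
| "move_head MoveRight h = h + 1"
| "move_head Stay h = h"

definition tm_step :: "tm \<Rightarrow> config \<Rightarrow> config" where
  "tm_step M c =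
     (if halted M c then c
      else case delta M (state c) (tape c (head c)) of (q, b, m) \<Rightarrow>
        \<lparr>state = q, head = move_head m (head c), tape = (tape c)(head c := b)\<rparr>)"

definition tape_of :: "nat list \<Rightarrow> nat \<Rightarrow> nat" where
  "tape_of w = (\<lambda>i. if i < length w then w ! i else blank)"

definition run :: "tm \<Rightarrow> nat list \<Rightarrow> nat \<Rightarrow> config" where
  "run M w t = (tm_step M ^^ t) \<lparr>state = start M, head = 0, tape = tape_of w\<rparr>"


section \<open>PSPACE-completeness\<close>

text \<open>
  A language is given together with its finite input alphabet \<open>\<Sigma>\<close>.  Since the head starts in cell 0
  and moves by at most one cell, the number of cells scanned on input \<open>w\<close> is at most \<open>k\<close> iff the
  head position always stays below \<open>k\<close>.  Halted configurations are fixed by \<^const>\<open>tm_step\<close>.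
\<close>

definition in_PSPACE :: "nat set \<Rightarrow> nat list set \<Rightarrow> bool" where
  "in_PSPACE \<Sigma> L \<longleftrightarrow>
     L \<subseteq> lists \<Sigma> \<and>
     (\<exists>M. \<exists>p :: nat poly. wf_tm \<Sigma> M \<and>
        (\<forall>w \<in> lists \<Sigma>.
           (\<exists>t. state (run M w t) = (if w \<in> L then accept M else reject M)) \<and>
           (\<forall>t. head (run M w t) < poly p (length w))))"

definition poly_time_computable ::
    "nat set \<Rightarrow> nat set \<Rightarrow> (nat list \<Rightarrow> nat list) \<Rightarrow> bool" where
  "poly_time_computable \<Sigma> \<Sigma>' f \<longleftrightarrow>
     (\<exists>M. \<exists>p :: nat poly. wf_tm \<Sigma> M \<and>
        (\<forall>w \<in> lists \<Sigma>. f w \<in> lists \<Sigma>' \<and>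
           (\<exists>t \<le> poly p (length w). halted M (run M w t) \<and> tape (run M w t) = tape_of (f w))))"

definition poly_time_reducible ::
    "nat set \<Rightarrow> nat list set \<Rightarrow> nat set \<Rightarrow> nat list set \<Rightarrow> bool" where
  "poly_time_reducible \<Sigma> L \<Sigma>' L' \<longleftrightarrow>
     (\<exists>f. poly_time_computable \<Sigma> \<Sigma>' f \<and> (\<forall>w \<in> lists \<Sigma>. w \<in> L \<longleftrightarrow> f w \<in> L'))"

definition PSPACE_complete :: "nat set \<Rightarrow> nat list set \<Rightarrow> bool" where
  "PSPACE_complete \<Sigma> L \<longleftrightarrow>
     in_PSPACE \<Sigma> L \<and>
     (\<forall>\<Sigma>' L'. in_PSPACE \<Sigma>' L' \<longrightarrow> poly_time_reducible \<Sigma>' L' \<Sigma> L)"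


section \<open>Semigroup and monoid presentations\<close>

text \<open>
  The semigroup and the monoid case differ only in the set \<open>W\<close> of admissible words: non-empty words
  \<open>A\<^sup>+\<close> for semigroups, all words \<open>A\<^sup>*\<close> for monoids.
\<close>

abbreviation nonempty_words :: "'a set \<Rightarrow> 'a list set" where
  "nonempty_words A \<equiv> lists A - {[]}"

definition finite_presentation ::
    "'a set \<Rightarrow> 'a list set \<Rightarrow> ('a list \<times> 'a list) set \<Rightarrow> bool" where
  "finite_presentation A W R \<longleftrightarrow> finite A \<and> finite R \<and> R \<subseteq> W \<times> W"

abbreviation finite_semigroup_presentation :: "'a set \<Rightarrow> ('a list \<times> 'a list) set \<Rightarrow> bool" where
  "finite_semigroup_presentation A R \<equiv> finite_presentation A (nonempty_words A) R"

abbreviation finite_monoid_presentation :: "'a set \<Rightarrow> ('a list \<times> 'a list) set \<Rightarrow> bool" where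
  "finite_monoid_presentation A R \<equiv> finite_presentation A (lists A) R"

text \<open>The smallest congruence on \<open>W\<close> containing \<open>R\<close>.\<close>

inductive equal_in :: "'a list set \<Rightarrow> ('a list \<times> 'a list) set \<Rightarrow> 'a list \<Rightarrow> 'a list \<Rightarrow> bool"
  for W R where
  relator: "(u, v) \<in> R \<Longrightarrow> equal_in W R u v"
| refl: "u \<in> W \<Longrightarrow> equal_in W R u u"
| sym: "equal_in W R u v \<Longrightarrow> equal_in W R v u"
| trans: "equal_in W R u v \<Longrightarrow> equal_in W R v w \<Longrightarrow> equal_in W R u w"
| mult_left: "equal_in W R u v \<Longrightarrow> x \<in> W \<Longrightarrow> equal_in W R (x @ u) (x @ v)"
| mult_right: "equal_in W R u v \<Longrightarrow> x \<in> W \<Longrightarrow> equal_in W R (u @ x) (v @ x)"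

definition rewrite_step :: "('a list \<times> 'a list) set \<Rightarrow> 'a list \<Rightarrow> 'a list \<Rightarrow> bool" where
  "rewrite_step R w w' \<longleftrightarrow>
     (\<exists>u v r' r''. ((r', r'') \<in> R \<or> (r'', r') \<in> R) \<and> w = u @ r' @ v \<and> w' = u @ r'' @ v)"

definition derivation ::
    "'a list set \<Rightarrow> ('a list \<times> 'a list) set \<Rightarrow> 'a list \<Rightarrow> 'a list \<Rightarrow> 'a list list \<Rightarrow> bool" where
  "derivation W R w w' ws \<longleftrightarrow>
     ws \<noteq> [] \<and> set ws \<subseteq> W \<and> hd ws = w \<and> last ws = w' \<and> successively (rewrite_step R) ws"

lemma rewrite_step_imp_equal_in:
  assumes A: "W = lists A \<or> W = nonempty_words A"
    and R: "R \<subseteq> W \<times> W" and w: "w \<in> W" and s: "rewrite_step R w w'"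
  shows "equal_in W R w w'"
proof -
  obtain u v r' r'' where r: "(r', r'') \<in> R \<or> (r'', r') \<in> R"
    and eq: "w = u @ r' @ v" "w' = u @ r'' @ v"
    using s by (auto simp: rewrite_step_def)
  have "equal_in W R r' r''"
    using r by (auto intro: equal_in.relator equal_in.sym)
  then have 1: "equal_in W R (r' @ v) (r'' @ v)"
    using A w eq by (cases "v = []") (auto intro: equal_in.mult_right)
  then show ?thesis
    using A w eq by (cases "u = []") (auto intro: equal_in.mult_left)
qed

lemma rewrite_step_append:
  assumes "rewrite_step R w w'"
  shows "rewrite_step R (x @ w @ y) (x @ w' @ y)"
proof -
  obtain u v r' r'' where "(r', r'') \<in> R \<or> (r'', r') \<in> R"
    "w = u @ r' @ v" "w' = u @ r'' @ v"
    using assms by (auto simp: rewrite_step_def)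
  then have "((r', r'') \<in> R \<or> (r'', r') \<in> R) \<and>
      x @ w @ y = (x @ u) @ r' @ (v @ y) \<and> x @ w' @ y = (x @ u) @ r'' @ (v @ y)"
    by simp
  then show ?thesis
    unfolding rewrite_step_def by blast
qed

lemma rewrite_step_sym: "rewrite_step R w w' \<Longrightarrow> rewrite_step R w' w"
  by (auto simp: rewrite_step_def)

lemma equal_in_iff_derivation:
  assumes A: "W = lists A \<or> W = nonempty_words A" and R: "R \<subseteq> W \<times> W"
  shows "equal_in W R w w' \<longleftrightarrow> (\<exists>ws. derivation W R w w' ws)"
proof
  assume "equal_in W R w w'"
  then show "\<exists>ws. derivation W R w w' ws"
  proof induction
    case (relator u v)
    have "rewrite_step R u v"
      unfolding rewrite_step_def using relator by (metis append_Nil append_Nil2)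
    then have "derivation W R u v [u, v]"
      using relator R by (auto simp: derivation_def)
    then show ?case ..
  next
    case (refl u)
    then have "derivation W R u u [u]"
      by (auto simp: derivation_def)
    then show ?case ..
  next
    case (sym u v)
    then obtain ws where "derivation W R u v ws"
      by blast
    then have "derivation W R v u (rev ws)"
      by (auto simp: derivation_def hd_rev last_rev successively_rev
               intro: successively_mono rewrite_step_sym)
    then show ?case ..
  next
    case (trans u v w)
    then obtain ws ws' where ws: "derivation W R u v ws" and ws': "derivation W R v w ws'"
      by blast
    then obtain vs where vs: "ws' = v # vs"
      by (cases ws') (auto simp: derivation_def)
    have "derivation W R u w (ws @ vs)"
      using ws ws' vs by (cases vs) (auto simp: derivation_def successively_append_iff)
    then show ?case ..
  next
    case (mult_left u v x)
    have *: "x @ w \<in> W" if "w \<in> W" for w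
      using A mult_left.hyps that by auto
    obtain ws where "derivation W R u v ws"
      using mult_left.IH by blast
    then have "derivation W R (x @ u) (x @ v) (map (\<lambda>w. x @ w) ws)"
      using * rewrite_step_append[of R _ _ x "[]"]
      by (auto simp: derivation_def hd_map last_map successively_map intro: successively_mono)
    then show ?case ..
  next
    case (mult_right u v x)
    have *: "w @ x \<in> W" if "w \<in> W" for w
      using A mult_right.hyps that by auto
    obtain ws where "derivation W R u v ws"
      using mult_right.IH by blast
    then have "derivation W R (u @ x) (v @ x) (map (\<lambda>w. w @ x) ws)"
      using * rewrite_step_append[of R _ _ "[]" x]
      by (auto simp: derivation_def hd_map last_map successively_map intro: successively_mono)
    then show ?case ..
  qed
next
  assume "\<exists>ws. derivation W R w w' ws"
  then obtain ws where "derivation W R w w' ws" ..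
  then show "equal_in W R w w'"
  proof (induction ws arbitrary: w)
    case Nil
    then show ?case by (simp add: derivation_def)
  next
    case (Cons a ws)
    show ?case
    proof (cases ws)
      case Nil
      then show ?thesis using Cons.prems by (auto simp: derivation_def intro: equal_in.refl)
    next
      case (Cons b vs)
      with Cons.prems have "derivation W R b w' ws" "rewrite_step R w b" "w \<in> W"
        by (auto simp: derivation_def)
      then show ?thesis
        using Cons.IH rewrite_step_imp_equal_in[OF A R] by (blast intro: equal_in.trans)
    qed
  qed
qed

definition derivation_space :: "'a list list \<Rightarrow> nat" where
  "derivation_space ws = Max (length ` set ws)"

definition pair_space ::
    "'a list set \<Rightarrow> ('a list \<times> 'a list) set \<Rightarrow> 'a list \<Rightarrow> 'a list \<Rightarrow> nat" where
  "pair_space W R w w' = (LEAST s. \<exists>ws. derivation W R w w' ws \<and> derivation_space ws = s)"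

text \<open>
  For a finite alphabet the set below is finite, so the supremum is a maximum; the only exception
  is the empty set (semigroups, \<open>n = 0\<close>), where the supremum is 0.
\<close>

definition space_function :: "'a list set \<Rightarrow> ('a list \<times> 'a list) set \<Rightarrow> nat \<Rightarrow> nat" where
  "space_function W R n =
     Sup {pair_space W R w w' | w w'.
            w \<in> W \<and> w' \<in> W \<and> equal_in W R w w' \<and> length w \<le> n \<and> length w' \<le> n}"

text \<open>
  For the word problem, the generator \<open>a\<close> is written as the tape symbol \<open>a + 2\<close>, and the two input
  words are separated by the symbol 1.
\<close>

definition word_problem_alphabet :: "nat set \<Rightarrow> nat set" where
  "word_problem_alphabet A = insert 1 ((\<lambda>a. a + 2) ` A)"

definition word_problem :: "nat list set \<Rightarrow> (nat list \<times> nat list) set \<Rightarrow> nat list set" where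
  "word_problem W R =
     {map (\<lambda>a. a + 2) u @ [1] @ map (\<lambda>a. a + 2) v | u v. u \<in> W \<and> v \<in> W \<and> equal_in W R u v}"


section \<open>Polynomial functions\<close>

definition preceq :: "(nat \<Rightarrow> real) \<Rightarrow> (nat \<Rightarrow> real) \<Rightarrow> bool"  (infix "\<preceq>" 50) where
  "f \<preceq> g \<longleftrightarrow> (\<exists>c::nat. c > 0 \<and> (\<forall>n. f n \<le> real c * g (c * n) + real (c * n)))"

definition polynomial_function :: "(nat \<Rightarrow> nat) \<Rightarrow> bool" where
  "polynomial_function f \<longleftrightarrow>
     (\<exists>p :: real poly. mono (\<lambda>n::nat. poly p (real n)) \<and>
        (\<lambda>n. real (f n)) \<preceq> (\<lambda>n. poly p (real n)))"

end

theory Submission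
  imports Defs "HOL-Library.Countable"
begin

text \<open>
  The presentation is a deterministic device written as a Thue system.  Its letters are of four
  kinds: letters to the left of a head, heads, letters to the right of a head, and one zero letter.
  The relations are local steps of the head, which exchange two adjacent letters for two others, and
  relations that replace by zero any two adjacent letters that do not fit the pattern ``left letters,
  at most one head, right letters'', as well as the accepting head.  A step of the head keeps the
  length, and a word that becomes zero can be shrunk to the single zero letter.  So two equal words of
  length at most \<open>n\<close> are joined by a derivation inside the words of length at most \<open>n\<close>
  (\<open>equivalent_short_steps\<close>), and the space function is bounded by the identity.

  A word that is not yet zero contains at most one head, hence at most one place where a step
  applies, and by the argument of Post the symmetric closure of a deterministic step is easy to
  describe: two words are equal iff both eventually become zero or their forward orbits meet
  (\<open>equal_in_relators\<close>).  Over an alphabet with \<open>b\<close> letters the orbit of a word of length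
  at most \<open>n\<close> is on its cycle after \<open>b ^ n\<close> steps.  Thus it suffices to run both words for
  \<open>b ^ n\<close> steps and then one of them for another \<open>b ^ n\<close> steps, comparing all the while; a
  counter in base \<open>b\<close> with \<open>n\<close> digits measures the time.  This puts the word problem into
  PSPACE (\<open>word_problem_in_PSPACE\<close>).

  For hardness the head is an interpreter.  The word of an input consists of a program and a row of
  bits; the head walks to and fro between the current instruction and the current bit.  A Turing
  machine \<open>M\<close> is compiled into a program whose row of bits has one block for each tape cell, the
  block listing in unary the state and the symbol of the cell.  When \<open>M\<close> accepts, the head
  becomes the accepting head and the word is zero; when \<open>M\<close> rejects, the head runs off the end
  of the program and stops for ever, and the word is not zero (\<open>simulation\<close>).  Only the program
  depends on \<open>M\<close>, the rules of the head do not.  If \<open>M\<close> needs space \<open>p\<close>, an input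
  \<open>w\<close> is therefore accepted iff the word with at least \<open>p (length w)\<close> blocks equals zero
  (\<open>PSPACE_hard\<close>), and it remains to write down that word in polynomial time.

  The two machines needed, the one that decides the word problem and the one that computes the
  reduction, have the same shape: they sweep over the input from right to left and back, transform
  it like a Mealy machine, and may append a string on the right after each sweep.  The first section
  turns such a description into a Turing machine once and for all.
\<close>

section \<open>Turing machines that sweep over their input\<close>

fun mealy :: "('s \<Rightarrow> 'd \<Rightarrow> 's \<times> 'e) \<Rightarrow> 's \<Rightarrow> 'd list \<Rightarrow> 's \<times> 'e list" where
  "mealy f s [] = (s, [])"
| "mealy f s (d # ds) =
     (let (s1, d1) = f s d; (s2, ds2) = mealy f s1 ds in (s2, d1 # ds2))"

definition rmealy :: "('s \<Rightarrow> 'd \<Rightarrow> 's \<times> 'e) \<Rightarrow> 's \<Rightarrow> 'd list \<Rightarrow> 's \<times> 'e list" where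
  "rmealy f s ds = map_prod id rev (mealy f s (rev ds))"

lemma length_mealy: "mealy f s ds = (s', ds') \<Longrightarrow> length ds' = length ds"
  by (induction ds arbitrary: s ds') (auto simp: Let_def split: prod.splits)

lemma rmealyE:
  assumes "rmealy f s ds = (s', ds')" shows "mealy f s (rev ds) = (s', rev ds')"
  using assms by (cases "mealy f s (rev ds)") (auto simp: rmealy_def)

lemma length_rmealy: "rmealy f s ds = (s', ds') \<Longrightarrow> length ds' = length ds"
  by (auto dest!: rmealyE length_mealy)

lemma mealy_append:
  "mealy f s (xs @ ys) =
     (let (s1, xs') = mealy f s xs; (s2, ys') = mealy f s1 ys in (s2, xs' @ ys'))"
  by (induction xs arbitrary: s) (auto simp: Let_def split: prod.splits)

lemma rmealy_Nil [simp]: "rmealy f s [] = (s, [])"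
  by (simp add: rmealy_def)

lemma rmealy_Cons [simp]:
  "rmealy f s (d # ds) = (let (s1, ds1) = rmealy f s ds; (s2, d2) = f s1 d in (s2, d2 # ds1))"
  by (auto simp: rmealy_def mealy_append Let_def split: prod.splits)

lemma rmealy_append:
  "rmealy f s (xs @ ys) =
     (let (s1, ys') = rmealy f s ys; (s2, xs') = rmealy f s1 xs in (s2, xs' @ ys'))"
  by (auto simp: rmealy_def mealy_append Let_def split: prod.splits)

lemma mealy_stable:
  assumes "\<And>x. x \<in> set xs \<Longrightarrow> f s (g x) = (s, h x)"
  shows "mealy f s (map g xs) = (s, map h xs)"
  using assms by (induction xs) auto

lemma rmealy_stable:
  assumes "\<And>x. x \<in> set xs \<Longrightarrow> f s (g x) = (s, h x)"
  shows "rmealy f s (map g xs) = (s, map h xs)"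
  using assms by (induction xs) auto

text \<open>
  The finite control of a machine that first converts its input into a row of data cells and then
  repeats: a pass to the left over everything written so far, a decision at the left end, a pass to the
  right, and an emission after the last written cell.  It ends with a pass that turns the data cells
  into output.  The left end of a tape cannot be detected by moving, so the first data cell carries
  a mark (the boolean in \<open>Cell\<close>).
\<close>

datatype 's control =
  Begin_run | Convert | Go_left 's | Go_right 's | Write "nat list" 's | Finish bool
| Write_only "nat list" | Halt bool

instance control :: (countable) countable by countable_datatype

datatype 'd cell = Raw nat | Cell bool 'd

text \<open>
  \<open>Inl\<close> at the left end stops the machine with a verdict, \<open>Inr\<close> starts the pass to
  the right.  \<open>N\<close> bounds the tape symbols of input and output, \<open>B\<close> the length of an
  emission.  On the empty input there is no data cell to mark; its output and verdict are
  given separately.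
\<close>

locale sweeper =
  fixes S :: "'s::countable set" and D :: "'d::countable set" and B N :: nat
    and \<Sigma> :: "nat set"
    and conv :: "nat \<Rightarrow> 'd" and s0 :: 's
    and pass_left :: "'s \<Rightarrow> 'd \<Rightarrow> 's \<times> 'd" and at_left :: "'s \<Rightarrow> bool + 's"
    and pass_right :: "'s \<Rightarrow> 'd \<Rightarrow> 's \<times> 'd" and at_right :: "'s \<Rightarrow> nat list \<times> 's"
    and out :: "'d \<Rightarrow> nat" and out_empty :: "nat list" and verdict_empty :: bool
  assumes finite_S: "finite S" and finite_D: "finite D" and s0: "s0 \<in> S"
    and \<Sigma>: "\<Sigma> \<subseteq> {1..N}"
    and conv: "a \<le> N \<Longrightarrow> conv a \<in> D"
    and pass_left: "s \<in> S \<Longrightarrow> d \<in> D \<Longrightarrow> pass_left s d \<in> S \<times> D"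
    and pass_right: "s \<in> S \<Longrightarrow> d \<in> D \<Longrightarrow> pass_right s d \<in> S \<times> D"
    and at_left: "s \<in> S \<Longrightarrow> at_left s = Inr s' \<Longrightarrow> s' \<in> S"
    and at_right: "s \<in> S \<Longrightarrow> at_right s \<in> {e \<in> lists {1..N}. length e \<le> B} \<times> S"
    and out: "d \<in> D \<Longrightarrow> out d \<in> {1..N}"
    and out_empty: "out_empty \<in> lists {1..N}" "length out_empty \<le> B"
begin

fun step :: "'s control \<Rightarrow> 'd cell \<Rightarrow> 's control \<times> 'd cell \<times> move" where
  "step Begin_run (Raw a) =
     (if a = 0 then (Write_only out_empty, Raw 0, Stay)
      else (Convert, Cell True (conv a), MoveRight))"
| "step Convert (Raw a) =
     (if a = 0 then (Go_left s0, Raw 0, MoveLeft) else (Convert, Cell False (conv a), MoveRight))"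
| "step (Go_left s) (Raw a) = (Go_left s, Raw a, MoveLeft)"
| "step (Go_left s) (Cell b d) =
     (let (s', d') = pass_left s d in
      if b then (case at_left s' of Inl r \<Rightarrow> Finish r | Inr s'' \<Rightarrow> Go_right s'', Cell b d', Stay)
      else (Go_left s', Cell b d', MoveLeft))"
| "step (Go_right s) (Cell b d) =
     (let (s', d') = pass_right s d in (Go_right s', Cell b d', MoveRight))"
| "step (Go_right s) (Raw a) =
     (if a = 0 then (let (e, s') = at_right s in (Write e s', Raw 0, Stay))
      else (Go_right s, Raw a, MoveRight))"
| "step (Write [] s) g = (Go_left s, g, MoveLeft)"
| "step (Write (a # e) s) g = (Write e s, Raw a, MoveRight)"
| "step (Finish r) (Cell b d) = (Finish r, Raw (out d), MoveRight)"
| "step (Finish r) (Raw a) = (Halt r, Raw a, Stay)"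
| "step (Write_only []) g = (Halt verdict_empty, g, Stay)"
| "step (Write_only (a # e)) g = (Write_only e, Raw a, MoveRight)"
| "step q g = (q, g, Stay)"

text \<open>
  Input and output symbols stand for themselves, as the machine model demands; data cells are
  numbered above them.
\<close>

fun enc :: "'d cell \<Rightarrow> nat" where
  "enc (Raw a) = a"
| "enc (Cell b d) = Suc (N + to_nat (b, d))"

definition dec :: "nat \<Rightarrow> 'd cell" where
  "dec x = (if x \<le> N then Raw x else case_prod Cell (from_nat (x - Suc N)))"

fun valid :: "'d cell \<Rightarrow> bool" where
  "valid (Raw a) \<longleftrightarrow> a \<le> N"
| "valid (Cell b d) \<longleftrightarrow> True"

lemma dec_enc [simp]: "valid g \<Longrightarrow> dec (enc g) = g"
  by (cases g) (auto simp: dec_def)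

definition emissions :: "nat list set" where
  "emissions = {e \<in> lists {1..N}. length e \<le> B}"

definition controls :: "'s control set" where
  "controls = {Begin_run, Convert} \<union> Go_left ` S \<union> Go_right ` S \<union>
     case_prod Write ` (emissions \<times> S) \<union> range Finish \<union> Write_only ` emissions \<union> range Halt"

definition cells :: "'d cell set" where
  "cells = Raw ` {0..N} \<union> case_prod Cell ` (UNIV \<times> D)"

definition machine :: tm where
  "machine = \<lparr>states = to_nat ` controls, tape_alphabet = enc ` cells,
     delta = (\<lambda>q a. case step (from_nat q) (dec a) of (q', g, m) \<Rightarrow> (to_nat q', enc g, m)),
     start = to_nat (Begin_run :: 's control), accept = to_nat (Halt True :: 's control),
     reject = to_nat (Halt False :: 's control)\<rparr>"

lemma valid_cells: "g \<in> cells \<Longrightarrow> valid g"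
  by (auto simp: cells_def)

lemma emissions_tl: "a # e \<in> emissions \<Longrightarrow> a \<in> {1..N} \<and> e \<in> emissions"
  by (auto simp: emissions_def)

lemma Write_controls: "Write e s \<in> controls \<longleftrightarrow> e \<in> emissions \<and> s \<in> S"
  by (auto simp: controls_def)
lemma Write_only_controls: "Write_only e \<in> controls \<longleftrightarrow> e \<in> emissions"
  by (auto simp: controls_def)
lemma Go_left_controls: "Go_left s \<in> controls \<longleftrightarrow> s \<in> S"
  by (auto simp: controls_def)
lemma Go_right_controls: "Go_right s \<in> controls \<longleftrightarrow> s \<in> S"
  by (auto simp: controls_def)
lemma simple_controls: "Begin_run \<in> controls" "Convert \<in> controls" "Finish r \<in> controls"
  "Halt r \<in> controls"
  by (auto simp: controls_def)
lemma Raw_cells: "Raw a \<in> cells \<longleftrightarrow> a \<le> N"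
  by (auto simp: cells_def)
lemma Cell_cells: "Cell b d \<in> cells \<longleftrightarrow> d \<in> D"
  by (auto simp: cells_def)

lemmas closure_simps = Write_controls Write_only_controls Go_left_controls Go_right_controls
  simple_controls Raw_cells Cell_cells

lemma step_closed:
  assumes q: "q \<in> controls" and g: "g \<in> cells"
  shows "step q g \<in> controls \<times> cells \<times> UNIV"
proof -
  have s0c: "Go_left s0 \<in> controls" using s0 by (simp add: closure_simps)
  have oe: "Write_only out_empty \<in> controls"
    using out_empty by (simp add: closure_simps emissions_def)
  have em: "at_right s \<in> emissions \<times> S" if "s \<in> S" for s
    using at_right[OF that] by (simp add: emissions_def)
  show ?thesis
    using q g
  proof (cases "(q, g)" rule: step.cases)
    case (4 s b d)
    then have "s \<in> S" "d \<in> D" using q g by (auto simp: closure_simps)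
    with pass_left[of s d] 4 at_left show ?thesis
      by (auto simp: closure_simps Let_def split: prod.splits sum.splits)
  next
    case (5 s b d)
    then have "s \<in> S" "d \<in> D" using q g by (auto simp: closure_simps)
    with pass_right[of s d] 5 show ?thesis
      by (auto simp: closure_simps Let_def split: prod.splits)
  next
    case (6 s a)
    then have "s \<in> S" using q by (auto simp: closure_simps)
    with em[of s] 6 g show ?thesis
      by (auto simp: closure_simps Let_def split: prod.splits)
  next
    case (9 r b d)
    then have "d \<in> D" using g by (auto simp: closure_simps)
    with out[of d] 9 show ?thesis by (auto simp: closure_simps)
  qed (use s0c oe conv in \<open>auto simp: closure_simps dest: emissions_tl\<close>)
qed

lemma finite_emissions: "finite emissions"
  using finite_lists_length_le[of "{1..N}" B]
  by (rule finite_subset[rotated]) (auto simp: emissions_def)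
  
lemma wf_machine: "wf_tm \<Sigma> machine"
proof -
  have fin: "finite controls" "finite cells"
    using finite_S finite_D finite_emissions by (auto simp: controls_def cells_def)
  have 0: "blank \<in> enc ` cells"
    by (rule image_eqI[of _ _ "Raw 0"]) (auto simp: closure_simps)
  have 1: "\<Sigma> \<subseteq> enc ` cells - {blank}"
  proof
    fix a assume "a \<in> \<Sigma>"
    then have "a \<in> {1..N}" using \<Sigma> by blast
    then have "a = enc (Raw a)" "Raw a \<in> cells" "a \<noteq> 0" by (auto simp: closure_simps)
    then show "a \<in> enc ` cells - {blank}" by blast
  qed
  have 2: "delta machine (to_nat q) (enc g) \<in> to_nat ` controls \<times> enc ` cells \<times> UNIV"
    if "q \<in> controls" "g \<in> cells" for q g
    using step_closed[OF that] valid_cells[OF that(2)]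
    by (auto simp: machine_def split: prod.splits)
  show ?thesis
    unfolding wf_tm_def using fin 0 1 2
    by (auto simp: machine_def closure_simps)
qed

text \<open>
  A tape split at the head, the part to the left reversed.  Blanks at the end of the list make no
  difference (\<open>cfg_blank\<close>), so the empty right part stands for the blank region.
\<close>

definition cfg :: "'s control \<Rightarrow> 'd cell list \<Rightarrow> 'd cell list \<Rightarrow> config" where
  "cfg q ls rs = \<lparr>state = to_nat q, head = length ls, tape = tape_of (map enc (rev ls @ rs))\<rparr>"

definition steps_within :: "nat \<Rightarrow> config \<Rightarrow> config \<Rightarrow> bool" where
  "steps_within b c c' \<longleftrightarrow> (\<exists>t\<le>b. (tm_step machine ^^ t) c = c')"

lemma steps_within_refl: "steps_within b c c"
  by (auto simp: steps_within_def intro!: exI[of _ 0])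

lemma steps_within_trans:
  assumes "steps_within a c d" "steps_within b d e" shows "steps_within (a + b) c e"
proof -
  obtain t u where "t \<le> a" "(tm_step machine ^^ t) c = d" "u \<le> b" "(tm_step machine ^^ u) d = e"
    using assms by (auto simp: steps_within_def)
  then show ?thesis unfolding steps_within_def
    by (intro exI[of _ "u + t"]) (auto simp: funpow_add)
qed

lemma steps_within_mono: "steps_within a c d \<Longrightarrow> a \<le> b \<Longrightarrow> steps_within b c d"
  unfolding steps_within_def using order_trans by blast

lemma steps_within_step: "tm_step machine c = d \<Longrightarrow> steps_within 1 c d"
  by (auto simp: steps_within_def intro!: exI[of _ 1])

lemma steps_within_Suc: "tm_step machine c = d \<Longrightarrow> steps_within b d e \<Longrightarrow> steps_within (Suc b) c e"
  using steps_within_trans[OF steps_within_step] by fastforce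

lemma halted_cfg: "halted machine (cfg q ls rs) \<longleftrightarrow> (\<exists>r. q = Halt r)"
proof -
  have "(\<exists>r. q = Halt r) \<longleftrightarrow> q = Halt True \<or> q = Halt False"
    by (metis (full_types))
  then show ?thesis by (auto simp: halted_def machine_def cfg_def)
qed

lemma tape_of_nth: "tape_of (xs @ y # ys) (length xs) = y"
  by (simp add: tape_of_def)

lemma tape_of_upd: "(tape_of (xs @ y # ys))(length xs := z) = tape_of (xs @ z # ys)"
  by (auto simp: tape_of_def nth_append fun_eq_iff nth_Cons')

lemma cfg_blank: "cfg q ls (rs @ [Raw 0]) = cfg q ls rs"
  by (auto simp: cfg_def tape_of_def fun_eq_iff nth_append nth_Cons')

lemma cfg_blank_Nil: "cfg q ls [Raw 0] = cfg q ls []"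
  using cfg_blank[of q ls "[]"] by simp

lemma cfg_step:
  assumes "valid x" and st: "step q x = (q', y, m)" and nh: "\<And>r. q \<noteq> Halt r"
  shows "tm_step machine (cfg q ls (x # rs)) =
     (case m of Stay \<Rightarrow> cfg q' ls (y # rs) | MoveRight \<Rightarrow> cfg q' (y # ls) rs
      | MoveLeft \<Rightarrow> (case ls of [] \<Rightarrow> cfg q' [] (y # rs) | l # ls' \<Rightarrow> cfg q' ls' (l # y # rs)))"
proof -
  have hd: "tape (cfg q ls (x # rs)) (head (cfg q ls (x # rs))) = enc x"
    using tape_of_nth[of "rev (map enc ls)" "enc x" "map enc rs"] by (simp add: cfg_def rev_map)
  have up: "(tape (cfg q ls (x # rs)))(head (cfg q ls (x # rs)) := enc y)
     = tape_of (map enc (rev ls @ y # rs))"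
    using tape_of_upd[of "rev (map enc ls)" "enc x" "map enc rs" "enc y"]
    by (simp add: cfg_def rev_map)
  have de: "delta machine (state (cfg q ls (x # rs))) (enc x) = (to_nat q', enc y, m)"
    using st assms(1) by (simp add: machine_def cfg_def)
  have "tm_step machine (cfg q ls (x # rs)) =
     \<lparr>state = to_nat q', head = move_head m (length ls), tape = tape_of (map enc (rev ls @ y # rs))\<rparr>"
    using nh unfolding tm_step_def hd de
    by (simp add: halted_cfg up) (simp add: cfg_def)
  then show ?thesis by (cases m) (auto simp: cfg_def split: list.splits)
qed

lemmas right_step = cfg_step[where m = MoveRight, simplified]
lemmas left_step = cfg_step[where m = MoveLeft and ls = "l # ls" for l ls, simplified]
lemmas stay_step = cfg_step[where m = Stay, simplified]

text \<open>The head stands on the top of the nonempty stack of cells to its left.\<close>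
definition lcfg :: "'s control \<Rightarrow> 'd cell list \<Rightarrow> 'd cell list \<Rightarrow> config" where
  "lcfg q zs rs = cfg q (tl zs) (hd zs # rs)"

text \<open>
  Every pass to the right that keeps its control state is an instance of this loop.
\<close>

lemma right_loop:
  assumes "\<And>x. x \<in> set xs \<Longrightarrow> valid (g x) \<and> step q (g x) = (q, h x, MoveRight)"
    and nh: "\<And>r. q \<noteq> Halt r"
  shows "steps_within (length xs) (cfg q ls (map g xs @ rs)) (cfg q (rev (map h xs) @ ls) rs)"
  using assms(1)
proof (induction xs arbitrary: ls)
  case (Cons x xs)
  have "tm_step machine (cfg q ls (g x # map g xs @ rs)) = cfg q (h x # ls) (map g xs @ rs)"
    by (rule right_step) (use Cons.prems nh in auto)
  from steps_within_Suc[OF this Cons.IH] Cons.prems show ?case by simp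
qed (simp add: steps_within_refl)

lemma go_left_raw:
  "set e \<subseteq> {..N} \<Longrightarrow> steps_within (length e) (lcfg (Go_left s) (map Raw e @ z # zs) rs)
     (lcfg (Go_left s) (z # zs) (rev (map Raw e) @ rs))"
proof (induction e arbitrary: rs)
  case Nil then show ?case by (simp add: steps_within_refl)
next
  case (Cons a e)
  obtain z' zs' where z: "map Raw e @ z # zs = z' # zs'" by (cases e) auto
  have "tm_step machine (cfg (Go_left s) (z' # zs') (Raw a # rs))
      = cfg (Go_left s) zs' (z' # Raw a # rs)"
    by (rule left_step) (use Cons.prems in auto)
  then have "tm_step machine (lcfg (Go_left s) (map Raw (a # e) @ z # zs) rs)
      = lcfg (Go_left s) (map Raw e @ z # zs) (Raw a # rs)"
    by (simp add: lcfg_def z)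
  from steps_within_Suc[OF this Cons.IH] Cons.prems show ?case by simp
qed

lemma go_left_cells:
  "mealy pass_left s (rds @ [d]) = (s1, rds' @ [d']) \<Longrightarrow>
   steps_within (Suc (length rds)) (lcfg (Go_left s) (map (Cell False) rds @ [Cell True d]) rs)
     (cfg (case at_left s1 of Inl r \<Rightarrow> Finish r | Inr s' \<Rightarrow> Go_right s') []
        (Cell True d' # rev (map (Cell False) rds') @ rs))"
proof (induction rds arbitrary: s rds' rs)
  case Nil
  from Nil length_mealy[OF Nil] have rd: "rds' = []" and p: "pass_left s d = (s1, d')"
    by (auto simp: Let_def split: prod.splits)
  have "tm_step machine (cfg (Go_left s) [] (Cell True d # rs))
      = cfg (case at_left s1 of Inl r \<Rightarrow> Finish r | Inr s' \<Rightarrow> Go_right s') [] (Cell True d' # rs)"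
    by (rule stay_step) (auto simp: p)
  from steps_within_step[OF this] show ?case by (simp add: lcfg_def rd)
next
  case (Cons x rds)
  obtain s2 x' where p: "pass_left s x = (s2, x')" by fastforce
  obtain s3 ys where m: "mealy pass_left s2 (rds @ [d]) = (s3, ys)" by fastforce
  from length_mealy[OF m] have "ys \<noteq> []" by auto
  with Cons.prems p m obtain rds'' where r: "rds' = x' # rds''" "ys = rds'' @ [d']" "s3 = s1"
    by (cases rds') (auto simp: Let_def)
  obtain z zs where z: "map (Cell False) rds @ [Cell True d] = z # zs" by (cases rds) auto
  have "tm_step machine (cfg (Go_left s) (z # zs) (Cell False x # rs))
      = cfg (Go_left s2) zs (z # Cell False x' # rs)"
    by (rule left_step) (auto simp: p)
  then have st: "tm_step machine (lcfg (Go_left s) (map (Cell False) (x # rds) @ [Cell True d]) rs)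
      = lcfg (Go_left s2) (map (Cell False) rds @ [Cell True d]) (Cell False x' # rs)"
    by (simp add: lcfg_def z)
  from steps_within_Suc[OF st Cons.IH[OF m[unfolded r]]] show ?case by (simp add: r)
qed

lemma go_right_cells:
  "mealy pass_right s (map snd gs) = (s1, ds') \<Longrightarrow>
   steps_within (length gs) (cfg (Go_right s) ls (map (case_prod Cell) gs @ rs))
     (cfg (Go_right s1) (rev (map2 Cell (map fst gs) ds') @ ls) rs)"
proof (induction gs arbitrary: s ds' ls)
  case Nil then show ?case by (simp add: steps_within_refl)
next
  case (Cons g gs)
  obtain b d where g: "g = (b, d)" by (cases g)
  obtain s2 x' where p: "pass_right s d = (s2, x')" by fastforce
  obtain s3 ys where m: "mealy pass_right s2 (map snd gs) = (s3, ys)" by fastforce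
  from Cons.prems p m g have r: "ds' = x' # ys" "s3 = s1" by (auto simp: Let_def)
  have "tm_step machine (cfg (Go_right s) ls (Cell b d # map (case_prod Cell) gs @ rs))
      = cfg (Go_right s2) (Cell b x' # ls) (map (case_prod Cell) gs @ rs)"
    by (rule right_step) (auto simp: p)
  from steps_within_Suc[OF this Cons.IH[OF m[unfolded r]]] show ?case by (simp add: r g)
qed

lemma write_pass:
  "set e \<subseteq> {1..N} \<Longrightarrow> steps_within (length e) (cfg (Write e s) ls [])
     (cfg (Write [] s) (rev (map Raw e) @ ls) [])"
proof (induction e arbitrary: ls)
  case Nil then show ?case by (simp add: steps_within_refl)
next
  case (Cons a e)
  have "tm_step machine (cfg (Write (a # e) s) ls [Raw 0]) = cfg (Write e s) (Raw a # ls) []"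
    by (rule right_step) auto
  then have "tm_step machine (cfg (Write (a # e) s) ls []) = cfg (Write e s) (Raw a # ls) []"
    by (simp add: cfg_blank_Nil)
  from steps_within_Suc[OF this Cons.IH] Cons.prems show ?case by simp
qed

lemma write_only_pass:
  "set e \<subseteq> {1..N} \<Longrightarrow> steps_within (length e) (cfg (Write_only e) ls [])
     (cfg (Write_only []) (rev (map Raw e) @ ls) [])"
proof (induction e arbitrary: ls)
  case Nil then show ?case by (simp add: steps_within_refl)
next
  case (Cons a e)
  have "tm_step machine (cfg (Write_only (a # e)) ls [Raw 0]) = cfg (Write_only e) (Raw a # ls) []"
    by (rule right_step) auto
  then have "tm_step machine (cfg (Write_only (a # e)) ls []) = cfg (Write_only e) (Raw a # ls) []"
    by (simp add: cfg_blank_Nil)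
  from steps_within_Suc[OF this Cons.IH] Cons.prems show ?case by simp
qed

lemma mealy_closed:
  assumes f: "\<And>s d. s \<in> S \<Longrightarrow> d \<in> D \<Longrightarrow> f s d \<in> S \<times> D"
    and "s \<in> S" "set ds \<subseteq> D" "mealy f s ds = (s', ds')"
  shows "s' \<in> S \<and> set ds' \<subseteq> D"
  using assms(2-)
proof (induction ds arbitrary: s s' ds')
  case Nil then show ?case by simp
next
  case (Cons d ds)
  obtain s1 d1 where 1: "f s d = (s1, d1)" by fastforce
  obtain s2 ds2 where 2: "mealy f s1 ds = (s2, ds2)" by fastforce
  from f[of s d] 1 Cons.prems have "s1 \<in> S" "d1 \<in> D" by auto
  with Cons.IH[OF _ _ 2] Cons.prems 1 2 show ?case by (auto simp: Let_def)
qed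

text \<open>
  One round of the machine, seen from the right end: the states, the data and the emitted string
  before and after.
\<close>

inductive sweep :: "'s \<times> 'd list \<times> nat list \<Rightarrow> 's \<times> 'd list \<times> nat list \<Rightarrow> bool" where
  "rmealy pass_left s ds = (s1, ds1) \<Longrightarrow> at_left s1 = Inr s2 \<Longrightarrow>
   mealy pass_right s2 ds1 = (s3, ds3) \<Longrightarrow> at_right s3 = (e, s4) \<Longrightarrow>
   sweep (s, ds, xs) (s4, ds3, xs @ e)"

definition proper :: "'s \<times> 'd list \<times> nat list \<Rightarrow> bool" where
  "proper = (\<lambda>(s, ds, xs). s \<in> S \<and> ds \<noteq> [] \<and> set ds \<subseteq> D \<and> set xs \<subseteq> {1..N})"

definition marked :: "'d list \<Rightarrow> 'd cell list" where
  "marked ds = Cell True (hd ds) # map (Cell False) (tl ds)"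

lemma marked_conv: "ds \<noteq> [] \<Longrightarrow>
  marked ds = map (case_prod Cell) (zip (True # replicate (length ds - 1) False) ds)"
proof -
  have "map (Cell False) xs = map (case_prod Cell) (zip (replicate (length xs) False) xs)" for xs
    by (induction xs) auto
  then show "ds \<noteq> [] \<Longrightarrow> ?thesis" by (cases ds) (auto simp: marked_def)
qed

definition right_end :: "'s \<times> 'd list \<times> nat list \<Rightarrow> config" where
  "right_end = (\<lambda>(s, ds, xs). lcfg (Go_left s) (rev (marked ds @ map Raw xs)) [])"

lemma left_pass:
  assumes "proper (s, ds, xs)" and m: "rmealy pass_left s ds = (s1, ds1)"
  shows "steps_within (length ds + length xs) (right_end (s, ds, xs))
     (cfg (case at_left s1 of Inl r \<Rightarrow> Finish r | Inr s' \<Rightarrow> Go_right s') []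
        (marked ds1 @ map Raw xs))"
proof -
  obtain d rest where ds: "ds = d # rest" using assms by (cases ds) (auto simp: proper_def)
  obtain d' rest' where ds1: "ds1 = d' # rest'" using length_rmealy[OF m] ds by (cases ds1) auto
  have m': "mealy pass_left s (rev rest @ [d]) = (s1, rev rest' @ [d'])"
    using rmealyE[OF m] by (simp add: ds ds1)
  obtain z zs where z: "map (Cell False) (rev rest) @ [Cell True d] = z # zs" by (cases "rev rest") auto
  have 1: "steps_within (length xs) (right_end (s, ds, xs)) 
      (lcfg (Go_left s) (map (Cell False) (rev rest) @ [Cell True d]) (map Raw xs))"
    using go_left_raw[of "rev xs" s z zs "[]"] assms(1)
    by (simp add: right_end_def marked_def ds rev_map z[symmetric] proper_def) force
  have "steps_within (length xs + Suc (length (rev rest))) (right_end (s, ds, xs))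
     (cfg (case at_left s1 of Inl r \<Rightarrow> Finish r | Inr s' \<Rightarrow> Go_right s') []
        (Cell True d' # rev (map (Cell False) (rev rest')) @ map Raw xs))"
    by (rule steps_within_trans[OF 1 go_left_cells[OF m']])
  then show ?thesis by (simp add: ds ds1 marked_def rev_map add.commute)
qed

text \<open>
  The cost of one round is linear in the written part of the tape, measured after the round because
  the emission of the round is to be included.
\<close>

lemma sweep_within:
  assumes "sweep c c'" and "proper c"
  shows "proper c' \<and> length (fst (snd c')) = length (fst (snd c)) \<and>
     length (snd (snd c)) \<le> length (snd (snd c')) \<and>
     steps_within (2 * (length (fst (snd c')) + length (snd (snd c'))) + 2) (right_end c) (right_end c')"
  using assms
proof cases
  case (1 s ds s1 ds1 s2 s3 ds3 e s4 xs)
  have pr: "s \<in> S" "ds \<noteq> []" "set ds \<subseteq> D" "set xs \<subseteq> {1..N}"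
    using assms(2) by (auto simp: proper_def 1)
  have c1: "s1 \<in> S" "set ds1 \<subseteq> D"
    using mealy_closed[OF pass_left pr(1) _ rmealyE[OF 1(3)]] pr(3) by auto
  have c2: "s2 \<in> S" using at_left[OF c1(1) 1(4)] .
  have c3: "s3 \<in> S" "set ds3 \<subseteq> D" using mealy_closed[OF pass_right c2 c1(2) 1(5)] by auto
  have c4: "s4 \<in> S" "set e \<subseteq> {1..N}" using at_right[OF c3(1)] 1(6) by auto
  have len: "length ds1 = length ds" "length ds3 = length ds"
    using length_rmealy[OF 1(3)] length_mealy[OF 1(5)] by auto
  have ne: "ds1 \<noteq> []" "ds3 \<noteq> []" using len pr by auto
  let ?bs = "True # replicate (length ds - 1) False"
  have lb: "length ?bs = length ds" using pr(2) by (cases ds) auto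
  have L: "steps_within (length ds + length xs) (right_end c)
      (cfg (Go_right s2) [] (marked ds1 @ map Raw xs))"
    using left_pass[OF assms(2)[unfolded 1(1)] 1(3)] by (simp add: 1(1,4))
  have mz: "mealy pass_right s2 (map snd (zip ?bs ds1)) = (s3, ds3)"
    using 1(5) lb len by (simp del: replicate_Suc)
  have R1: "steps_within (length ds) (cfg (Go_right s2) [] (marked ds1 @ map Raw xs))
      (cfg (Go_right s3) (rev (marked ds3)) (map Raw xs))"
  proof -
    have "map fst (zip ?bs ds1) = ?bs" using lb len by simp
    then show ?thesis
      using go_right_cells[OF mz, of "[]" "map Raw xs"] lb len pr
      by (simp add: marked_conv[OF ne(1)] marked_conv[OF ne(2)] del: zip_Cons_Cons)
  qed
  have R2: "steps_within (length xs) (cfg (Go_right s3) (rev (marked ds3)) (map Raw xs))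
      (cfg (Go_right s3) (rev (marked ds3 @ map Raw xs)) [])"
    using right_loop[of xs Raw "Go_right s3" Raw "rev (marked ds3)" "[]"] pr(4) by fastforce
  have R3: "tm_step machine (cfg (Go_right s3) ls []) = cfg (Write e s4) ls []" for ls
  proof -
    have "tm_step machine (cfg (Go_right s3) ls [Raw 0]) = cfg (Write e s4) ls [Raw 0]"
      by (rule stay_step) (auto simp: 1(6))
    then show ?thesis by (simp add: cfg_blank_Nil)
  qed
  have R4: "steps_within (length e) (cfg (Write e s4) (rev (marked ds3 @ map Raw xs)) [])
      (cfg (Write [] s4) (rev (marked ds3 @ map Raw (xs @ e))) [])"
    using write_pass[OF c4(2), of s4 "rev (marked ds3 @ map Raw xs)"] by simp
  have R5: "tm_step machine (cfg (Write [] s4) (rev (marked ds3 @ map Raw (xs @ e))) [])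
      = right_end c'"
  proof -
    obtain z zs where z: "rev (marked ds3 @ map Raw (xs @ e)) = z # zs"
      by (cases "rev (marked ds3 @ map Raw (xs @ e))") (auto simp: marked_def)
    have "tm_step machine (cfg (Write [] s4) (z # zs) [Raw 0]) = cfg (Go_left s4) zs [z, Raw 0]"
      by (rule left_step) auto
    then show ?thesis unfolding 1(2) right_end_def prod.case lcfg_def z
      using cfg_blank[of "Go_left s4" zs "[z]"] by (simp add: cfg_blank_Nil)
  qed
  have "steps_within ((length ds + length xs) + (length ds + (length xs + Suc (length e + 1))))
     (right_end c) (right_end c')"
    by (rule steps_within_trans[OF L steps_within_trans[OF R1 steps_within_trans[OF R2
          steps_within_Suc[OF R3 steps_within_trans[OF R4 steps_within_step[OF R5]]]]]])
  then have "steps_within (2 * (length (fst (snd c')) + length (snd (snd c'))) + 2) (right_end c) (right_end c')"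
    by (rule steps_within_mono) (simp add: 1(2) len)
  then show ?thesis using c3 c4 ne pr len by (auto simp: 1(1,2) proper_def)
qed

lemma sweeps_within:
  assumes "(sweep ^^ k) c c'" and "proper c"
  shows "proper c' \<and> length (fst (snd c')) = length (fst (snd c)) \<and>
     steps_within (k * (2 * (length (fst (snd c)) + length (snd (snd c'))) + 2)) (right_end c) (right_end c')"
  using assms(1)
proof (induction k arbitrary: c')
  case 0 then show ?case using assms(2) by (simp add: steps_within_refl)
next
  case (Suc k)
  then obtain b where b: "(sweep ^^ k) c b" "sweep b c'" by auto
  note IH = Suc.IH[OF b(1)]
  note st = sweep_within[OF b(2)]
  let ?m = "\<lambda>x. k * (2 * (length (fst (snd c)) + x) + 2)"
  from IH st have *: "?m (length (snd (snd b))) \<le> ?m (length (snd (snd c')))"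
    by (intro mult_le_mono2) simp
  have "steps_within (?m (length (snd (snd b))) + (2 * (length (fst (snd c')) + length (snd (snd c'))) + 2))
     (right_end c) (right_end c')"
    using IH st by (blast intro: steps_within_trans)
  then have "steps_within (Suc k * (2 * (length (fst (snd c)) + length (snd (snd c'))) + 2)) (right_end c) (right_end c')"
    by (rule steps_within_mono) (use * IH st in \<open>simp\<close>)
  with IH st show ?case by simp
qed

text \<open>
  Each round emits at most \<open>B\<close> symbols.
\<close>

lemma sweep_length:
  assumes "(sweep ^^ k) c c'" "proper c"
  shows "length (snd (snd c')) \<le> length (snd (snd c)) + k * B"
  using assms(1)
proof (induction k arbitrary: c')
  case (Suc k)
  then obtain b where b: "(sweep ^^ k) c b" "sweep b c'" by auto
  have pb: "proper b" using sweeps_within[OF b(1) assms(2)] by simp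
  from b(2) have "length (snd (snd c')) \<le> length (snd (snd b)) + B"
  proof cases
    case (1 s ds s1 ds1 s2 s3 ds3 e s4 xs)
    have "s1 \<in> S" "set ds1 \<subseteq> D"
      using mealy_closed[OF pass_left _ _ rmealyE[OF 1(3)]] pb by (auto simp: 1 proper_def)
    moreover from this have "s2 \<in> S" using at_left 1(4) by blast
    ultimately have "s3 \<in> S" using mealy_closed[OF pass_right _ _ 1(5)] by blast
    then show ?thesis using at_right[of s3] by (simp add: 1)
  qed
  with Suc.IH[OF b(1)] show ?case by simp
qed simp

lemma run_cfg:
  assumes "w \<in> lists \<Sigma>"
  shows "run machine w t = (tm_step machine ^^ t) (cfg Begin_run [] (map Raw w))"
proof -
  have "map (enc \<circ> Raw) w = w" by (induction w) auto
  then show ?thesis by (simp add: run_def cfg_def machine_def)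
qed

theorem sweeper_run:
  assumes w: "w \<in> lists \<Sigma>" "w \<noteq> []"
    and k: "(sweep ^^ k) (s0, map conv w, []) (s, ds, xs)"
    and m: "rmealy pass_left s ds = (s1, ds1)" and h: "at_left s1 = Inl r"
  shows "\<exists>t \<le> (k + 2) * (2 * (length w + length xs) + 4).
     state (run machine w t) = to_nat (Halt r :: 's control) \<and>
     tape (run machine w t) = tape_of (map out ds1 @ xs)"
proof -
  obtain a v where av: "w = a # v" using w by (cases w) auto
  have sw: "set w \<subseteq> {1..N}" using w \<Sigma> by auto
  have pr: "proper (s0, map conv w, [])"
    using w sw s0 conv by (auto simp: proper_def)
  have "tm_step machine (cfg Begin_run [] (Raw a # map Raw v)) =
      cfg Convert [Cell True (conv a)] (map Raw v)"
    by (rule right_step) (use sw av in auto)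
  then have 1: "steps_within 1 (cfg Begin_run [] (map Raw w)) (cfg Convert [Cell True (conv a)] (map Raw v))"
    using steps_within_step by (simp only: av list.map)
  have 2: "steps_within (length v) (cfg Convert [Cell True (conv a)] (map Raw v))
      (cfg Convert (rev (marked (map conv w))) [])"
    using right_loop[of v Raw Convert "Cell False \<circ> conv" "[Cell True (conv a)]" "[]"] sw
    by (fastforce simp: av marked_def)
  have 3: "tm_step machine (cfg Convert (rev (marked (map conv w))) []) = right_end (s0, map conv w, [])"
  proof -
    obtain z zs where z: "rev (marked (map conv w)) = z # zs"
      by (cases "rev (marked (map conv w))") (auto simp: marked_def)
    have "tm_step machine (cfg Convert (z # zs) [Raw 0]) = cfg (Go_left s0) zs [z, Raw 0]"
      by (rule left_step) auto
    then show ?thesis unfolding right_end_def prod.case lcfg_def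
      using cfg_blank[of "Go_left s0" zs "[z]"] by (simp add: z cfg_blank_Nil)
  qed
  note sw' = sweeps_within[OF k pr]
  have pr': "proper (s, ds, xs)" and len: "length ds = length w"
    and 4: "steps_within (k * (2 * (length w + length xs) + 2)) (right_end (s0, map conv w, [])) (right_end (s, ds, xs))"
    using sw' by auto
  have 5: "steps_within (length ds + length xs) (right_end (s, ds, xs))
      (cfg (Finish r) [] (marked ds1 @ map Raw xs))"
    using left_pass[OF pr' m] by (simp add: h)
  have len1: "length ds1 = length w" "ds1 \<noteq> []" using length_rmealy[OF m] len w by auto
  let ?gs = "zip (True # replicate (length ds1 - 1) False) ds1"
  have lg: "length ?gs = length w" "map snd ?gs = ds1"
    using len1 w by (auto simp: av simp del: replicate_Suc)
  have 6: "steps_within (length w) (cfg (Finish r) [] (marked ds1 @ map Raw xs))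
      (cfg (Finish r) (rev (map Raw (map out ds1))) (map Raw xs))"
  proof -
    have "map (Raw \<circ> out \<circ> snd) ?gs = map Raw (map out (map snd ?gs))"
      by (simp only: map_map o_assoc)
    then have e: "map (Raw \<circ> out \<circ> snd) ?gs = map Raw (map out ds1)" by (simp only: lg)
    have "steps_within (length ?gs) (cfg (Finish r) [] (map (case_prod Cell) ?gs @ map Raw xs))
        (cfg (Finish r) (rev (map (Raw \<circ> out \<circ> snd) ?gs) @ []) (map Raw xs))"
      by (rule right_loop) auto
    then show ?thesis unfolding e lg marked_conv[OF len1(2)] append_Nil2 .
  qed
  have 7: "tm_step machine (cfg (Finish r) ls (map Raw xs)) = cfg (Halt r) ls (map Raw xs)" for ls
  proof (cases xs)
    case Nil
    have "tm_step machine (cfg (Finish r) ls [Raw 0]) = cfg (Halt r) ls [Raw 0]"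
      by (rule stay_step) auto
    then show ?thesis by (simp add: cfg_blank_Nil Nil)
  next
    case (Cons x ys)
    have "tm_step machine (cfg (Finish r) ls (Raw x # map Raw ys)) = cfg (Halt r) ls (Raw x # map Raw ys)"
      by (rule stay_step) (use pr' Cons in \<open>auto simp: proper_def\<close>)
    then show ?thesis by (simp add: Cons)
  qed
  let ?final = "cfg (Halt r) (rev (map Raw (map out ds1))) (map Raw xs)"
  have "steps_within (1 + (length v + Suc (k * (2 * (length w + length xs) + 2) + (length ds + length xs + (length w + 1)))))
     (cfg Begin_run [] (map Raw w)) ?final"
    by (rule steps_within_trans[OF 1 steps_within_trans[OF 2 steps_within_Suc[OF 3
        steps_within_trans[OF 4 steps_within_trans[OF 5 steps_within_trans[OF 6 steps_within_step[OF 7]]]]]]])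
  then have "steps_within ((k + 2) * (2 * (length w + length xs) + 4)) (cfg Begin_run [] (map Raw w)) ?final"
    by (rule steps_within_mono) (simp add: av len algebra_simps)
  then obtain t where t: "t \<le> (k + 2) * (2 * (length w + length xs) + 4)"
      "(tm_step machine ^^ t) (cfg Begin_run [] (map Raw w)) = ?final"
    by (auto simp: steps_within_def)
  have "enc \<circ> Raw = id" "enc \<circ> (Raw \<circ> out) = out" by (auto simp: fun_eq_iff)
  with t run_cfg[OF w(1), of t] show ?thesis
    by (intro exI[of _ t]) (simp add: cfg_def)
qed

lemma run_empty:
  "\<exists>t \<le> B + 2. state (run machine [] t) = to_nat (Halt verdict_empty :: 's control) \<and>
     tape (run machine [] t) = tape_of out_empty"
proof -
  have "tm_step machine (cfg Begin_run [] [Raw 0]) = cfg (Write_only out_empty) [] [Raw 0]"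
    by (rule stay_step) auto
  then have 1: "tm_step machine (cfg Begin_run [] []) = cfg (Write_only out_empty) [] []"
    by (simp add: cfg_blank_Nil)
  have 2: "steps_within (length out_empty) (cfg (Write_only out_empty) [] [])
      (cfg (Write_only []) (rev (map Raw out_empty)) [])"
    using write_only_pass[of out_empty "[]"] out_empty by auto
  have "tm_step machine (cfg (Write_only []) ls [Raw 0]) = cfg (Halt verdict_empty) ls [Raw 0]" for ls
    by (rule stay_step) auto
  then have 3: "tm_step machine (cfg (Write_only []) ls []) = cfg (Halt verdict_empty) ls []" for ls
    by (simp add: cfg_blank_Nil)
  have "steps_within (Suc (length out_empty + 1)) (cfg Begin_run [] [])
     (cfg (Halt verdict_empty) (rev (map Raw out_empty)) [])"
    by (rule steps_within_Suc[OF 1 steps_within_trans[OF 2 steps_within_step[OF 3]]])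
  then have "steps_within (B + 2) (cfg Begin_run [] [])
     (cfg (Halt verdict_empty) (rev (map Raw out_empty)) [])"
    by (rule steps_within_mono) (use out_empty in simp)
  then obtain t where t: "t \<le> B + 2" "(tm_step machine ^^ t) (cfg Begin_run [] []) =
      cfg (Halt verdict_empty) (rev (map Raw out_empty)) []"
    by (auto simp: steps_within_def)
  have "map (enc \<circ> Raw) ys = ys" for ys by (induction ys) auto
  with t run_cfg[of "[]" t] show ?thesis
    by (intro exI[of _ t]) (simp add: cfg_def)
qed

lemma verdict_state:
  "to_nat (Halt r :: 's control) = (if r then accept machine else reject machine)"
  by (simp add: machine_def)

lemma halted_state: "state c = to_nat (Halt r :: 's control) \<Longrightarrow> halted machine c"
  by (cases r) (auto simp: halted_def machine_def)

text \<open>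
  With nothing ever emitted, a blank read in the first cell after the input sends every control
  state back to the left or leaves the head in place, and the blank is rewritten.  This is an
  invariant of single steps and holds at all times, also during and after the last pass.
\<close>

lemma run_head_bounded:
  assumes em: "\<And>s. s \<in> S \<Longrightarrow> fst (at_right s) = []" "out_empty = []" and w: "w \<in> lists \<Sigma>"
  shows "head (run machine w t) \<le> length w"
proof -
  let ?ok = "\<lambda>q. q \<in> controls \<and> (case q of Write e _ \<Rightarrow> e = [] | Write_only e \<Rightarrow> e = [] | _ \<Rightarrow> True)"
  let ?inv = "\<lambda>c. (\<exists>q. state c = to_nat q \<and> ?ok q) \<and> head c \<le> length w \<and>
     (\<forall>i. tape c i \<in> enc ` cells) \<and> (\<forall>i\<ge>length w. tape c i = 0)"
  have inv_step: "?inv (tm_step machine c)" if inv: "?inv c" for c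
  proof (cases "halted machine c")
    case True then show ?thesis using inv by (simp add: tm_step_def)
  next
    case False
    obtain q where q: "state c = to_nat q" "?ok q" using inv by blast
    obtain g where g: "tape c (head c) = enc g" "g \<in> cells" using inv by blast
    obtain q' g' m where st: "step q g = (q', g', m)" by (metis prod_cases3)
    have cl: "q' \<in> controls" "g' \<in> cells" using step_closed[of q g] q g st by auto
    have de: "delta machine (state c) (tape c (head c)) = (to_nat q', enc g', m)"
      using st by (simp add: machine_def q g valid_cells)
    have emS: "at_right s = (e, s') \<Longrightarrow> s \<in> S \<Longrightarrow> e = []" for s e s'
      using em(1)[of s] by simp
    have ok': "?ok q'" using cl(1) st q(2) emS
      by (cases "(q, g)" rule: step.cases)
        (auto simp: closure_simps Let_def intro: em(2) split: prod.splits sum.splits if_splits)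
    have blk: "g' = Raw 0 \<and> m \<noteq> MoveRight" if "g = Raw 0"
      using st q(2) that
      by (cases "(q, g)" rule: step.cases) (auto simp: Let_def split: prod.splits)
    have g0: "g = Raw 0" if "head c = length w"
    proof -
      have "enc g = 0" using inv g(1) that by auto
      then show ?thesis by (cases g) auto
    qed
    have hb: "move_head m (head c) \<le> length w"
    proof (cases "head c = length w")
      case True then show ?thesis using blk g0 by (cases m) auto
    next
      case False
      moreover have "head c \<le> length w" using inv by blast
      ultimately show ?thesis by (cases m) auto
    qed
    have c': "tm_step machine c = \<lparr>state = to_nat q', head = move_head m (head c),
        tape = (tape c)(head c := enc g')\<rparr>"
      using False by (simp add: tm_step_def de)
    have "\<forall>i. ((tape c)(head c := enc g')) i \<in> enc ` cells" using inv cl(2) by auto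
    moreover have "((tape c)(head c := enc g')) i = 0" if "i \<ge> length w" for i
    proof (cases "i = head c")
      case True
      moreover have "head c \<le> length w" using inv by blast
      ultimately have "head c = length w" using that by simp
      then show ?thesis using blk g0 True by simp
    next
      case False then show ?thesis using inv that by simp
    qed
    ultimately show ?thesis using ok' hb unfolding c' by auto
  qed
  have "?inv (run machine w t)"
  proof (induction t)
    case 0
    have "tape_of w i \<in> enc ` cells" for i
    proof -
      have "tape_of w i \<le> N" using w \<Sigma> nth_mem[of i w] by (fastforce simp: tape_of_def)
      then show ?thesis by (intro image_eqI[of _ _ "Raw (tape_of w i)"]) (auto simp: closure_simps)
    qed
    then show ?case
      by (auto simp: run_def machine_def tape_of_def closure_simps intro!: exI[of _ Begin_run])
  next
    case (Suc t)
    then show ?case using inv_step[of "run machine w t"] by (simp add: run_def)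
  qed
  then show ?thesis by simp
qed

theorem sweeper_in_PSPACE:
  assumes em: "\<And>s. s \<in> S \<Longrightarrow> fst (at_right s) = []" "out_empty = []"
    and L: "L \<subseteq> lists \<Sigma>" "[] \<in> L \<longleftrightarrow> verdict_empty"
    and dec: "\<And>w. w \<in> lists \<Sigma> \<Longrightarrow> w \<noteq> [] \<Longrightarrow> \<exists>s ds xs s1 ds1.
       sweep\<^sup>*\<^sup>* (s0, map conv w, []) (s, ds, xs) \<and> rmealy pass_left s ds = (s1, ds1) \<and>
       at_left s1 = Inl (w \<in> L)"
  shows "in_PSPACE \<Sigma> L"
proof -
  have "\<exists>t. state (run machine w t) = (if w \<in> L then accept machine else reject machine)"
    if w: "w \<in> lists \<Sigma>" for w
  proof (cases "w = []")
    case True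
    then show ?thesis using run_empty L(2) unfolding verdict_state by metis
  next
    case False
    from dec[OF w this] obtain s ds xs s1 ds1 where
      "sweep\<^sup>*\<^sup>* (s0, map conv w, []) (s, ds, xs)" and *: "rmealy pass_left s ds = (s1, ds1)"
      "at_left s1 = Inl (w \<in> L)" by blast
    then obtain k where "(sweep ^^ k) (s0, map conv w, []) (s, ds, xs)"
      by (auto simp: rtranclp_power)
    from sweeper_run[OF w False this *] show ?thesis unfolding verdict_state by metis
  qed
  moreover have "head (run machine w t) < poly [:1, 1:] (length w)" if "w \<in> lists \<Sigma>" for w t
    using run_head_bounded[OF em that, of t] by simp
  ultimately show ?thesis unfolding in_PSPACE_def using wf_machine L(1) by blast
qed

theorem sweeper_poly_time_computable:
  fixes K X :: "nat poly"
  assumes f: "\<And>w. w \<in> lists \<Sigma> \<Longrightarrow> f w \<in> lists \<Sigma>'" and e: "f [] = out_empty"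
    and sim: "\<And>w. w \<in> lists \<Sigma> \<Longrightarrow> w \<noteq> [] \<Longrightarrow> \<exists>k s ds xs s1 ds1 r.
       (sweep ^^ k) (s0, map conv w, []) (s, ds, xs) \<and> rmealy pass_left s ds = (s1, ds1) \<and>
       at_left s1 = Inl r \<and> f w = map out ds1 @ xs \<and>
       k \<le> poly K (length w) \<and> length xs \<le> poly X (length w)"
  shows "poly_time_computable \<Sigma> \<Sigma>' f"
proof -
  define p :: "nat poly" where "p = [:B + 2:] + (K + [:2:]) * ([:2:] * ([:0, 1:] + X) + [:4:])"
  have p: "poly p n = B + 2 + (poly K n + 2) * (2 * (n + poly X n) + 4)" for n
    by (simp add: p_def)
  have "\<exists>t \<le> poly p (length w). halted machine (run machine w t) \<and> tape (run machine w t) = tape_of (f w)"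
    if w: "w \<in> lists \<Sigma>" for w
  proof (cases "w = []")
    case True
    obtain t where "t \<le> B + 2" "state (run machine [] t) = to_nat (Halt verdict_empty :: 's control)"
      "tape (run machine [] t) = tape_of out_empty"
      using run_empty by blast
    then show ?thesis using True e halted_state by (intro exI[of _ t]) (auto simp: p)
  next
    case False
    from sim[OF w False] obtain k s ds xs s1 ds1 r where *: "(sweep ^^ k) (s0, map conv w, []) (s, ds, xs)"
      "rmealy pass_left s ds = (s1, ds1)" "at_left s1 = Inl r" and fw: "f w = map out ds1 @ xs"
       and le: "k \<le> poly K (length w)" "length xs \<le> poly X (length w)" by blast
    from sweeper_run[OF w False *] obtain t where t: "t \<le> (k + 2) * (2 * (length w + length xs) + 4)"
      "state (run machine w t) = to_nat (Halt r :: 's control)" "tape (run machine w t) = tape_of (f w)"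
      by (auto simp: fw)
    have "(k + 2) * (2 * (length w + length xs) + 4) \<le> poly p (length w)"
      unfolding p using le by (intro trans_le_add2 mult_le_mono add_le_mono le_refl) auto
    then show ?thesis using t halted_state by (intro exI[of _ t]) auto
  qed
  then show ?thesis unfolding poly_time_computable_def using wf_machine f by blast
qed

end

section \<open>Thue systems driven by a single head\<close>

lemma funpow_swap: "(f ^^ i) ((f ^^ j) x) = (f ^^ j) ((f ^^ i) x)"
  using fun_cong[OF funpow_add[of i j f], of x] fun_cong[OF funpow_add[of j i f], of x]
  by (simp add: add.commute)

datatype kind = Left_kind | Head_kind | Right_kind | Zero_kind

text \<open>
  The pairs of kinds that may be adjacent in a word of the form: left letters, at most one head,
  right letters.
\<close>

fun joins :: "kind \<Rightarrow> kind \<Rightarrow> bool" where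
  "joins Left_kind k \<longleftrightarrow> k \<noteq> Zero_kind"
| "joins Head_kind k \<longleftrightarrow> k = Right_kind"
| "joins Right_kind k \<longleftrightarrow> k = Right_kind"
| "joins Zero_kind k \<longleftrightarrow> False"

text \<open>
  A head is consistently interested in one side only: it reads the left letter before it or the
  right letter behind it.  A rule keeps the pattern of kinds.
\<close>

locale pair_rewriting =
  fixes kind :: "'a::finite \<Rightarrow> kind" and rule :: "'a \<Rightarrow> 'a \<Rightarrow> ('a \<times> 'a) option"
    and goes_right :: "'a \<Rightarrow> bool" and z acc :: 'a
  assumes kind_z: "kind z = Zero_kind" and kind_acc: "kind acc = Head_kind"
    and rule_acc: "rule acc b = None" "rule a acc = None"
    and rule_source: "rule a b = Some c \<Longrightarrow>
       kind a = Left_kind \<and> kind b = Head_kind \<and> \<not> goes_right b \<or>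
       kind a = Head_kind \<and> goes_right a \<and> kind b = Right_kind"
    and rule_target: "rule a b = Some (a', b') \<Longrightarrow>
       kind a' = Left_kind \<and> kind b' = Head_kind \<or> kind a' = Head_kind \<and> kind b' = Right_kind"
begin

text \<open>
  The words without a zero letter to which no relation that produces one applies.
\<close>

definition live :: "'a list \<Rightarrow> bool" where
  "live w \<longleftrightarrow> z \<notin> set w \<and> acc \<notin> set w \<and> successively (\<lambda>a b. joins (kind a) (kind b)) w"

definition relations :: "('a list \<times> 'a list) set" where
  "relations = {([a, b], [a', b']) | a b a' b'. rule a b = Some (a', b')} \<union>
     {([a, b], [z]) | a b. \<not> joins (kind a) (kind b)} \<union> {([acc], [z])}"

text \<open>
  Rewriting at the leftmost pair that a rule applies to.  In a live word this is the only such pair,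
  but the function is total, so that orbits can be considered for all words.
\<close>

fun next_word :: "'a list \<Rightarrow> 'a list" where
  "next_word (a # b # w) =
     (case rule a b of Some (a', b') \<Rightarrow> a' # b' # w | None \<Rightarrow> a # next_word (b # w))"
| "next_word w = w"

definition vanishes :: "'a list \<Rightarrow> bool" where
  "vanishes w \<longleftrightarrow> (\<exists>i. \<not> live ((next_word ^^ i) w))"

definition equivalent :: "'a list \<Rightarrow> 'a list \<Rightarrow> bool" where
  "equivalent u v \<longleftrightarrow>
     vanishes u \<and> vanishes v \<or> (\<exists>i j. (next_word ^^ i) u = (next_word ^^ j) v)"

lemma length_next_word [simp]: "length (next_word w) = length w"
  by (induction w rule: next_word.induct) (auto split: option.splits prod.splits)

lemma length_next_word_pow [simp]: "length ((next_word ^^ i) w) = length w"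
  by (induction i) auto

lemma next_word_site:
  "next_word w = w \<or> (\<exists>p a b a' b' r. w = p @ a # b # r \<and> rule a b = Some (a', b') \<and>
     next_word w = p @ a' # b' # r)"
proof (induction w rule: next_word.induct)
  case (1 a b w)
  show ?case
  proof (cases "rule a b")
    case None
    from 1[OF None] show ?thesis
    proof
      assume "next_word (b # w) = b # w"
      then show ?thesis using None by simp
    next
      assume "\<exists>p a1 b1 a' b' r. b # w = p @ a1 # b1 # r \<and> rule a1 b1 = Some (a', b') \<and>
        next_word (b # w) = p @ a' # b' # r"
      then obtain p a1 b1 a' b' r where *: "b # w = p @ a1 # b1 # r" "rule a1 b1 = Some (a', b')"
        "next_word (b # w) = p @ a' # b' # r" by blast
      have "next_word (a # b # w) = a # next_word (b # w)" using None by simp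
      with * show ?thesis by (metis append_Cons)
    qed
  next
    case (Some c)
    then show ?thesis by (cases c) (auto intro!: exI[of _ "[]"])
  qed
qed auto

text \<open>
  The converse fails only because a step may produce the accepting head.  A pair that does not fit
  stays where it is under rewriting in either direction, since a left letter and a head admit the same
  neighbours on the left, and a head and a right letter the same neighbours on the right.
\<close>

lemma live_rule:
  assumes r: "rule a b = Some (a', b')" and live: "live (p @ a' # b' # r)"
  shows "live (p @ a # b # r)"
proof -
  have na: "a \<noteq> acc" "b \<noteq> acc" using r rule_acc by auto
  have nz: "a \<noteq> z" "b \<noteq> z" using rule_source[OF r] kind_z by auto
  have "joins k (kind a') \<Longrightarrow> joins k (kind a)" for k
    using rule_source[OF r] rule_target[OF r] by (cases k) auto
  moreover have "joins (kind b') k \<Longrightarrow> joins (kind b) k" for k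
    using rule_source[OF r] rule_target[OF r] by (cases k) auto
  moreover have "joins (kind a) (kind b)"
    using rule_source[OF r] by auto
  ultimately have "successively (\<lambda>a b. joins (kind a) (kind b)) (p @ a # b # r)"
    using live by (cases r) (auto simp: live_def successively_append_iff)
  then show ?thesis using live na nz by (auto simp: live_def)
qed

lemma live_next_word: "live (next_word w) \<Longrightarrow> live w"
  using next_word_site[of w] live_rule by metis

lemma live_next_word_pow: "live ((next_word ^^ i) w) \<Longrightarrow> live w"
  by (induction i) (auto dest: live_next_word)

lemma vanishes_pow: "vanishes ((next_word ^^ i) w) \<longleftrightarrow> vanishes w"
proof
  assume "vanishes ((next_word ^^ i) w)"
  then obtain j where "\<not> live ((next_word ^^ (j + i)) w)"
    by (auto simp: vanishes_def funpow_add)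
  then show "vanishes w" unfolding vanishes_def by blast
next
  assume "vanishes w"
  then obtain j where "\<not> live ((next_word ^^ j) w)" by (auto simp: vanishes_def)
  then have "\<not> live ((next_word ^^ i) ((next_word ^^ j) w))" using live_next_word_pow by blast
  then have "\<not> live ((next_word ^^ j) ((next_word ^^ i) w))"
    by (subst funpow_swap)
  then show "vanishes ((next_word ^^ i) w)" unfolding vanishes_def by blast
qed

lemma successively_Right:
  "successively (\<lambda>a b. joins (kind a) (kind b)) (a # w) \<Longrightarrow> kind a \<in> {Head_kind, Right_kind} \<Longrightarrow>
   \<forall>b \<in> set w. kind b = Right_kind"
proof (induction w arbitrary: a)
  case (Cons b w)
  from Cons.prems have b: "kind b = Right_kind" by auto
  with Cons.prems have "\<forall>c \<in> set w. kind c = Right_kind" by (intro Cons.IH[of b]) auto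
  with b show ?case by simp
qed simp

text \<open>
  Determinism.  If a pair further left matched a rule, it would contain a head, and everything behind
  a head is a right letter; then the given pair would contain the same head, which would have to look
  to both sides.
\<close>

lemma next_word_live:
  assumes "rule a b = Some (a', b')" "successively (\<lambda>a b. joins (kind a) (kind b)) (p @ a # b # r)"
  shows "next_word (p @ a # b # r) = p @ a' # b' # r"
  using assms(2)
proof (induction p)
  case Nil then show ?case using assms(1) by simp
next
  case (Cons c p)
  obtain d q where d: "p @ a # b # r = d # q" by (cases p) auto
  have "successively (\<lambda>a b. joins (kind a) (kind b)) (c # d # q)"
    using Cons.prems by (simp only: append_Cons d)
  then have sq: "successively (\<lambda>a b. joins (kind a) (kind b)) (d # q)"
    by (simp only: successively.simps)
  have "rule c d = None"
  proof (rule ccontr)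
    assume "rule c d \<noteq> None"
    then obtain x where x: "rule c d = Some x" by auto
    note src = rule_source[OF x] and src' = rule_source[OF assms(1)]
    have R: "\<forall>b \<in> set q. kind b = Right_kind" if "kind d \<in> {Head_kind, Right_kind}"
      using successively_Right[OF sq] that by blast
    show False
    proof (cases p)
      case Nil
      with d have "d = a" "q = b # r" by auto
      with R have "kind d \<in> {Head_kind, Right_kind} \<Longrightarrow> kind b = Right_kind" by simp
      with src src' \<open>d = a\<close> show False by auto
    next
      case (Cons e p')
      with d have "a \<in> set q" "b \<in> set q" by auto
      with R have "kind d \<in> {Head_kind, Right_kind} \<Longrightarrow> kind a = Right_kind \<and> kind b = Right_kind"
        by blast
      with src src' show False by auto
    qed
  qed
  then have "next_word (c # d # q) = c # next_word (d # q)" by simp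
  moreover have "next_word (d # q) = p @ a' # b' # r" using Cons.IH sq by (simp only: d)
  ultimately show ?case by (simp only: append_Cons d)
qed

lemma equivalent_refl: "equivalent u u"
  unfolding equivalent_def by blast

lemma equivalent_sym: "equivalent u v \<Longrightarrow> equivalent v u"
  unfolding equivalent_def by (elim disjE conjE exE) (simp, blast intro: HOL.sym)

lemma equivalent_vanishes:
  assumes "equivalent u v" shows "vanishes u \<longleftrightarrow> vanishes v"
  using assms unfolding equivalent_def
proof (elim disjE exE)
  fix i j assume "(next_word ^^ i) u = (next_word ^^ j) v"
  then show ?thesis using vanishes_pow[of i u] vanishes_pow[of j v] by simp
qed simp

text \<open>
  Deterministic orbits that meet stay together, so two meeting points on the middle orbit can be
  moved to a common one.
\<close>

lemma equivalent_trans: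
  assumes "equivalent u v" "equivalent v w" shows "equivalent u w"
proof (cases "vanishes v")
  case True
  then have "vanishes u" "vanishes w" using assms equivalent_vanishes by blast+
  then show ?thesis unfolding equivalent_def by blast
next
  case False
  then obtain i j k l where 1: "(next_word ^^ i) u = (next_word ^^ j) v"
    and 2: "(next_word ^^ k) v = (next_word ^^ l) w"
    using assms unfolding equivalent_def by blast
  have "(next_word ^^ (k + i)) u = (next_word ^^ (k + j)) v"
    using 1 by (simp add: funpow_add)
  also have "\<dots> = (next_word ^^ (j + k)) v" by (simp add: add.commute)
  also have "\<dots> = (next_word ^^ (j + l)) w" using 2 by (simp add: funpow_add)
  finally show ?thesis unfolding equivalent_def by blast
qed

text \<open>
  A rule applied anywhere in a live word is the step of \<open>next_word\<close>; in a dead word it leads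
  to a dead word.  The other relations connect dead words.
\<close>

lemma relation_equivalent:
  assumes "(r', r'') \<in> relations"
  shows "equivalent (p @ r' @ q) (p @ r'' @ q)"
proof -
  have dead: "vanishes w" if "\<not> live w" for w
    unfolding vanishes_def using that by (intro exI[of _ 0]) auto
  from assms consider
    (rule) a b a' b' where "r' = [a, b]" "r'' = [a', b']" "rule a b = Some (a', b')"
  | (zero) "\<not> live (p @ r' @ q)" "\<not> live (p @ r'' @ q)"
    by (auto simp: relations_def live_def successively_append_iff)
  then show ?thesis
  proof cases
    case rule
    show ?thesis
    proof (cases "live (p @ r' @ q)")
      case True
      then have "(next_word ^^ 1) (p @ r' @ q) = (next_word ^^ 0) (p @ r'' @ q)"
        using next_word_live[OF rule(3), of p q] rule by (simp add: live_def)
      then show ?thesis unfolding equivalent_def by blast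
    next
      case False
      moreover have "\<not> live (p @ r'' @ q)" using live_rule[OF rule(3), of p q] False rule by auto
      ultimately show ?thesis unfolding equivalent_def using dead by blast
    qed
  next
    case zero
    then show ?thesis unfolding equivalent_def using dead by blast
  qed
qed

lemma rewrite_step_equivalent: "rewrite_step relations u v \<Longrightarrow> equivalent u v"
  unfolding rewrite_step_def using relation_equivalent equivalent_sym by blast

end

subsection \<open>Space-bounded derivations\<close>

definition short_steps :: "nat \<Rightarrow> ('a list \<times> 'a list) set \<Rightarrow> 'a list \<Rightarrow> 'a list \<Rightarrow> bool" where
  "short_steps n R = (\<lambda>w w'. rewrite_step R w w' \<and> length w \<le> n \<and> length w' \<le> n)\<^sup>*\<^sup>*"

lemma short_steps_refl: "short_steps n R w w"
  by (simp add: short_steps_def)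

lemma short_steps_trans: "short_steps n R u v \<Longrightarrow> short_steps n R v w \<Longrightarrow> short_steps n R u w"
  by (simp add: short_steps_def)

lemma short_steps_step:
  "rewrite_step R w w' \<Longrightarrow> length w \<le> n \<Longrightarrow> length w' \<le> n \<Longrightarrow> short_steps n R w w'"
  by (auto simp: short_steps_def)

lemma short_steps_sym: "short_steps n R u v \<Longrightarrow> short_steps n R v u"
  unfolding short_steps_def
  by (rule sympD[OF symp_rtranclp], rule sympI) (simp, metis rewrite_step_sym)

lemma rewrite_step_admissible:
  assumes "rewrite_step R u w" and A: "W = lists A \<or> W = nonempty_words A"
    and R: "R \<subseteq> nonempty_words A \<times> nonempty_words A" and u: "u \<in> W"
  shows "w \<in> W"
proof -
  obtain p q r' r'' where r: "(r', r'') \<in> R \<or> (r'', r') \<in> R" and eq: "u = p @ r' @ q" "w = p @ r'' @ q"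
    using assms(1) unfolding rewrite_step_def by blast
  have "r'' \<in> nonempty_words A" using r R by blast
  moreover have "p \<in> lists A" "q \<in> lists A" using u A eq by auto
  ultimately show ?thesis using A by (elim disjE) (simp_all add: eq)
qed

lemma short_steps_derivation:
  assumes "short_steps n R u v" and A: "W = lists A \<or> W = nonempty_words A"
    and R: "R \<subseteq> nonempty_words A \<times> nonempty_words A" and u: "u \<in> W" "length u \<le> n"
  shows "\<exists>ws. derivation W R u v ws \<and> derivation_space ws \<le> n"
  using assms(1) u unfolding short_steps_def
proof (induction rule: converse_rtranclp_induct)
  case base
  then have "derivation W R v v [v] \<and> derivation_space [v] \<le> n"
    by (auto simp: derivation_def derivation_space_def)
  then show ?case ..
next
  case (step u w)
  have "w \<in> W" "length w \<le> n" using rewrite_step_admissible[OF _ A R step(4)] step(1) by blast+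
  with step(3) obtain ws where ws: "derivation W R w v ws" "derivation_space ws \<le> n" by blast
  have "derivation W R u v (u # ws)"
    using ws(1) step(1,4) by (cases ws) (auto simp: derivation_def)
  moreover have "derivation_space (u # ws) \<le> n"
    using ws step(5) by (auto simp: derivation_space_def derivation_def)
  ultimately show ?case by blast
qed

context pair_rewriting
begin

lemma relation_step: "(r', r'') \<in> relations \<Longrightarrow> rewrite_step relations (p @ r' @ q) (p @ r'' @ q)"
  unfolding rewrite_step_def by blast

lemma short_steps_next_word:
  assumes "length w \<le> n" shows "short_steps n relations w (next_word w)"
  using next_word_site[of w]
proof (elim disjE exE conjE)
  fix p a b a' b' r
  assume *: "w = p @ a # b # r" "rule a b = Some (a', b')" "next_word w = p @ a' # b' # r"
  have "rewrite_step relations w (next_word w)"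
    using relation_step[of "[a, b]" "[a', b']" p r] * by (auto simp: relations_def)
  then show ?thesis using assms by (auto intro: short_steps_step)
qed (simp add: short_steps_refl)

lemma short_steps_pow:
  assumes "length w \<le> n" shows "short_steps n relations w ((next_word ^^ i) w)"
proof (induction i)
  case (Suc i)
  show ?case using short_steps_trans[OF Suc short_steps_next_word] assms by simp
qed (simp add: short_steps_refl)

lemma absorb_left: "length (p @ [z]) \<le> n \<Longrightarrow> short_steps n relations (p @ [z]) [z]"
proof (induction p rule: rev_induct)
  case (snoc a p)
  have "\<not> joins (kind a) (kind z)" by (cases "kind a") (auto simp: kind_z)
  then have "rewrite_step relations (p @ [a, z] @ []) (p @ [z] @ [])"
    by (intro relation_step) (auto simp: relations_def)
  then have "short_steps n relations (p @ [a, z]) (p @ [z])"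
    using snoc.prems by (intro short_steps_step) auto
  then show ?case using snoc short_steps_trans by fastforce
qed (simp add: short_steps_refl)

lemma absorb_right: "length (p @ z # r) \<le> n \<Longrightarrow> short_steps n relations (p @ z # r) (p @ [z])"
proof (induction r)
  case (Cons a r)
  have "rewrite_step relations (p @ [z, a] @ r) (p @ [z] @ r)"
    by (intro relation_step) (auto simp: relations_def kind_z)
  then have "short_steps n relations (p @ z # a # r) (p @ z # r)"
    using Cons.prems by (intro short_steps_step) auto
  then show ?case using Cons short_steps_trans by fastforce
qed (simp add: short_steps_refl)

lemma absorb: "length (p @ z # r) \<le> n \<Longrightarrow> short_steps n relations (p @ z # r) [z]"
  using absorb_right absorb_left[of p n] short_steps_trans by fastforce

lemma not_successively_split:
  "\<not> successively P w \<Longrightarrow> \<exists>p a b r. w = p @ a # b # r \<and> \<not> P a b"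
proof (induction w rule: induct_list012)
  case (3 x y zs)
  show ?case
  proof (cases "P x y")
    case True
    with 3 obtain p a b r where "y # zs = p @ a # b # r" "\<not> P a b" by auto
    then show ?thesis by (intro exI[of _ "x # p"]) auto
  qed (auto intro!: exI[of _ "[]"])
qed auto

text \<open>
  A dead word contains a factor that a relation turns into zero, and zero absorbs its neighbours one
  by one, because no letter may stand next to zero.  The length never grows.
\<close>

lemma short_steps_zero:
  assumes "\<not> live w" "length w \<le> n" shows "short_steps n relations w [z]"
proof -
  have *: ?thesis if "w = p @ r' @ r" "(r', [z]) \<in> relations" "length r' \<ge> 1" for p r' r
  proof -
    have "rewrite_step relations w (p @ [z] @ r)" using relation_step that by blast
    then have "short_steps n relations w (p @ z # r)"
      using assms(2) that by (intro short_steps_step) auto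
    then show ?thesis using absorb[of p r n] assms(2) that short_steps_trans by fastforce
  qed
  from assms(1) consider "z \<in> set w" | "acc \<in> set w"
    | "\<not> successively (\<lambda>a b. joins (kind a) (kind b)) w"
    by (auto simp: live_def)
  then show ?thesis
  proof cases
    case 1
    then obtain p r where "w = p @ z # r" by (meson split_list)
    then show ?thesis using absorb assms(2) by auto
  next
    case 2
    then obtain p r where "w = p @ acc # r" by (meson split_list)
    then show ?thesis by (intro *[of p "[acc]" r]) (auto simp: relations_def)
  next
    case 3
    then obtain p a b r where "w = p @ a # b # r" "\<not> joins (kind a) (kind b)"
      using not_successively_split by blast
    then show ?thesis by (intro *[of p "[a, b]" r]) (auto simp: relations_def)
  qed
qed

lemma equivalent_short_steps:
  assumes "equivalent u v" "length u \<le> n" "length v \<le> n"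
  shows "short_steps n relations u v"
  using assms(1) unfolding equivalent_def
proof (elim disjE exE conjE)
  have *: "short_steps n relations w [z]" if "vanishes w" "length w \<le> n" for w
    using that short_steps_pow short_steps_zero short_steps_trans
    by (metis vanishes_def length_next_word_pow)
  assume "vanishes u" "vanishes v"
  then show ?thesis using * assms short_steps_sym short_steps_trans by metis
next
  fix i j assume "(next_word ^^ i) u = (next_word ^^ j) v"
  then show ?thesis using assms short_steps_pow short_steps_sym short_steps_trans by metis
qed

text \<open>
  The same presentation with the letters numbered.
\<close>

definition generators :: "nat set" where
  "generators = range (to_nat :: 'a \<Rightarrow> nat)"

definition relators :: "(nat list \<times> nat list) set" where
  "relators = map_prod (map to_nat) (map to_nat) ` relations"

lemma generators_words: "u \<in> lists generators \<Longrightarrow> \<exists>v :: 'a list. u = map to_nat v"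
  unfolding generators_def by (simp add: lists_image) blast

lemma inj_map_to_nat: "map (to_nat :: 'a \<Rightarrow> nat) u = map to_nat v \<longleftrightarrow> u = v"
  by (simp add: inj_map_eq_map)

lemma relators_nonempty: "relators \<subseteq> nonempty_words generators \<times> nonempty_words generators"
  by (auto simp: relators_def relations_def generators_def)

lemma finite_relators: "finite relators"
proof -
  have "relations \<subseteq> {u. length u \<le> 2} \<times> {u. length u \<le> 2}"
    by (auto simp: relations_def)
  moreover have "finite {u :: 'a list. length u \<le> 2}"
    using finite_lists_length_le[of "UNIV :: 'a set" 2] by simp
  ultimately have "finite relations" using finite_subset by blast
  then show ?thesis by (simp add: relators_def)
qed

lemma presentation:
  "finite_semigroup_presentation generators relators"
  "finite_monoid_presentation generators relators"
  using relators_nonempty finite_relators by (auto simp: finite_presentation_def generators_def)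

lemma rewrite_step_map:
  "rewrite_step relators (map to_nat u) w \<longleftrightarrow>
     (\<exists>v. w = map to_nat v \<and> rewrite_step relations u v)"
proof
  assume "rewrite_step relators (map to_nat u) w"
  then obtain p q r' r'' where r: "(r', r'') \<in> relations \<or> (r'', r') \<in> relations"
    and eq: "map to_nat u = p @ map to_nat r' @ q" "w = p @ map to_nat r'' @ q"
    unfolding rewrite_step_def relators_def by (fastforce simp: map_prod_def)
  from eq(1) obtain p1 r1 q1 where "u = p1 @ r1 @ q1" "p = map to_nat p1"
    "map to_nat r' = map to_nat r1" "q = map to_nat q1"
    by (auto simp: map_eq_append_conv append_eq_map_conv)
  then have "w = map to_nat (p1 @ r'' @ q1)" "rewrite_step relations u (p1 @ r'' @ q1)"
    using r eq(2) by (auto simp: inj_map_to_nat rewrite_step_def)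
  then show "\<exists>v. w = map to_nat v \<and> rewrite_step relations u v" by blast
next
  assume "\<exists>v. w = map to_nat v \<and> rewrite_step relations u v"
  then obtain v where w: "w = map to_nat v" and "rewrite_step relations u v" by blast
  then obtain p q r' r'' where "(r', r'') \<in> relations \<or> (r'', r') \<in> relations"
    "u = p @ r' @ q" "w = map to_nat (p @ r'' @ q)"
    unfolding rewrite_step_def by blast
  then have "((map to_nat r', map to_nat r'') \<in> relators \<or> (map to_nat r'', map to_nat r') \<in> relators) \<and>
      map to_nat u = map to_nat p @ map to_nat r' @ map to_nat q \<and>
      w = map to_nat p @ map to_nat r'' @ map to_nat q"
    by (force simp: relators_def)
  then show "rewrite_step relators (map to_nat u) w"
    unfolding rewrite_step_def by blast
qed

lemma short_steps_map:
  "short_steps n relations u v \<Longrightarrow> short_steps n relators (map to_nat u) (map to_nat v)"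
  unfolding short_steps_def
proof (induction rule: rtranclp_induct)
  case (step v w)
  then show ?case using rewrite_step_map[of v "map to_nat w"]
    by (auto intro: rtranclp.rtrancl_into_rtrancl)
qed simp

context
  fixes W assumes W: "W = lists generators \<or> W = nonempty_words generators"
begin

lemma relators_W: "relators \<subseteq> W \<times> W"
  using relators_nonempty W by auto

lemma equal_in_relators:
  "equal_in W relators (map to_nat u) (map to_nat v) \<longleftrightarrow>
     map to_nat u \<in> W \<and> map to_nat v \<in> W \<and> equivalent u v"
proof
  assume "equal_in W relators (map to_nat u) (map to_nat v)"
  then obtain ws where ws: "derivation W relators (map to_nat u) (map to_nat v) ws"
    using equal_in_iff_derivation[OF W relators_W] by blast
  then have mem: "map to_nat u \<in> W" "map to_nat v \<in> W" 
    by (auto simp: derivation_def) (metis hd_in_set last_in_set subsetD)+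
  from ws have "equivalent u v"
  proof (induction ws arbitrary: u)
    case Nil then show ?case by (simp add: derivation_def)
  next
    case (Cons a ws)
    show ?case
    proof (cases ws)
      case Nil
      then show ?thesis using Cons.prems
        by (auto simp: derivation_def inj_map_to_nat intro: equivalent_refl)
    next
      case (Cons b vs)
      with Cons.prems have d: "derivation W relators b (map to_nat v) ws"
        and s: "rewrite_step relators (map to_nat u) b"
        by (auto simp: derivation_def)
      from s obtain u' where "b = map to_nat u'" "rewrite_step relations u u'"
        using rewrite_step_map by blast
      then show ?thesis using Cons.IH[of u'] d rewrite_step_equivalent equivalent_trans by blast
    qed
  qed
  with mem show "map to_nat u \<in> W \<and> map to_nat v \<in> W \<and> equivalent u v" by blast
next
  assume *: "map to_nat u \<in> W \<and> map to_nat v \<in> W \<and> equivalent u v"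
  let ?n = "max (length u) (length v)"
  have "short_steps ?n relators (map to_nat u) (map to_nat v)"
    using * by (intro short_steps_map equivalent_short_steps) auto
  then show "equal_in W relators (map to_nat u) (map to_nat v)"
    using short_steps_derivation[OF _ W relators_nonempty] *
      equal_in_iff_derivation[OF W relators_W] by fastforce
qed

lemma pair_space_le:
  assumes "equal_in W relators u v" "u \<in> W" "v \<in> W" "length u \<le> n" "length v \<le> n"
  shows "pair_space W relators u v \<le> n"
proof -
  obtain u' v' :: "'a list" where uv: "u = map to_nat u'" "v = map to_nat v'"
    using generators_words assms(2,3) W by (metis DiffD1)
  with assms have "equivalent u' v'" using equal_in_relators by simp
  then have "short_steps n relators u v"
    using assms uv by (auto intro: short_steps_map equivalent_short_steps)
  then obtain ws where ws: "derivation W relators u v ws" "derivation_space ws \<le> n"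
    using short_steps_derivation[OF _ W relators_nonempty] assms by blast
  then have "pair_space W relators u v \<le> derivation_space ws"
    unfolding pair_space_def by (intro Least_le) blast
  with ws show ?thesis by simp
qed

lemma space_function_le: "space_function W relators n \<le> n"
proof -
  let ?X = "{pair_space W relators w w' | w w'.
            w \<in> W \<and> w' \<in> W \<and> equal_in W relators w w' \<and> length w \<le> n \<and> length w' \<le> n}"
  have le: "x \<le> n" if "x \<in> ?X" for x using that pair_space_le by blast
  show ?thesis
  proof (cases "?X = {}")
    case True
    then show ?thesis unfolding space_function_def by (simp only: Sup_nat_empty)
  next
    case False
    then show ?thesis unfolding space_function_def using le by (rule cSup_least)
  qed
qed

lemma polynomial_space: "polynomial_function (space_function W relators)"
proof -
  have "(\<lambda>n. real (space_function W relators n)) \<preceq> (\<lambda>n. poly 0 (real n))"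
    unfolding preceq_def using space_function_le by (intro exI[of _ 1]) simp
  then show ?thesis unfolding polynomial_function_def by (intro exI[of _ 0]) (simp add: monoI)
qed

end

end

section \<open>Deciding equality in polynomial space\<close>

subsection \<open>Orbits in a finite set\<close>

lemma orbit_collision:
  fixes f :: "'b \<Rightarrow> 'b"
  assumes "finite S" "card S \<le> K" "\<And>i. (f ^^ i) x \<in> S"
  shows "\<exists>a b. a < b \<and> b \<le> K \<and> (f ^^ a) x = (f ^^ b) x"
proof -
  \<comment> \<open>there are \<open>K + 1\<close> times but at most \<open>K\<close> points\<close>
  have "card ((\<lambda>i. (f ^^ i) x) ` {..K}) \<le> card S"
    using assms by (intro card_mono) auto
  also have "\<dots> < card {..K}" using assms by simp
  finally have "\<not> inj_on (\<lambda>i. (f ^^ i) x) {..K}" by (rule pigeonhole)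
  then obtain a b where "a \<le> K" "b \<le> K" "a \<noteq> b" "(f ^^ a) x = (f ^^ b) x"
    by (auto simp: inj_on_def)
  then show ?thesis by (metis nat_neq_iff)
qed

lemma orbit_early:
  fixes f :: "'b \<Rightarrow> 'b"
  assumes "finite S" "card S \<le> K" "\<And>i. (f ^^ i) x \<in> S"
  shows "\<exists>j<K. (f ^^ i) x = (f ^^ j) x"
proof (induction i rule: less_induct)
  case (less i)
  obtain a b where ab: "a < b" "b \<le> K" "(f ^^ a) x = (f ^^ b) x"
    using orbit_collision[OF assms] by blast
  show ?case
  proof (cases "i < K")
    case False
    have "(f ^^ i) x = (f ^^ (i - b)) ((f ^^ b) x)"
      using False ab by (simp add: funpow_add[symmetric, THEN fun_cong, unfolded o_apply])
    also have "\<dots> = (f ^^ (i - b + a)) x" using ab by (simp add: funpow_add)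
    finally show ?thesis using less[of "i - b + a"] False ab by auto
  qed auto
qed

lemma orbit_periodic:
  fixes f :: "'b \<Rightarrow> 'b"
  assumes "finite S" "card S \<le> K" "\<And>i. (f ^^ i) x \<in> S"
  shows "\<exists>p>0. \<forall>m. (f ^^ (K + p * m)) x = (f ^^ K) x"
proof -
  obtain a b where ab: "a < b" "b \<le> K" "(f ^^ a) x = (f ^^ b) x"
    using orbit_collision[OF assms] by blast
  have 1: "(f ^^ (c + b)) x = (f ^^ (c + a)) x" for c using ab by (simp add: funpow_add)
  have "(f ^^ (K + (b - a) * m)) x = (f ^^ K) x" for m
  proof (induction m)
    case (Suc m)
    have "K + (b - a) * Suc m = (K + (b - a) * m - a) + b" using ab by simp
    then have "(f ^^ (K + (b - a) * Suc m)) x = (f ^^ ((K + (b - a) * m - a) + a)) x"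
      by (simp only: 1)
    also have "(K + (b - a) * m - a) + a = K + (b - a) * m" using ab by simp
    finally show ?case using Suc by simp
  qed simp
  then show ?thesis using ab by (intro exI[of _ "b - a"]) auto
qed

text \<open>
  If the orbits meet at all, then after \<open>K\<close> steps both points lie on the same cycle, and the
  second is reached from the first within one turn, which takes fewer than \<open>K\<close> steps.
\<close>

lemma orbits_meet:
  fixes f :: "'b \<Rightarrow> 'b"
  assumes S: "finite S" "card S \<le> K" "\<And>i. (f ^^ i) x \<in> S"
    and T: "finite T" "card T \<le> K" "\<And>i. (f ^^ i) y \<in> T"
    and meet: "(f ^^ i) x = (f ^^ j) y"
  shows "\<exists>k<K. (f ^^ k) ((f ^^ K) x) = (f ^^ K) y"
proof -
  obtain p where p: "p > 0" "\<And>m. (f ^^ (K + p * m)) y = (f ^^ K) y"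
    using orbit_periodic[OF T] by blast
  \<comment> \<open>\<open>q\<close> steps after the meeting point the orbit of \<open>y\<close> is again at its point of time \<open>K\<close>; the term \<open>p * K\<close> makes \<open>q\<close> at least \<open>K\<close>\<close>
  define q where "q = K + p * (j + K) - j"
  have "j + K \<le> p * (j + K)" using p(1) by simp
  then have q: "q + j = K + p * (j + K)" "q \<ge> K" unfolding q_def by linarith+
  have "(f ^^ (q + i)) x = (f ^^ (q + j)) y" using meet by (simp add: funpow_add)
  then have "(f ^^ ((q + i - K) + K)) x = (f ^^ K) y" using q p(2) by simp
  then have "(f ^^ (q + i - K)) ((f ^^ K) x) = (f ^^ K) y" by (simp only: funpow_add o_apply)
  moreover have "\<exists>k<K. (f ^^ (q + i - K)) ((f ^^ K) x) = (f ^^ k) ((f ^^ K) x)"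
    using S(1,2) by (rule orbit_early) (metis S(3) funpow_add o_apply)
  ultimately show ?thesis by auto
qed

subsection \<open>Counter\<close>

fun increment :: "nat \<Rightarrow> bool \<Rightarrow> nat \<Rightarrow> bool \<times> nat" where
  "increment b c d = (if c then if Suc d < b then (False, Suc d) else (True, 0) else (False, d))"

text \<open>
  The most significant digit comes first, so that incrementing is a pass from right to left.
\<close>

fun counter :: "nat \<Rightarrow> nat list \<Rightarrow> nat" where
  "counter b [] = 0"
| "counter b (d # ds) = d * b ^ length ds + counter b ds"

lemma counter_increment:
  assumes "set ds \<subseteq> {..<b}" "rmealy (increment b) c ds = (c', ds')"
  shows "set ds' \<subseteq> {..<b} \<and>
     counter b ds + of_bool c = counter b ds' + of_bool c' * b ^ length ds"
  using assms
proof (induction ds arbitrary: c' ds')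
  case Nil then show ?case by auto
next
  case (Cons d ds)
  obtain c1 ds1 where 1: "rmealy (increment b) c ds = (c1, ds1)" by fastforce
  obtain c2 d2 where 2: "increment b c1 d = (c2, d2)" by fastforce
  from Cons.prems(2) 1 2 have r: "c' = c2" "ds' = d2 # ds1"
    by (auto simp del: increment.simps)
  from Cons.IH[OF _ 1] Cons.prems have IH: "set ds1 \<subseteq> {..<b}"
    "counter b ds + of_bool c = counter b ds1 + of_bool c1 * b ^ length ds" by auto
  have len: "length ds1 = length ds" using length_rmealy[OF 1] .
  have d: "d < b" using Cons.prems by simp
  have 3: "d2 < b" "d + of_bool c1 = d2 + of_bool c2 * b"
    using 2 d by (auto split: if_splits)
  define P where "P = b ^ length ds"
  have "(d + of_bool c1) * P = (d2 + of_bool c2 * b) * P" by (simp only: 3)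
  then have "d * P + of_bool c1 * P = d2 * P + of_bool c2 * (b * P)"
    by (simp only: distrib_right mult.assoc)
  moreover have "counter b ds + of_bool c = counter b ds1 + of_bool c1 * P"
    using IH(2) by (simp only: P_def)
  ultimately have "d * P + counter b ds + of_bool c = d2 * P + counter b ds1 + of_bool c2 * (b * P)"
    by linarith
  then show ?case using IH(1) 3(1) by (simp only: r counter.simps len P_def) simp
qed

lemma counter_less: "set ds \<subseteq> {..<b} \<Longrightarrow> counter b ds < b ^ length ds"
proof (induction ds)
  case (Cons d ds)
  then have "d * b ^ length ds + counter b ds < Suc d * b ^ length ds" by auto
  also have "\<dots> \<le> b * b ^ length ds" using Cons.prems by (intro mult_le_mono1) auto
  finally show ?case by simp
qed simp

lemma counter_zero: "counter b (replicate n 0) = 0"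
  by (induction n) auto

subsection \<open>Decision procedure\<close>

text \<open>
  State of a transducer that performs one step on a word while reading it from the left: the letter
  before the current one, the letter that still has to be written at the left half of a rewritten pair,
  and whether the word has been found dead.
\<close>

type_synonym 'a track = "'a option \<times> 'a option \<times> bool"

text \<open>
  The control of the decision procedure for an input \<open>u1v\<close>.  \<open>In_right\<close> and
  \<open>In_left\<close> parse it from the right and move \<open>v\<close> to a second track; \<open>Scan\<close>,
  \<open>Scan_on\<close> and \<open>Shift\<close> push \<open>v\<close> along its track until it lies below \<open>u\<close>;
  \<open>Stepping\<close> and \<open>Fixing\<close> are the two halves of a simulated step.  The first boolean of
  \<open>Stepping\<close> and of \<open>Fixing\<close> tells whether only the first word is still moved, the second
  boolean of \<open>Stepping\<close> whether the two words have been equal so far.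
\<close>

datatype 'a phase =
  In_right bool | In_left bool bool | Malformed | Scan | Scan_on bool | Shift "'a option" | Aligned
| Idle | Stepping bool bool "'a track" "'a track"
| Fixing bool "'a option \<times> bool" "'a option \<times> bool" bool | Accepting

instance phase :: (countable) countable by countable_datatype

instance phase :: (finite) finite
proof
  have "p \<in> range In_right \<union> case_prod In_left ` UNIV \<union> {Malformed, Scan, Aligned, Idle, Accepting} \<union>
    range Scan_on \<union> range Shift \<union> (\<lambda>(a, b, c, d). Stepping a b c d) ` UNIV \<union>
    (\<lambda>(a, b, c, d). Fixing a b c d) ` UNIV" for p :: "'a phase"
    by (cases p) (auto simp: image_iff)
  then have "(UNIV :: 'a phase set) \<subseteq> range In_right \<union> case_prod In_left ` UNIV \<union>
    {Malformed, Scan, Aligned, Idle, Accepting} \<union>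
    range Scan_on \<union> range Shift \<union> (\<lambda>(a, b, c, d). Stepping a b c d) ` UNIV \<union>
    (\<lambda>(a, b, c, d). Fixing a b c d) ` UNIV" by blast
  then show "finite (UNIV :: 'a phase set)" by (rule finite_subset) simp
qed

text \<open>
  Two tracks of letters, each with a mark for the right half of a pair just rewritten, and a digit of
  the counter.
\<close>

type_synonym 'a square = "('a option \<times> bool) \<times> ('a option \<times> bool) \<times> nat"

definition unmarked :: "'a option \<Rightarrow> 'a option \<times> bool" where
  "unmarked c = (c, False)"

definition squares :: "'a option list \<Rightarrow> 'a option list \<Rightarrow> nat list \<Rightarrow> 'a square list" where
  "squares X Y ds = zip (map unmarked X) (zip (map unmarked Y) ds)"

text \<open>
  Words of different length on tracks of the same length; the padding makes equality of words
  equality of tracks.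
\<close>

definition padded :: "nat \<Rightarrow> 'a list \<Rightarrow> 'a option list" where
  "padded n w = map Some w @ replicate (n - length w) None"

lemma length_padded: "length w \<le> n \<Longrightarrow> length (padded n w) = n"
  by (simp add: padded_def)

lemma padded_eq: "padded n u = padded n v \<longleftrightarrow> u = v"
proof
  have *: "map the (takeWhile (\<lambda>c. c \<noteq> None) (padded n w)) = w" for w :: "'a list"
  proof -
    have "takeWhile (\<lambda>c. c \<noteq> None) (map Some w @ replicate (n - length w) None) = map Some w"
      by (simp add: takeWhile_append takeWhile_replicate)
    then show ?thesis by (simp add: padded_def o_def)
  qed
  assume "padded n u = padded n v" then show "u = v" by (metis *)
qed simp

context pair_rewriting
begin

text \<open>
  With as many digits as there are cells, the counter runs at least as long as there are words
  of any one length that fit on a track.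
\<close>

definition base :: nat where "base = card (UNIV :: 'a set)"

lemma base_pos: "base > 0"
  by (simp add: base_def finite_UNIV_card_ge_0)

text \<open>
  The pass to the right sees the left letter of a pair before the right one.  It can only write the
  second half of the new pair; the first half is kept as pending, and the cell written is marked.
\<close>

fun track_right :: "'a track \<Rightarrow> 'a option \<Rightarrow> 'a track \<times> ('a option \<times> bool)" where
  "track_right (prev, pend, dead) c =
     (let dead' = (dead \<or> (case c of None \<Rightarrow> False | Some b \<Rightarrow> b = z \<or> b = acc \<or>
            (case prev of None \<Rightarrow> False | Some a \<Rightarrow> \<not> joins (kind a) (kind b))));
          fired = (case (pend, prev, c) of (None, Some a, Some b) \<Rightarrow> rule a b | _ \<Rightarrow> None)
      in case fired of Some (a', b') \<Rightarrow> ((c, Some a', dead'), (Some b', True))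
         | None \<Rightarrow> ((c, pend, dead'), (c, False)))"

text \<open>
  On the way back the pending letter is put into the cell to the left of the marked one.
\<close>

fun track_left :: "'a option \<times> bool \<Rightarrow> 'a option \<times> bool \<Rightarrow> ('a option \<times> bool) \<times> ('a option \<times> bool)" where
  "track_left (pend, armed) (c, m) =
     (if m then ((pend, True), (c, False))
      else if armed then ((None, False), (pend, False))
      else ((pend, False), (c, False)))"

abbreviation start_step :: "bool \<Rightarrow> 'a phase" where
  "start_step ph \<equiv> Stepping ph True (None, None, False) (None, None, False)"

text \<open>
  In \<open>Shift c\<close> the state carries the letter of the cell to the right.
\<close>

fun pass_left :: "'a phase \<Rightarrow> 'a square \<Rightarrow> 'a phase \<times> 'a square" where
  "pass_left (In_right ne) (x, y, d) = (case fst x of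
       Some a \<Rightarrow> (In_right True, (unmarked None, unmarked (Some a), d))
     | None \<Rightarrow> (In_left ne False, (x, y, d)))"
| "pass_left (In_left nr nl) (x, y, d) =
     (if fst x = None then Malformed else In_left nr True, (x, y, d))"
| "pass_left (Shift c) (x, y, d) = (Shift (fst y), (x, unmarked c, d))"
| "pass_left (Fixing ph fx fy cr) (x, y, d) =
     (let (fx', x') = track_left fx x; (fy', y') = track_left fy y; (cr', d') = increment base cr d
      in (Fixing ph fx' fy' cr', (x', y', d')))"
| "pass_left p sq = (p, sq)"

fun pass_right :: "'a phase \<Rightarrow> 'a square \<Rightarrow> 'a phase \<times> 'a square" where
  "pass_right Scan (x, y, d) = (if fst y = None then Scan_on False else Aligned, (x, y, d))"
| "pass_right (Scan_on b) (x, y, d) = (Scan_on (b \<or> fst y \<noteq> None), (x, y, d))"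
| "pass_right (Stepping ph eq tx ty) (x, y, d) =
     (let (tx', x') = track_right tx (fst x); (ty', y') = track_right ty (fst y)
      in (Stepping ph (eq \<and> fst x = fst y) tx' ty', (x', if ph then unmarked (fst y) else y', d)))"
| "pass_right p sq = (p, sq)"

fun at_right :: "'a phase \<Rightarrow> nat list \<times> 'a phase" where
  "at_right (Scan_on b) = ([], if b then Shift None else Idle)"
| "at_right Aligned = ([], Idle)"
| "at_right (Stepping ph eq (_, px, dx) (_, py, dy)) =
     ([], if eq \<or> dx \<and> dy then Accepting
          else Fixing ph (px, False) (if ph then None else py, False) True)"
| "at_right p = ([], p)"

fun at_left :: "bool \<Rightarrow> 'a phase \<Rightarrow> bool + 'a phase" where
  "at_left empties (In_right _) = Inl False"
| "at_left empties Malformed = Inl False"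
| "at_left empties (In_left nr nl) = (if empties \<or> nr \<and> nl then Inr Scan else Inl False)"
| "at_left empties (Shift _) = Inr Scan"
| "at_left empties Idle = Inr (start_step False)"
| "at_left empties (Fixing ph _ _ cr) =
     (if cr then (if ph then Inl False else Inr (start_step True)) else Inr (start_step ph))"
| "at_left empties Accepting = Inl True"
| "at_left empties p = Inr p"

definition letter_square :: "nat \<Rightarrow> 'a square" where
  "letter_square a = (unmarked (if a = 1 then None else Some (from_nat (a - 2))), unmarked None, 0)"

lemma fst_at_right: "fst (at_right p) = []"
  by (cases p rule: at_right.cases) auto

lemma decider_sweeper:
  "sweeper UNIV (UNIV \<times> UNIV \<times> {..<base}) 0 (Suc (Max (word_problem_alphabet generators)))
     (word_problem_alphabet generators) letter_square (In_right False) pass_left (at_left empties)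
     pass_right at_right (\<lambda>_. 1) []"
proof
  note b = base_pos
  show "finite (UNIV :: 'a phase set)" "finite ((UNIV :: ('a option \<times> bool) set) \<times>
      (UNIV :: ('a option \<times> bool) set) \<times> {..<base})" by simp_all
  have fin: "finite (word_problem_alphabet generators)"
    by (simp add: word_problem_alphabet_def generators_def)
  show "word_problem_alphabet generators \<subseteq> {1..Suc (Max (word_problem_alphabet generators))}"
  proof
    fix x assume x: "x \<in> word_problem_alphabet generators"
    then have "x \<le> Max (word_problem_alphabet generators)" using fin by simp
    moreover have "x \<ge> 1" using x by (auto simp: word_problem_alphabet_def)
    ultimately show "x \<in> {1..Suc (Max (word_problem_alphabet generators))}" by simp
  qed
  show "letter_square a \<in> UNIV \<times> UNIV \<times> {..<base}" for a
    using b by (simp add: letter_square_def)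
  show "pass_left s d \<in> UNIV \<times> UNIV \<times> UNIV \<times> {..<base}" if "d \<in> UNIV \<times> UNIV \<times> {..<base}" for s d
    using that b by (cases "(s, d)" rule: pass_left.cases) (auto simp: Let_def split: option.splits prod.splits)
  show "pass_right s d \<in> UNIV \<times> UNIV \<times> UNIV \<times> {..<base}" if "d \<in> UNIV \<times> UNIV \<times> {..<base}" for s d
    using that b by (cases "(s, d)" rule: pass_right.cases) (auto simp: Let_def split: option.splits prod.splits)
  show "at_right s \<in> {e \<in> lists {1..Suc (Max (word_problem_alphabet generators))}. length e \<le> 0} \<times> UNIV" for s
    using fst_at_right[of s] by (cases "at_right s") auto
qed auto

lemma mealy_replicate_None:
  "\<exists>prev'. mealy track_right (prev, pend, dd) (replicate k None) =
     ((prev', pend, dd), map unmarked (replicate k None))"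
proof (induction k arbitrary: prev)
  case (Suc k)
  have 1: "track_right (prev, pend, dd) None = ((None, pend, dd), unmarked None)"
    by (cases pend; cases prev) (simp_all add: unmarked_def)
  obtain prev' where "mealy track_right (None, pend, dd) (replicate k None) =
     ((prev', pend, dd), map unmarked (replicate k None))"
    using Suc.IH by blast
  then show ?case by (simp add: 1 Let_def del: track_right.simps)
qed simp

lemma track_pending:
  "\<exists>prev' dd'. mealy track_right (prev, Some a, dd) xs = ((prev', Some a, dd'), map unmarked xs)"
proof (induction xs arbitrary: prev dd)
  case (Cons c xs)
  obtain dd1 where 1: "track_right (prev, Some a, dd) c = ((c, Some a, dd1), unmarked c)"
    by (simp add: unmarked_def Let_def)
  obtain p2 dd2 where 2: "mealy track_right (c, Some a, dd1) xs = ((p2, Some a, dd2), map unmarked xs)"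
    using Cons.IH by blast
  show ?case by (simp only: mealy.simps 1 2 Let_def prod.case) simp
qed auto

lemma track_right_state:
  "fst (fst (track_right (prev, pend, dd) (Some b))) = Some b \<and>
   snd (snd (fst (track_right (prev, pend, dd) (Some b)))) = (dd \<or> b = z \<or> b = acc \<or>
            (case prev of None \<Rightarrow> False | Some a \<Rightarrow> \<not> joins (kind a) (kind b)))"
  by (cases pend; cases prev) (auto simp: Let_def split: option.splits)

lemma track_right_dead:
  "mealy track_right (prev, pend, dd) (map Some w @ replicate k None) = ((prev', pend', dd'), ys) \<Longrightarrow>
   dd' \<longleftrightarrow> dd \<or> z \<in> set w \<or> acc \<in> set w \<or>
     \<not> successively (\<lambda>a b. joins (kind a) (kind b)) (case prev of None \<Rightarrow> w | Some a \<Rightarrow> a # w)"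
proof (induction w arbitrary: prev pend dd ys)
  case Nil
  then show ?case using mealy_replicate_None[of prev pend dd k] by (auto split: option.splits)
next
  case (Cons b w)
  let ?dd = "dd \<or> b = z \<or> b = acc \<or>
            (case prev of None \<Rightarrow> False | Some a \<Rightarrow> \<not> joins (kind a) (kind b))"
  define D where "D = ?dd"
  obtain p1 pend1 d1 c1 where t: "track_right (prev, pend, dd) (Some b) = ((p1, pend1, d1), c1)"
    by (metis surj_pair)
  have "p1 = Some b" "d1 = D"
    using track_right_state[of prev pend dd b] unfolding t D_def by simp_all
  with t have 1: "track_right (prev, pend, dd) (Some b) = ((Some b, pend1, D), c1)" by simp
  obtain s2 ys' where 2: "mealy track_right (Some b, pend1, D) (map Some w @ replicate k None) = (s2, ys')"
    by (metis surj_pair)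
  have "s2 = (prev', pend', dd')"
    using Cons.prems by (simp add: 1 2 Let_def del: track_right.simps)
  note IH = Cons.IH[OF 2[unfolded this]]
  show ?case
    unfolding IH D_def by (cases prev) auto
qed

text \<open>
  The state \<open>st\<close> in which the way back arrives at the letter \<open>a\<close> tells whether that
  letter is the left half of the rewritten pair; the case distinction of the recursion of
  \<open>next_word\<close> becomes one of \<open>st\<close>.
\<close>

lemma track_after_letter:
  "\<exists>prev' pend dd' ys st w'.
     mealy track_right (Some a, None, dd) (map Some w @ replicate k None) = ((prev', pend, dd'), ys) \<and>
     rmealy track_left (pend, False) ys = (st, map unmarked (map Some w' @ replicate k None)) \<and>
     st \<in> {(None, False)} \<union> (\<lambda>a. (Some a, True)) ` UNIV \<and>
     next_word (a # w) = (case st of (Some a', True) \<Rightarrow> a' | _ \<Rightarrow> a) # w'"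
proof (induction w arbitrary: a dd)
  case Nil
  obtain prev' where 1: "mealy track_right (Some a, None, dd) (replicate k None) =
     ((prev', None, dd), map unmarked (replicate k None))"
    using mealy_replicate_None by blast
  have "rmealy track_left (None, False) (map unmarked xs) = ((None, False), map unmarked xs)" for xs
    by (rule rmealy_stable) (simp add: unmarked_def)
  from 1 this[of "replicate k None"] show ?case by (auto intro!: exI[of _ "[]"])
next
  case (Cons b w)
  show ?case
  proof (cases "rule a b")
    case None
    obtain dd1 where 1: "track_right (Some a, None, dd) (Some b) = ((Some b, None, dd1), unmarked (Some b))"
      using None by (simp add: Let_def unmarked_def)
    obtain prev' pend dd' ys st w' where IH:
      "mealy track_right (Some b, None, dd1) (map Some w @ replicate k None) = ((prev', pend, dd'), ys)"
      "rmealy track_left (pend, False) ys = (st, map unmarked (map Some w' @ replicate k None))"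
      "st \<in> {(None, False)} \<union> (\<lambda>a. (Some a, True)) ` UNIV"
      "next_word (b # w) = (case st of (Some a', True) \<Rightarrow> a' | _ \<Rightarrow> b) # w'"
      using Cons.IH by blast
    let ?c = "case st of (Some a', True) \<Rightarrow> a' | _ \<Rightarrow> b"
    have 2: "track_left st (unmarked (Some b)) = ((None, False), unmarked (Some ?c))"
      using IH(3) by (auto simp: unmarked_def)
    have "mealy track_right (Some a, None, dd) (map Some (b # w) @ replicate k None)
        = ((prev', pend, dd'), unmarked (Some b) # ys)"
      by (simp add: 1 IH(1) Let_def del: track_right.simps)
    moreover have "rmealy track_left (pend, False) (unmarked (Some b) # ys)
        = ((None, False), map unmarked (map Some (?c # w') @ replicate k None))"
      by (simp add: IH(2) 2 Let_def del: track_left.simps)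
    moreover have "next_word (a # b # w) = a # ?c # w'" using None IH(4) by simp
    ultimately show ?thesis
      by (intro exI[of _ prev'] exI[of _ pend] exI[of _ dd'] exI[of _ "unmarked (Some b) # ys"]
        exI[of _ "(None, False)"] exI[of _ "?c # w'"]) simp
  next
    case (Some c)
    obtain a' b' where c: "c = (a', b')" by (cases c)
    obtain dd1 where 1: "track_right (Some a, None, dd) (Some b) = ((Some b, Some a', dd1), (Some b', True))"
      using Some c by (simp add: Let_def)
    let ?R = "map Some w @ replicate k None"
    obtain prev' dd' where 2: "mealy track_right (Some b, Some a', dd1) ?R = ((prev', Some a', dd'), map unmarked ?R)"
      using track_pending by blast
    have 3: "rmealy track_left (Some a', False) (map unmarked ?R) = ((Some a', False), map unmarked ?R)"
      by (rule rmealy_stable) (simp add: unmarked_def)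
    have "mealy track_right (Some a, None, dd) (map Some (b # w) @ replicate k None)
        = ((prev', Some a', dd'), (Some b', True) # map unmarked ?R)"
      using 2 by (simp add: 1 Let_def del: track_right.simps)
    moreover have "rmealy track_left (Some a', False) ((Some b', True) # map unmarked ?R)
        = ((Some a', True), map unmarked (map Some (b' # w) @ replicate k None))"
      using 3 by (simp add: Let_def) (simp add: unmarked_def)
    moreover have "next_word (a # b # w) = a' # b' # w" using Some c by simp
    ultimately show ?thesis
      by (intro exI[of _ prev'] exI[of _ "Some a'"] exI[of _ dd'] exI[of _ "(Some b', True) # map unmarked ?R"]
        exI[of _ "(Some a', True)"] exI[of _ "b' # w"]) simp
  qed
qed

text \<open>
  One sweep to the right and back is one step of the rewriting system.
\<close>

lemma track_word:
  "\<exists>prev' pend ys st.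
     mealy track_right (None, None, False) (padded n w) = ((prev', pend, \<not> live w), ys) \<and>
     rmealy track_left (pend, False) ys = (st, map unmarked (padded n (next_word w)))"
proof -
  define k where "k = n - length w"
  have R: "padded n w = map Some w @ replicate k None" "padded n (next_word w) = map Some (next_word w) @ replicate k None"
    by (simp_all add: padded_def k_def)
  have "\<exists>prev' pend dd ys st.
     mealy track_right (None, None, False) (padded n w) = ((prev', pend, dd), ys) \<and>
     rmealy track_left (pend, False) ys = (st, map unmarked (padded n (next_word w)))"
  proof (cases w)
    case Nil
    obtain prev' where 1: "mealy track_right (None, None, False) (replicate k None) =
       ((prev', None, False), map unmarked (replicate k None))"
      using mealy_replicate_None by blast
    have "rmealy track_left (None, False) (map unmarked (replicate k None)) = ((None, False), map unmarked (replicate k None))"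
      by (rule rmealy_stable) (simp add: unmarked_def)
    with 1 show ?thesis by (simp add: R[unfolded Nil] Nil) blast
  next
    case (Cons a v)
    obtain dd1 where 1: "track_right (None, None, False) (Some a) = ((Some a, None, dd1), unmarked (Some a))"
      by (simp add: Let_def unmarked_def)
    obtain prev' pend dd' ys st w' where IH:
      "mealy track_right (Some a, None, dd1) (map Some v @ replicate k None) = ((prev', pend, dd'), ys)"
      "rmealy track_left (pend, False) ys = (st, map unmarked (map Some w' @ replicate k None))"
      "st \<in> {(None, False)} \<union> (\<lambda>a. (Some a, True)) ` UNIV"
      "next_word (a # v) = (case st of (Some a', True) \<Rightarrow> a' | _ \<Rightarrow> a) # w'"
      using track_after_letter by blast
    let ?c = "case st of (Some a', True) \<Rightarrow> a' | _ \<Rightarrow> a"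
    have 2: "track_left st (unmarked (Some a)) = ((None, False), unmarked (Some ?c))"
      using IH(3) by (auto simp: unmarked_def)
    have "mealy track_right (None, None, False) (padded n w) = ((prev', pend, dd'), unmarked (Some a) # ys)"
      by (simp add: R(1)[unfolded Cons] Cons 1 IH(1) Let_def del: track_right.simps)
    moreover have "rmealy track_left (pend, False) (unmarked (Some a) # ys)
        = ((None, False), map unmarked (padded n (next_word w)))"
      by (simp add: R(2)[unfolded Cons IH(4)] Cons IH(2,4) 2 Let_def del: track_left.simps)
    ultimately show ?thesis by blast
  qed
  then obtain prev' pend dd ys st where *:
     "mealy track_right (None, None, False) (padded n w) = ((prev', pend, dd), ys)"
     "rmealy track_left (pend, False) ys = (st, map unmarked (padded n (next_word w)))" by blast
  have "dd \<longleftrightarrow> \<not> live w"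
    using track_right_dead[OF *(1)[unfolded R]] by (auto simp: live_def)
  with * show ?thesis by blast
qed

lemma mealy_Stepping:
  assumes "length X = length ds" "length Y = length ds"
    "mealy track_right tx X = (tx', X')" "mealy track_right ty Y = (ty', Y')"
  shows "mealy pass_right (Stepping ph eq tx ty) (squares X Y ds) =
    (Stepping ph (eq \<and> X = Y) tx' ty', zip X' (zip (if ph then map unmarked Y else Y') ds))"
  using assms unfolding squares_def
proof (induction ds arbitrary: X Y X' Y' eq tx ty)
  case Nil then show ?case by simp
next
  case (Cons d ds)
  obtain x X1 y Y1 where XY: "X = x # X1" "Y = y # Y1"
    using Cons.prems(1,2) by (cases X; cases Y) auto
  obtain tx1 x' ty1 y' where 1: "track_right tx x = (tx1, x')" "track_right ty y = (ty1, y')"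
    by (cases "track_right tx x", cases "track_right ty y") blast
  obtain X1' Y1' where 2: "mealy track_right tx1 X1 = (tx', X1')" "X' = x' # X1'"
    "mealy track_right ty1 Y1 = (ty', Y1')" "Y' = y' # Y1'"
    using Cons.prems(3,4) 1 by (auto simp: XY Let_def simp del: track_right.simps split: prod.splits)
  show ?case
    using Cons.IH[OF _ _ 2(1,3), of "eq \<and> x = y"] Cons.prems(1,2)
    by (auto simp: XY 1 2 unmarked_def Let_def simp del: track_right.simps)
qed

lemma rmealy_Fixing:
  assumes "length X = length ds" "length Y = length ds"
    "rmealy track_left fx X = (fx', X')" "rmealy track_left fy Y = (fy', Y')"
    "rmealy (increment base) cr ds = (cr', ds')"
  shows "rmealy pass_left (Fixing ph fx fy cr) (zip X (zip Y ds)) =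
    (Fixing ph fx' fy' cr', zip X' (zip Y' ds'))"
  using assms
proof (induction ds arbitrary: X Y X' Y' ds' fx' fy' cr')
  case Nil then show ?case by simp
next
  case (Cons d ds)
  obtain x X1 y Y1 where XY: "X = x # X1" "Y = y # Y1"
    using Cons.prems(1,2) by (cases X; cases Y) auto
  obtain fx1 X1' fy1 Y1' cr1 ds1 where 1: "rmealy track_left fx X1 = (fx1, X1')"
    "rmealy track_left fy Y1 = (fy1, Y1')" "rmealy (increment base) cr ds = (cr1, ds1)"
    by fastforce
  obtain x' y' d' where 2: "track_left fx1 x = (fx', x')" "track_left fy1 y = (fy', y')"
    "increment base cr1 d = (cr', d')" "X' = x' # X1'" "Y' = y' # Y1'" "ds' = d' # ds1"
    using Cons.prems(3-5) 1
    by (auto simp: XY Let_def simp del: track_left.simps increment.simps split: prod.splits)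
  show ?case
    using Cons.IH[OF _ _ 1] Cons.prems(1,2)
    by (simp add: XY 2 Let_def del: track_left.simps increment.simps)
qed

text \<open>
  Either case proves that the original words are equal.
\<close>

definition agree :: "'a list \<Rightarrow> 'a list \<Rightarrow> bool" where
  "agree u v \<longleftrightarrow> u = v \<or> \<not> live u \<and> \<not> live v"

text \<open>
  The machine at the right end, in the middle of a simulated step.
\<close>

definition stage :: "bool \<Rightarrow> 'a list \<Rightarrow> 'a list \<Rightarrow> nat list \<Rightarrow> 'a phase \<times> 'a square list \<times> nat list" where
  "stage ph u v ds =
     (let (s, cs) = mealy pass_right (start_step ph) (squares (padded (length ds) u) (padded (length ds) v) ds)
      in (snd (at_right s), cs, []))"

lemma stage_cases:
  assumes len: "length u \<le> length ds" "length v \<le> length ds"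
    and inc: "rmealy (increment base) True ds = (c, ds')"
  shows "\<exists>s cs. stage ph u v ds = (s, cs, []) \<and> (if agree u v then s = Accepting else
     \<exists>fx fy. rmealy pass_left s cs = (Fixing ph fx fy c,
       squares (padded (length ds) (next_word u)) (padded (length ds) (if ph then v else next_word v)) ds'))"
proof -
  let ?n = "length ds"
  obtain p q X st where x: "mealy track_right (None, None, False) (padded ?n u) = ((p, q, \<not> live u), X)"
    "rmealy track_left (q, False) X = (st, map unmarked (padded ?n (next_word u)))"
    using track_word by blast
  obtain p' q' Y st' where y: "mealy track_right (None, None, False) (padded ?n v) = ((p', q', \<not> live v), Y)"
    "rmealy track_left (q', False) Y = (st', map unmarked (padded ?n (next_word v)))"
    using track_word by blast
  let ?Y = "if ph then map unmarked (padded ?n v) else Y"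
  have m: "mealy pass_right (start_step ph) (squares (padded ?n u) (padded ?n v) ds) =
    (Stepping ph (u = v) (p, q, \<not> live u) (p', q', \<not> live v), zip X (zip ?Y ds))"
    using mealy_Stepping[OF _ _ x(1) y(1)] len by (simp add: length_padded padded_eq)
  show ?thesis
  proof (cases "agree u v")
    case True
    then show ?thesis by (auto simp: stage_def m agree_def)
  next
    case False
    let ?fy = "(if ph then None else q', False)"
    have lX: "length X = ?n" "length Y = ?n" using length_mealy[OF x(1)] length_mealy[OF y(1)] len
      by (auto simp: length_padded)
    have "rmealy track_left (None, False) (map unmarked W) = ((None, False), map unmarked W)" for W
      by (rule rmealy_stable) (simp add: unmarked_def)
    with y(2) obtain st'' where "rmealy track_left ?fy ?Y =
        (st'', map unmarked (padded ?n (if ph then v else next_word v)))"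
      by (cases ph) auto
    from rmealy_Fixing[OF _ _ x(2) this inc, of ph] len lX
    have "rmealy pass_left (Fixing ph (q, False) ?fy True) (zip X (zip ?Y ds)) =
      (Fixing ph st st'' c, squares (padded ?n (next_word u)) (padded ?n (if ph then v else next_word v)) ds')"
      by (cases ph) (simp_all add: squares_def length_padded)
    moreover have "stage ph u v ds = (Fixing ph (q, False) ?fy True, zip X (zip ?Y ds), [])"
      using False by (auto simp: stage_def m agree_def)
    ultimately show ?thesis using False by auto
  qed
qed

context
  fixes empties :: bool
begin

interpretation dec: sweeper UNIV "UNIV \<times> UNIV \<times> {..<base}" 0 "Suc (Max (word_problem_alphabet generators))"
  "word_problem_alphabet generators" letter_square "In_right False" pass_left "at_left empties" pass_right
  at_right "\<lambda>_. 1" "[]" False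
  by (rule decider_sweeper)

definition decides :: "'a phase \<times> 'a square list \<times> nat list \<Rightarrow> bool \<Rightarrow> bool" where
  "decides c b \<longleftrightarrow> (\<exists>s ds xs s1 ds1. dec.sweep\<^sup>*\<^sup>* c (s, ds, xs) \<and>
     rmealy pass_left s ds = (s1, ds1) \<and> at_left empties s1 = Inl b)"

lemma decides_sweep: "dec.sweep c c' \<Longrightarrow> decides c' b \<Longrightarrow> decides c b"
  unfolding decides_def by (meson converse_rtranclp_into_rtranclp)

lemma decides_sweeps: "dec.sweep\<^sup>*\<^sup>* c c' \<Longrightarrow> decides c' b \<Longrightarrow> decides c b"
  unfolding decides_def by (meson rtranclp_trans)

lemma decides_now: "rmealy pass_left s ds = (s1, ds1) \<Longrightarrow> at_left empties s1 = Inl b \<Longrightarrow> decides (s, ds, xs) b"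
  unfolding decides_def by blast

lemma rmealy_Accepting: "rmealy pass_left Accepting cs = (Accepting, cs)"
  using rmealy_stable[of cs pass_left Accepting id id] by simp

lemma sweep_to_stage:
  assumes "rmealy pass_left s cs = (s1, squares (padded (length ds) u) (padded (length ds) v) ds)"
    "at_left empties s1 = Inr (start_step ph)"
  shows "dec.sweep (s, cs, []) (stage ph u v ds)"
proof -
  obtain s3 cs3 where m: "mealy pass_right (start_step ph)
      (squares (padded (length ds) u) (padded (length ds) v) ds) = (s3, cs3)" by fastforce
  have "at_right s3 = ([], snd (at_right s3))" using fst_at_right[of s3] by (metis prod.collapse)
  from dec.sweep.intros[OF assms m this] show ?thesis by (simp add: stage_def m)
qed

text \<open>
  Induction on the remaining running time of the counter, whose overflow ends the stage with a
  rejection.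
\<close>

lemma decides_second_stage:
  assumes "length u \<le> length ds" "length v \<le> length ds" "set ds \<subseteq> {..<base}"
  shows "decides (stage True u v ds)
     (\<exists>j < base ^ length ds - counter base ds. agree ((next_word ^^ j) u) v)"
  using assms
proof (induction "base ^ length ds - counter base ds" arbitrary: u ds rule: less_induct)
  case less
  let ?K = "base ^ length ds"
  obtain c ds' where inc: "rmealy (increment base) True ds = (c, ds')" by fastforce
  note ci = counter_increment[OF less.prems(3) inc]
  have len: "length ds' = length ds" using length_rmealy[OF inc] .
  have lt: "counter base ds < ?K" using counter_less[OF less.prems(3)] .
  obtain s cs where sc: "stage True u v ds = (s, cs, [])" "if agree u v then s = Accepting else
     \<exists>fx fy. rmealy pass_left s cs = (Fixing True fx fy c,
       squares (padded (length ds) (next_word u)) (padded (length ds) v) ds')"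
    using stage_cases[OF less.prems(1,2) inc, of True, simplified if_True if_False] by blast
  show ?case
  proof (cases "agree u v")
    case True
    then have "\<exists>j < ?K - counter base ds. agree ((next_word ^^ j) u) v"
      using lt by (intro exI[of _ 0]) simp
    then show ?thesis using True sc rmealy_Accepting by (auto intro!: decides_now)
  next
    case False
    then obtain fx fy where L: "rmealy pass_left s cs = (Fixing True fx fy c,
       squares (padded (length ds) (next_word u)) (padded (length ds) v) ds')"
      using sc by auto
    show ?thesis
    proof (cases c)
      case True
      then have "?K - counter base ds = 1" using ci lt by auto
      then have "\<not> (\<exists>j < ?K - counter base ds. agree ((next_word ^^ j) u) v)" using False by simp
      then show ?thesis using L True sc by (auto intro!: decides_now)
    next
      case nc: False
      have "dec.sweep (s, cs, []) (stage True (next_word u) v ds')"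
        using L nc len by (intro sweep_to_stage) auto
      moreover have K: "?K - counter base ds = Suc (base ^ length ds' - counter base ds')"
        using ci nc lt len by auto
      have "decides (stage True (next_word u) v ds')
        (\<exists>j < base ^ length ds' - counter base ds'. agree ((next_word ^^ j) (next_word u)) v)"
        by (rule less.hyps) (use K len less.prems ci in auto)
      moreover have "(\<exists>j < ?K - counter base ds. agree ((next_word ^^ j) u) v) \<longleftrightarrow>
        (\<exists>j < base ^ length ds' - counter base ds'. agree ((next_word ^^ j) (next_word u)) v)"
        using False by (simp add: K Ex_less_Suc2 funpow_swap1)
      ultimately show ?thesis using sc decides_sweep by simp
    qed
  qed
qed

text \<open>
  When the counter overflows it is zero again and serves as the clock of the second stage.
\<close>

lemma decides_first_stage:
  assumes "length u \<le> length ds" "length v \<le> length ds" "set ds \<subseteq> {..<base}"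
  shows "decides (stage False u v ds)
     ((\<exists>j < base ^ length ds - counter base ds. agree ((next_word ^^ j) u) ((next_word ^^ j) v)) \<or>
      (\<exists>j < base ^ length ds. agree
         ((next_word ^^ j) ((next_word ^^ (base ^ length ds - counter base ds)) u))
         ((next_word ^^ (base ^ length ds - counter base ds)) v)))"
  using assms
proof (induction "base ^ length ds - counter base ds" arbitrary: u v ds rule: less_induct)
  case less
  let ?K = "base ^ length ds"
  obtain c ds' where inc: "rmealy (increment base) True ds = (c, ds')" by fastforce
  note ci = counter_increment[OF less.prems(3) inc]
  have len: "length ds' = length ds" using length_rmealy[OF inc] .
  have lt: "counter base ds < ?K" using counter_less[OF less.prems(3)] .
  obtain s cs where sc: "stage False u v ds = (s, cs, [])" "if agree u v then s = Accepting else
     \<exists>fx fy. rmealy pass_left s cs = (Fixing False fx fy c,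
       squares (padded (length ds) (next_word u)) (padded (length ds) (next_word v)) ds')"
    using stage_cases[OF less.prems(1,2) inc, of False, simplified if_True if_False] by blast
  show ?case
  proof (cases "agree u v")
    case True
    then have "\<exists>j < ?K - counter base ds. agree ((next_word ^^ j) u) ((next_word ^^ j) v)"
      using lt by (intro exI[of _ 0]) simp
    then show ?thesis using True sc rmealy_Accepting by (auto intro!: decides_now)
  next
    case False
    then obtain fx fy where L: "rmealy pass_left s cs = (Fixing False fx fy c,
       squares (padded (length ds) (next_word u)) (padded (length ds) (next_word v)) ds')"
      using sc by auto
    show ?thesis
    proof (cases c)
      case True
      then have K: "?K - counter base ds = 1" and 0: "counter base ds' = 0" using ci lt by auto
      have "decides (stage True (next_word u) (next_word v) ds')
         (\<exists>j < base ^ length ds' - counter base ds'. agree ((next_word ^^ j) (next_word u)) (next_word v))"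
        by (rule decides_second_stage) (use len less.prems ci in auto)
      moreover have "dec.sweep (s, cs, []) (stage True (next_word u) (next_word v) ds')"
        using L True len by (intro sweep_to_stage) auto
      ultimately show ?thesis using sc decides_sweep False by (simp add: K 0 len)
    next
      case nc: False
      have "dec.sweep (s, cs, []) (stage False (next_word u) (next_word v) ds')"
        using L nc len by (intro sweep_to_stage) auto
      moreover have K: "?K - counter base ds = Suc (base ^ length ds' - counter base ds')"
        using ci nc lt len by auto
      let ?k' = "base ^ length ds' - counter base ds'"
      have "decides (stage False (next_word u) (next_word v) ds')
       ((\<exists>j < ?k'. agree ((next_word ^^ j) (next_word u)) ((next_word ^^ j) (next_word v))) \<or>
        (\<exists>j < base ^ length ds'. agree ((next_word ^^ j) ((next_word ^^ ?k') (next_word u)))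
         ((next_word ^^ ?k') (next_word v))))"
        by (rule less.hyps) (use K len less.prems ci in auto)
      moreover have "(\<exists>j < ?K - counter base ds. agree ((next_word ^^ j) u) ((next_word ^^ j) v)) \<longleftrightarrow>
        (\<exists>j < ?k'. agree ((next_word ^^ j) (next_word u)) ((next_word ^^ j) (next_word v)))"
        using False by (simp add: K Ex_less_Suc2 funpow_swap1)
      moreover have "(next_word ^^ (?K - counter base ds)) w = (next_word ^^ ?k') (next_word w)" for w
        by (simp add: K funpow_swap1)
      ultimately show ?thesis using sc decides_sweep len by simp
    qed
  qed
qed

text \<open>
  The two stages together find every equality: a word that vanishes is dead after \<open>K\<close> steps
  because deadness persists, and meeting orbits are detected by the second stage
  (\<open>orbits_meet\<close>).
\<close>

lemma agree_equivalent:
  assumes len: "length u \<le> n" "length v \<le> n"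
  defines "K \<equiv> base ^ n"
  shows "(\<exists>j<K. agree ((next_word ^^ j) u) ((next_word ^^ j) v)) \<or>
     (\<exists>j<K. agree ((next_word ^^ j) ((next_word ^^ K) u)) ((next_word ^^ K) v)) \<longleftrightarrow> equivalent u v"
proof
  have *: "equivalent u v" if "agree ((next_word ^^ i) u) ((next_word ^^ j) v)" for i j
    using that unfolding agree_def equivalent_def vanishes_def by blast
  assume "(\<exists>j<K. agree ((next_word ^^ j) u) ((next_word ^^ j) v)) \<or>
     (\<exists>j<K. agree ((next_word ^^ j) ((next_word ^^ K) u)) ((next_word ^^ K) v))"
  then show "equivalent u v"
  proof (elim disjE exE conjE)
    fix j assume "agree ((next_word ^^ j) ((next_word ^^ K) u)) ((next_word ^^ K) v)"
    then have "agree ((next_word ^^ (j + K)) u) ((next_word ^^ K) v)" by (simp add: funpow_add)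
    then show ?thesis by (rule *)
  qed (rule *)
next
  let ?S = "\<lambda>w :: 'a list. {w' :: 'a list. length w' = length w}"
  have S: "finite (?S w)" "card (?S w) \<le> K" "(next_word ^^ i) w \<in> ?S w" if "length w \<le> n" for w i
  proof -
    show "finite (?S w)" using finite_lists_length_eq[of "UNIV :: 'a set" "length w"] by simp
    have "card (?S w) = base ^ length w"
      using card_lists_length_eq[of "UNIV :: 'a set" "length w"] by (simp add: base_def)
    also have "\<dots> \<le> K" unfolding K_def using that
      by (intro power_increasing) (simp_all add: base_pos Suc_le_eq)
    finally show "card (?S w) \<le> K" .
  qed simp
  have dead: "\<not> live ((next_word ^^ K) w)" if vw: "vanishes w" and "length w \<le> n" for w
  proof -
    obtain i where i: "\<not> live ((next_word ^^ i) w)" using vw unfolding vanishes_def by blast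
    obtain j where j: "j < K" "(next_word ^^ i) w = (next_word ^^ j) w"
      using orbit_early[OF S[OF \<open>length w \<le> n\<close>]] by blast
    have "(next_word ^^ K) w = (next_word ^^ (K - j)) ((next_word ^^ j) w)"
      using j(1) fun_cong[OF funpow_add[of "K - j" j next_word], of w] by simp
    then show ?thesis using i j live_next_word_pow by metis
  qed
  have K: "K > 0" by (simp add: K_def base_pos)
  assume "equivalent u v"
  then consider "vanishes u" "vanishes v" | i j where "(next_word ^^ i) u = (next_word ^^ j) v"
    unfolding equivalent_def by blast
  then show "(\<exists>j<K. agree ((next_word ^^ j) u) ((next_word ^^ j) v)) \<or>
     (\<exists>j<K. agree ((next_word ^^ j) ((next_word ^^ K) u)) ((next_word ^^ K) v))"
  proof cases
    case 1
    then have "agree ((next_word ^^ 0) ((next_word ^^ K) u)) ((next_word ^^ K) v)"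
      using dead len by (simp add: agree_def)
    then show ?thesis using K by blast
  next
    case 2
    then show ?thesis using orbits_meet[OF S[OF len(1)] S[OF len(2)] 2] unfolding agree_def by blast
  qed
qed

abbreviation codes :: "'a list \<Rightarrow> nat list" where
  "codes u \<equiv> map (\<lambda>a. a + 2) (map to_nat u)"

lemma letter_square_simps:
  "letter_square (to_nat a + 2) = (unmarked (Some a), unmarked None, 0)"
  "letter_square 1 = (unmarked None, unmarked None, 0)"
  by (simp_all add: letter_square_def)

lemma rmealy_In_right:
  "rmealy pass_left (In_right ne) (map letter_square (codes v)) =
     (In_right (ne \<or> v \<noteq> []), map (\<lambda>a. (unmarked None, unmarked (Some a), 0)) v)"
proof (induction v)
  case (Cons a v)
  have "letter_square (Suc (Suc (to_nat a))) = (unmarked (Some a), unmarked None, 0)"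
    using letter_square_simps(1)[of a] by simp
  then show ?case using Cons by (simp add: o_def) (simp add: unmarked_def)
qed simp

lemma rmealy_In_left:
  "rmealy pass_left (In_left nr nl) (map letter_square w) =
     (if 1 \<in> set w then Malformed else In_left nr (nl \<or> w \<noteq> []), map letter_square w)"
  by (induction w) (auto simp: letter_square_def unmarked_def)

lemma squares_Cons: "squares (x # X) (y # Y) (d # ds) = (unmarked x, unmarked y, d) # squares X Y ds"
  by (simp add: squares_def)

lemma squares_right: "map (\<lambda>a. (unmarked None, unmarked (Some a), 0)) v =
   squares (replicate (length v) None) (map Some v) (replicate (length v) 0)"
  by (induction v) (simp_all add: squares_Cons, simp add: squares_def)

lemma squares_initial:
  "map letter_square (codes u) @ (unmarked None, unmarked None, 0) # map (\<lambda>a. (unmarked None, unmarked (Some a), 0)) v =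
   squares (map Some u @ None # replicate (length v) None) (replicate (length u + 1) None @ map Some v)
     (replicate (length u + 1 + length v) 0)"
proof (induction u)
  case Nil then show ?case by (simp add: squares_Cons squares_right)
next
  case (Cons a u)
  have "letter_square (Suc (Suc (to_nat a))) = (unmarked (Some a), unmarked None, 0)"
    using letter_square_simps(1)[of a] by simp
  with Cons show ?case by (simp add: squares_Cons)
qed

lemma rmealy_Shift:
  assumes "length X = length ds" "length Y = length ds"
  shows "rmealy pass_left (Shift c) (squares X Y ds) = (Shift (hd (Y @ [c])), squares X (tl (Y @ [c])) ds)"
  using assms
proof (induction ds arbitrary: X Y)
  case Nil then show ?case by (simp add: squares_def)
next
  case (Cons d ds)
  obtain x X1 y Y1 where XY: "X = x # X1" "Y = y # Y1"
    using Cons.prems by (cases X; cases Y) auto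
  obtain y' Y' where Y': "Y1 @ [c] = y' # Y'" by (cases Y1) auto
  show ?case using Cons.IH[of X1 Y1] Cons.prems
    by (simp add: XY squares_Cons Y') (simp add: unmarked_def)
qed

lemma mealy_Scan_on:
  assumes "length X = length ds" "length Y = length ds"
  shows "mealy pass_right (Scan_on b) (squares X Y ds) = (Scan_on (b \<or> (\<exists>y\<in>set Y. y \<noteq> None)), squares X Y ds)"
  using assms
proof (induction ds arbitrary: X Y b)
  case Nil then show ?case by (simp add: squares_def)
next
  case (Cons d ds)
  obtain x X1 y Y1 where XY: "X = x # X1" "Y = y # Y1"
    using Cons.prems by (cases X; cases Y) auto
  show ?case using Cons.IH[of X1 Y1] Cons.prems
    by (simp add: XY squares_Cons unmarked_def disj_assoc)
qed

lemma mealy_Scan: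
  assumes "length X = length ds" "length Y = length ds" "ds \<noteq> []"
  shows "mealy pass_right Scan (squares X Y ds) =
    (if hd Y = None then Scan_on (\<exists>y\<in>set Y. y \<noteq> None) else Aligned, squares X Y ds)"
proof -
  obtain d ds1 x X1 y Y1 where XY: "ds = d # ds1" "X = x # X1" "Y = y # Y1"
    using assms by (cases ds; cases X; cases Y) auto
  have 1: "mealy pass_right Aligned cs = (Aligned, cs)" for cs
    using mealy_stable[of cs pass_right Aligned id id] by simp
  have 2: "mealy pass_right (Scan_on False) (squares X1 Y1 ds1) =
     (Scan_on (\<exists>y\<in>set Y1. y \<noteq> None), squares X1 Y1 ds1)"
    using mealy_Scan_on[of X1 ds1 Y1 False] assms XY by simp
  show ?thesis by (simp add: XY squares_Cons 1 2 unmarked_def)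
qed

lemma sweep_Scan:
  assumes "rmealy pass_left s cs = (s1, squares X Y ds)" "at_left empties s1 = Inr Scan"
    "length X = length ds" "length Y = length ds" "ds \<noteq> []"
  shows "dec.sweep (s, cs, []) (if hd Y = None \<and> (\<exists>y\<in>set Y. y \<noteq> None) then Shift None else Idle, squares X Y ds, [])"
proof -
  have "at_right (if hd Y = None then Scan_on (\<exists>y\<in>set Y. y \<noteq> None) else Aligned) =
     ([], if hd Y = None \<and> (\<exists>y\<in>set Y. y \<noteq> None) then Shift None else Idle)"
    by simp
  from dec.sweep.intros[OF assms(1,2) mealy_Scan[OF assms(3-5)] this, of "[]"]
  show ?thesis by simp
qed

text \<open>
  After the initial parse the second word starts one cell behind the end of the first one, so the
  number of shifts is the length of the first word plus one.
\<close>

lemma shift_loop: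
  assumes v: "v \<noteq> []" and X: "length X = length ds" and "length ds = Suc m + length v + k"
  shows "dec.sweep\<^sup>*\<^sup>* (Shift None, squares X (replicate (Suc m) None @ map Some v @ replicate k None) ds, [])
     (Idle, squares X (padded (length ds) v) ds, [])"
  using assms(3)
proof (induction m arbitrary: k)
  case 0
  let ?Y = "replicate (Suc 0) None @ map Some v @ replicate k None"
  let ?Y' = "padded (length ds) v"
  have p: "?Y' = map Some v @ replicate (Suc k) None"
    using 0 by (simp add: padded_def)
  have "hd (?Y @ [None]) = None" "tl (?Y @ [None]) = ?Y'"
    by (simp_all add: p replicate_append_same)
  then have R: "rmealy pass_left (Shift None) (squares X ?Y ds) = (Shift None, squares X ?Y' ds)"
    using rmealy_Shift[of X ds ?Y None] X 0 by simp
  have "hd ?Y' \<noteq> None" using v by (cases v) (auto simp: padded_def)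
  moreover have "length ?Y' = length ds" "ds \<noteq> []" using 0 by (auto simp: length_padded)
  ultimately have "dec.sweep (Shift None, squares X ?Y ds, []) (Idle, squares X ?Y' ds, [])"
    using sweep_Scan[OF R _ X] by (simp only: at_left.simps if_False simp_thms)
  then show ?case by (rule r_into_rtranclp)
next
  case (Suc m)
  let ?Y = "replicate (Suc (Suc m)) None @ map Some v @ replicate k None"
  let ?Y' = "replicate (Suc m) None @ map Some v @ replicate (Suc k) None"
  have "hd (?Y @ [None]) = None" "tl (?Y @ [None]) = ?Y'"
    by (simp_all add: replicate_append_same)
  then have R: "rmealy pass_left (Shift None) (squares X ?Y ds) = (Shift None, squares X ?Y' ds)"
    using rmealy_Shift[of X ds ?Y None] X Suc.prems by simp
  have "hd ?Y' = None \<and> (\<exists>y\<in>set ?Y'. y \<noteq> None)" using v by (cases v) auto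
  moreover have "length ?Y' = length ds" "ds \<noteq> []" using Suc.prems by auto
  ultimately have "dec.sweep (Shift None, squares X ?Y ds, []) (Shift None, squares X ?Y' ds, [])"
    using sweep_Scan[OF R _ X] by (simp only: at_left.simps if_True simp_thms)
  moreover have "dec.sweep\<^sup>*\<^sup>* (Shift None, squares X ?Y' ds, []) (Idle, squares X (padded (length ds) v) ds, [])"
    using Suc.IH[of "Suc k"] Suc.prems by simp
  ultimately show ?case by (rule converse_rtranclp_into_rtranclp)
qed

lemma decides_Idle:
  assumes "length u \<le> n" "length v \<le> n"
  shows "decides (Idle, squares (padded n u) (padded n v) (replicate n 0), []) (equivalent u v)"
proof -
  let ?ds = "replicate n (0 :: nat)"
  have "rmealy pass_left Idle cs = (Idle, cs)" for cs
    using rmealy_stable[of cs pass_left Idle id id] by simp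
  then have "dec.sweep (Idle, squares (padded n u) (padded n v) ?ds, []) (stage False u v ?ds)"
    by (intro sweep_to_stage) auto
  moreover have "decides (stage False u v ?ds) (equivalent u v)"
    using decides_first_stage[of u ?ds v] agree_equivalent[OF assms] assms base_pos
    by (simp add: counter_zero subset_iff)
  ultimately show ?thesis by (rule decides_sweep)
qed

lemma decides_well_formed:
  assumes "empties \<or> u \<noteq> [] \<and> v \<noteq> []"
  shows "decides (In_right False, map letter_square (codes u @ [1] @ codes v), []) (equivalent u v)"
proof -
  let ?n = "length u + 1 + length v"
  let ?X = "map Some u @ None # replicate (length v) None"
  let ?Y = "replicate (length u + 1) None @ map Some v"
  let ?ds = "replicate ?n (0 :: nat)"
  have 0: "1 \<notin> set (codes u)" by auto
  have X: "?X = padded ?n u" by (simp add: padded_def)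
  have "rmealy pass_left (In_right False) (map letter_square (codes u @ [1] @ codes v)) =
     (In_left (v \<noteq> []) (u \<noteq> []), map letter_square (codes u) @ (unmarked None, unmarked None, 0) #
        map (\<lambda>a. (unmarked None, unmarked (Some a), 0)) v)"
    using rmealy_In_right[of False v] rmealy_In_left[of "v \<noteq> []" False "codes u"] 0
    by (simp add: rmealy_append letter_square_simps o_def del: One_nat_def) (simp add: unmarked_def)
  then have L: "rmealy pass_left (In_right False) (map letter_square (codes u @ [1] @ codes v)) =
     (In_left (v \<noteq> []) (u \<noteq> []), squares ?X ?Y ?ds)"
    by (simp only: squares_initial)
  have S: "dec.sweep (In_right False, map letter_square (codes u @ [1] @ codes v), [])
    (if hd ?Y = None \<and> (\<exists>y\<in>set ?Y. y \<noteq> None) then Shift None else Idle, squares ?X ?Y ?ds, [])"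
    by (rule sweep_Scan[OF L]) (use assms in auto)
  have "dec.sweep\<^sup>*\<^sup>* (if hd ?Y = None \<and> (\<exists>y\<in>set ?Y. y \<noteq> None) then Shift None else Idle, squares ?X ?Y ?ds, [])
     (Idle, squares ?X (padded ?n v) ?ds, [])"
  proof (cases "v = []")
    case True
    then show ?thesis by (simp add: padded_def)
  next
    case False
    then have e: "(if hd ?Y = None \<and> (\<exists>y\<in>set ?Y. y \<noteq> None) then Shift None else Idle) = Shift None"
      by (cases v) auto
    have "dec.sweep\<^sup>*\<^sup>* (Shift None, squares ?X ?Y ?ds, []) (Idle, squares ?X (padded ?n v) ?ds, [])"
      using shift_loop[of v ?X ?ds "length u" 0] False by simp
    then show ?thesis unfolding e .
  qed
  with S have "dec.sweep\<^sup>*\<^sup>* (In_right False, map letter_square (codes u @ [1] @ codes v), [])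
     (Idle, squares (padded ?n u) (padded ?n v) ?ds, [])"
    unfolding X by (rule converse_rtranclp_into_rtranclp)
  then show ?thesis by (rule decides_sweeps) (rule decides_Idle, auto)
qed

lemma codes_image: "w \<in> lists (word_problem_alphabet generators) \<Longrightarrow> 1 \<notin> set w \<Longrightarrow> \<exists>v. w = codes v"
proof (induction w)
  case (Cons a w)
  then obtain v where "w = codes v" by auto
  moreover obtain b :: 'a where "a = to_nat b + 2"
    using Cons.prems by (auto simp: word_problem_alphabet_def generators_def)
  ultimately show ?case by (intro exI[of _ "b # v"]) simp
qed simp

lemma last_occurrence_unique:
  assumes "xs @ a # ys = xs' @ a # ys'" "a \<notin> set ys" "a \<notin> set ys'"
  shows "xs = xs' \<and> ys = ys'"
proof -
  have *: "takeWhile (\<lambda>b. b \<noteq> a) (rev (us @ a # vs)) = rev vs" if "a \<notin> set vs" for us vs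
    using that by (subst rev_append) (simp add: takeWhile_append)
  from *[OF assms(2), of xs] *[OF assms(3), of xs'] assms(1) have "ys = ys'" by simp
  with assms(1) show ?thesis by simp
qed

lemma codes_inject: "codes u = codes v \<longleftrightarrow> u = v"
proof -
  have "inj (\<lambda>a :: nat. a + 2)" by (simp add: inj_def)
  then show ?thesis using inj_map_to_nat by (metis inj_map_eq_map)
qed

lemma codes_split:
  assumes "w1 @ 1 # codes v = codes u' @ 1 # codes v'" shows "w1 = codes u' \<and> v = v'"
proof -
  have "1 \<notin> set (codes v)" "1 \<notin> set (codes v')" by auto
  then have "w1 = codes u'" "codes v = codes v'"
    using last_occurrence_unique[OF assms] by blast+
  then show ?thesis using codes_inject by blast
qed

theorem word_problem_in_PSPACE:
  assumes W: "W = (if empties then lists generators else nonempty_words generators)"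
  shows "in_PSPACE (word_problem_alphabet generators) (word_problem W relators)"
proof (rule dec.sweeper_in_PSPACE)
  let ?L = "word_problem W relators"
  have mem: "map to_nat u \<in> W \<longleftrightarrow> empties \<or> u \<noteq> []" for u :: "'a list"
    using W by (auto simp: generators_def)
  have WW: "W = lists generators \<or> W = nonempty_words generators" using W by auto
  show "?L \<subseteq> lists (word_problem_alphabet generators)"
    using WW by (fastforce simp: word_problem_def word_problem_alphabet_def)
  show "([] \<in> ?L) = False" by (auto simp: word_problem_def)
  have L_iff: "x \<in> ?L \<longleftrightarrow> (\<exists>u v. x = codes u @ [1] @ codes v \<and> (empties \<or> u \<noteq> [] \<and> v \<noteq> []) \<and> equivalent u v)" for x
  proof
    assume "x \<in> ?L"
    then obtain u v where x: "x = map (\<lambda>a. a + 2) u @ [1] @ map (\<lambda>a. a + 2) v" "u \<in> W" "v \<in> W"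
      "equal_in W relators u v" by (auto simp: word_problem_def)
    obtain u' v' :: "'a list" where "u = map to_nat u'" "v = map to_nat v'"
      using x(2,3) WW generators_words by (metis DiffD1)
    with x show "\<exists>u v. x = codes u @ [1] @ codes v \<and> (empties \<or> u \<noteq> [] \<and> v \<noteq> []) \<and> equivalent u v"
      using equal_in_relators[OF WW] mem by blast
  next
    assume "\<exists>u v. x = codes u @ [1] @ codes v \<and> (empties \<or> u \<noteq> [] \<and> v \<noteq> []) \<and> equivalent u v"
    then show "x \<in> ?L"
      unfolding word_problem_def using equal_in_relators[OF WW] mem by blast
  qed
  fix w assume w: "w \<in> lists (word_problem_alphabet generators)" "w \<noteq> []"
  have "decides (In_right False, map letter_square w, []) (w \<in> ?L)"
  proof (cases "1 \<in> set w")
    case False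
    then obtain v where v: "w = codes v" using codes_image w by blast
    have "w \<notin> ?L" using False by (auto simp: L_iff)
    then show ?thesis using rmealy_In_right[of False v] by (auto simp: v intro!: decides_now)
  next
    case True
    then obtain w1 w2 where w12: "w = w1 @ 1 # w2" "1 \<notin> set w2" by (meson split_list_last)
    then obtain v where v: "w2 = codes v" using codes_image w by auto
    show ?thesis
    proof (cases "1 \<in> set w1 \<or> \<not> (empties \<or> w1 \<noteq> [] \<and> v \<noteq> [])")
      case True
      have "rmealy pass_left (In_right False) (map letter_square w) =
        (if 1 \<in> set w1 then Malformed else In_left (v \<noteq> []) (w1 \<noteq> []), snd (rmealy pass_left (In_right False) (map letter_square w)))"
        using rmealy_In_right[of False v] rmealy_In_left[of "v \<noteq> []" False w1]
        by (simp add: w12 v rmealy_append letter_square_simps o_def del: One_nat_def) (simp add: unmarked_def)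
      moreover have "w \<notin> ?L"
      proof
        assume "w \<in> ?L"
        then obtain u' v' where *: "w = codes u' @ [1] @ codes v'" "empties \<or> u' \<noteq> [] \<and> v' \<noteq> []"
          by (auto simp: L_iff)
        then have "w1 = codes u' \<and> v = v'" using codes_split[of w1 v u' v'] by (simp add: w12 v)
        with True * show False by auto
      qed
      moreover have "at_left empties (if 1 \<in> set w1 then Malformed else In_left (v \<noteq> []) (w1 \<noteq> [])) = Inl False"
        using True by auto
      ultimately show ?thesis using decides_now by simp
    next
      case False
      then obtain u where u: "w1 = codes u" using codes_image w w12 by auto
      have "w \<in> ?L \<longleftrightarrow> equivalent u v"
      proof
        assume "w \<in> ?L"
        then obtain u' v' where *: "w = codes u' @ [1] @ codes v'" "equivalent u' v'"
          by (auto simp: L_iff)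
        then have "codes u = codes u' \<and> v = v'" using codes_split[of w1 v u' v'] by (simp add: w12 v u)
        then have "u = u'" "v = v'" using codes_inject by blast+
        then show "equivalent u v" using * by simp
      next
        assume "equivalent u v"
        then show "w \<in> ?L" using False unfolding L_iff by (intro exI[of _ u] exI[of _ v]) (auto simp: w12 u v)
      qed
      then show ?thesis using decides_well_formed[of u v] False by (simp add: w12 u v)
    qed
  qed
  then show "\<exists>s ds xs s1 ds1. dec.sweep\<^sup>*\<^sup>* (In_right False, map letter_square w, []) (s, ds, xs) \<and>
      rmealy pass_left s ds = (s1, ds1) \<and> at_left empties s1 = Inl (w \<in> ?L)"
    unfolding decides_def .
qed (simp_all add: fst_at_right)

end
end

section \<open>A rewriting head that interprets programs\<close>

text \<open>
  A programming language for a row of bits with a current position: write a bit, move the position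
  by one bit or back to the start of the block, skip to the next \<open>End_test\<close> if the current bit is
  off, restart the program, accept.
\<close>

datatype instr = Put bool | Right | Left | Home | Test | End_test | Restart | Accept

text \<open>
  The boolean of an instruction marks the one being executed.  A bit carries its value, whether it is
  the first of a block, and whether it is the current one.
\<close>

datatype sym = Ins instr bool | Begin | Separator | Bit bool bool bool

datatype agent = Fetch | Execute instr | Mark_right | Mark_left | To_start | Return | Return_skip
| Seek | Rewind | Accepted

text \<open>
  A head that reads a letter either passes it or stays on its side of the letter, in both cases
  rewriting it.
\<close>

datatype action = Pass sym agent | Turn sym agent

datatype letter = Before sym | After sym | At agent | Zero

instance instr :: finite
proof
  have "(UNIV :: instr set) \<subseteq> range Put \<union> {Right, Left, Home, Test, End_test, Restart, Accept}"
    by (auto, metis instr.exhaust rangeI)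
  then show "finite (UNIV :: instr set)" by (rule finite_subset) simp
qed

instance sym :: finite
proof
  have "x \<in> case_prod Ins ` UNIV \<union> {Begin, Separator} \<union> (\<lambda>(a, b, c). Bit a b c) ` UNIV" for x
    by (cases x) (auto simp: image_iff)
  then have "(UNIV :: sym set) \<subseteq> case_prod Ins ` UNIV \<union> {Begin, Separator} \<union> (\<lambda>(a, b, c). Bit a b c) ` UNIV"
    by blast
  then show "finite (UNIV :: sym set)" by (rule finite_subset) simp
qed

instance agent :: finite
proof
  have "x \<in> {Fetch, Mark_right, Mark_left, To_start, Return, Return_skip, Seek, Rewind, Accepted} \<union> range Execute" for x
    by (cases x) auto
  then have "(UNIV :: agent set) \<subseteq> {Fetch, Mark_right, Mark_left, To_start, Return, Return_skip, Seek, Rewind, Accepted} \<union> range Execute"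
    by blast
  then show "finite (UNIV :: agent set)" by (rule finite_subset) simp
qed

instance letter :: finite
proof
  have "x \<in> range Before \<union> range After \<union> range At \<union> {Zero}" for x
    by (cases x) auto
  then have "(UNIV :: letter set) \<subseteq> range Before \<union> range After \<union> range At \<union> {Zero}" by blast
  then show "finite (UNIV :: letter set)" by (rule finite_subset) simp
qed

fun faces_right :: "agent \<Rightarrow> bool" where
  "faces_right q \<longleftrightarrow> q \<in> {Fetch, Mark_right, Seek} \<union> range Execute"

text \<open>
  An instruction other than \<open>End_test\<close>, \<open>Restart\<close> and \<open>Accept\<close> is marked,
  carried to the current bit, executed there, and the head returns to the mark.  A failed test returns
  as \<open>Return_skip\<close> and continues as \<open>Seek\<close> behind the mark.  At the first bit \<open>Left\<close>
  has no effect: \<open>Mark_left\<close> meets the separator and turns back.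
\<close>

fun act :: "agent \<Rightarrow> sym \<Rightarrow> action option" where
  "act Fetch (Ins i False) = (case i of
       End_test \<Rightarrow> Some (Pass (Ins End_test False) Fetch)
     | Restart \<Rightarrow> Some (Turn (Ins Restart False) Rewind)
     | Accept \<Rightarrow> Some (Turn (Ins Accept False) Accepted)
     | _ \<Rightarrow> Some (Pass (Ins i True) (Execute i)))"
| "act (Execute i) (Ins j False) = Some (Pass (Ins j False) (Execute i))"
| "act (Execute i) Separator = Some (Pass Separator (Execute i))"
| "act (Execute i) (Bit b s False) = Some (Pass (Bit b s False) (Execute i))"
| "act (Execute i) (Bit b s True) = (case i of
       Put c \<Rightarrow> Some (Turn (Bit c s True) Return)
     | Right \<Rightarrow> Some (Pass (Bit b s False) Mark_right)
     | Left \<Rightarrow> Some (Turn (Bit b s False) Mark_left)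
     | Home \<Rightarrow> Some (if s then Turn (Bit b s True) Return else Turn (Bit b s False) To_start)
     | Test \<Rightarrow> Some (Turn (Bit b s True) (if b then Return else Return_skip))
     | _ \<Rightarrow> None)"
| "act Mark_right (Bit b s False) = Some (Turn (Bit b s True) Return)"
| "act Mark_left (Bit b s False) = Some (Pass (Bit b s True) Return)"
| "act Mark_left Separator = Some (Turn Separator Mark_right)"
| "act To_start (Bit b s False) =
     Some (if s then Pass (Bit b s True) Return else Pass (Bit b s False) To_start)"
| "act Return (Ins i True) = Some (Turn (Ins i False) Fetch)"
| "act Return x = Some (Pass x Return)"
| "act Return_skip (Ins i True) = Some (Turn (Ins i False) Seek)"
| "act Return_skip x = Some (Pass x Return_skip)"
| "act Seek (Ins i False) = Some (Pass (Ins i False) (if i = End_test then Fetch else Seek))"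
| "act Rewind Begin = Some (Turn Begin Fetch)"
| "act Rewind x = Some (Pass x Rewind)"
| "act q x = None"

fun side :: "letter \<Rightarrow> kind" where
  "side (Before x) = Left_kind"
| "side (After x) = Right_kind"
| "side (At q) = Head_kind"
| "side Zero = Zero_kind"

fun local_rule :: "letter \<Rightarrow> letter \<Rightarrow> (letter \<times> letter) option" where
  "local_rule (At q) (After x) = (if faces_right q then
     (case act q x of Some (Pass y q') \<Rightarrow> Some (Before y, At q') | Some (Turn y q') \<Rightarrow> Some (At q', After y)
      | None \<Rightarrow> None) else None)"
| "local_rule (Before x) (At q) = (if faces_right q then None else
     (case act q x of Some (Pass y q') \<Rightarrow> Some (At q', After y) | Some (Turn y q') \<Rightarrow> Some (Before y, At q')
      | None \<Rightarrow> None))"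
| "local_rule a b = None"

definition looks_right :: "letter \<Rightarrow> bool" where
  "looks_right a = (case a of At q \<Rightarrow> faces_right q | _ \<Rightarrow> False)"

interpretation U: pair_rewriting side local_rule looks_right Zero "At Accepted"
proof
  show "local_rule (At Accepted) b = None" "local_rule a (At Accepted) = None" for a b
    by (cases b; simp) (cases a; simp)
  show "side a = Left_kind \<and> side b = Head_kind \<and> \<not> looks_right b \<or>
       side a = Head_kind \<and> looks_right a \<and> side b = Right_kind" if "local_rule a b = Some c" for a b c
    using that by (cases "(a, b)" rule: local_rule.cases)
      (auto simp: looks_right_def simp del: faces_right.simps split: if_splits)
  show "side a' = Left_kind \<and> side b' = Head_kind \<or> side a' = Head_kind \<and> side b' = Right_kind"
    if "local_rule a b = Some (a', b')" for a b a' b'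
    using that by (cases "(a, b)" rule: local_rule.cases)
      (auto simp del: faces_right.simps split: if_splits option.splits action.splits)
qed auto

subsection \<open>Words with one head\<close>

definition config_word :: "sym list \<Rightarrow> agent \<Rightarrow> sym list \<Rightarrow> letter list" where
  "config_word l q r = map Before (rev l) @ At q # map After r"

lemma config_word_joins: "successively (\<lambda>a b. joins (side a) (side b)) (config_word l q r)"
proof -
  have *: "successively (\<lambda>a b. joins (side a) (side b)) (map After r)" for r
    by (induction r rule: induct_list012) auto
  have "successively (\<lambda>a b. joins (side a) (side b)) (At q # map After r)"
    using *[of r] by (cases r) auto
  moreover have "successively (\<lambda>a b. joins (side a) (side b)) (map Before xs @ b # ys)"
    if "successively (\<lambda>a b. joins (side a) (side b)) (b # ys)" "side b = Head_kind" for xs b ys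
    using that
  proof (induction xs)
    case (Cons x xs) then show ?case by (cases xs) auto
  qed simp
  ultimately show ?thesis by (simp add: config_word_def)
qed

lemma live_config_word: "U.live (config_word l q r) \<longleftrightarrow> q \<noteq> Accepted"
  using config_word_joins[of l q r] by (auto simp: U.live_def) (auto simp: config_word_def)

lemma next_right:
  assumes "faces_right q" "act q x = Some a"
  shows "U.next_word (config_word l q (x # r)) =
    (case a of Pass y q' \<Rightarrow> config_word (y # l) q' r | Turn y q' \<Rightarrow> config_word l q' (y # r))"
proof -
  obtain c d where r: "local_rule (At q) (After x) = Some (c, d)"
    using assms by (cases a) (auto simp del: faces_right.simps)
  have "U.next_word (config_word l q (x # r)) = map Before (rev l) @ c # d # map After r"
    using U.next_word_live[OF r, of "map Before (rev l)" "map After r"] config_word_joins[of l q "x # r"]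
    by (simp add: config_word_def)
  then show ?thesis using r assms
    by (auto simp: config_word_def simp del: faces_right.simps split: action.splits)
qed

lemma next_left:
  assumes "\<not> faces_right q" "act q x = Some a"
  shows "U.next_word (config_word (x # l) q r) =
    (case a of Pass y q' \<Rightarrow> config_word l q' (y # r) | Turn y q' \<Rightarrow> config_word (y # l) q' r)"
proof -
  obtain c d where r: "local_rule (Before x) (At q) = Some (c, d)"
    using assms by (cases a) (auto simp del: faces_right.simps)
  have "U.next_word (config_word (x # l) q r) = map Before (rev l) @ c # d # map After r"
    using U.next_word_live[OF r, of "map Before (rev l)" "map After r"] config_word_joins[of "x # l" q r]
    by (simp add: config_word_def)
  then show ?thesis using r assms
    by (auto simp: config_word_def simp del: faces_right.simps split: action.splits)
qed

text \<open>
  The only place a rule could apply is at the head.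
\<close>

lemma next_stuck:
  assumes "faces_right q" "act q x = None"
  shows "U.next_word (config_word l q (x # r)) = config_word l q (x # r)"
proof -
  have right_fixed: "U.next_word (map After r) = map After r" for r
    by (induction r rule: induct_list012) auto
  have 0: "U.next_word (At q # map After (x # r)) = At q # map After (x # r)"
    using assms right_fixed[of "x # r"] by (simp del: faces_right.simps)
  have "U.next_word (map Before xs @ At q # ys) = map Before xs @ At q # ys"
    if "U.next_word (At q # ys) = At q # ys" for xs ys
    using that
  proof (induction xs)
    case (Cons a xs)
    then show ?case using assms(1) by (cases xs) (simp_all del: faces_right.simps)
  qed simp
  from this[OF 0] show ?thesis by (simp add: config_word_def)
qed

definition reaches :: "letter list \<Rightarrow> letter list \<Rightarrow> bool" where
  "reaches w w' \<longleftrightarrow> (\<exists>i. (U.next_word ^^ i) w = w')"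

lemma reaches_refl: "reaches w w"
  unfolding reaches_def by (intro exI[of _ 0]) simp

lemma reaches_trans: "reaches u v \<Longrightarrow> reaches v w \<Longrightarrow> reaches u w"
  unfolding reaches_def by (elim exE) (metis funpow_add o_apply)

lemma reaches_next: "reaches (U.next_word u) v \<Longrightarrow> reaches u v"
  unfolding reaches_def by (elim exE) (metis funpow_Suc_right o_apply)

lemma reaches_right:
  assumes "faces_right q" "act q x = Some a"
    "reaches (case a of Pass y q' \<Rightarrow> config_word (y # l) q' r | Turn y q' \<Rightarrow> config_word l q' (y # r)) v"
  shows "reaches (config_word l q (x # r)) v"
  using assms reaches_next next_right by metis

lemma reaches_left:
  assumes "\<not> faces_right q" "act q x = Some a"
    "reaches (case a of Pass y q' \<Rightarrow> config_word l q' (y # r) | Turn y q' \<Rightarrow> config_word (y # l) q' r) v"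
  shows "reaches (config_word (x # l) q r) v"
  using assms reaches_next next_left by metis

lemma sweep_right:
  assumes "faces_right q" "\<And>x. x \<in> set xs \<Longrightarrow> act q x = Some (Pass x q)"
  shows "reaches (config_word l q (xs @ r)) (config_word (rev xs @ l) q r)"
  using assms(2)
proof (induction xs arbitrary: l)
  case (Cons x xs)
  then show ?case using reaches_right[OF assms(1), of x "Pass x q"] by simp
qed (simp add: reaches_refl)

lemma sweep_left:
  assumes "\<not> faces_right q" "\<And>x. x \<in> set xs \<Longrightarrow> act q x = Some (Pass x q)"
  shows "reaches (config_word (rev xs @ l) q r) (config_word l q (xs @ r))"
  using assms(2)
proof (induction xs arbitrary: r rule: rev_induct)
  case (snoc x xs)
  then show ?case using reaches_left[OF assms(1), of x "Pass x q"] by simp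
qed (simp add: reaches_refl)

subsection \<open>Interpreting instructions\<close>

abbreviation ins :: "instr \<Rightarrow> sym" where "ins i \<equiv> Ins i False"

definition bit :: "bool \<Rightarrow> bool \<times> bool \<Rightarrow> sym" where
  "bit m x = Bit (fst x) (snd x) m"

type_synonym data = "(bool \<times> bool) list \<times> (bool \<times> bool) \<times> (bool \<times> bool) list"

fun data_syms :: "data \<Rightarrow> sym list" where
  "data_syms (xs, x, ys) = map (bit False) xs @ bit True x # map (bit False) ys"

text \<open>
  A configuration of the interpreter between two instructions: \<open>p1\<close> has been executed,
  \<open>p2\<close> lies ahead.  The letters \<open>j\<close> to the left of the program are the junk that the
  reduction puts in place of its input.
\<close>

definition conf :: "sym list \<Rightarrow> instr list \<Rightarrow> instr list \<Rightarrow> data \<Rightarrow> letter list" where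
  "conf j p1 p2 d = config_word (rev (map ins p1) @ Begin # j) Fetch (map ins p2 @ Separator # data_syms d)"

lemma outbound:
  assumes "i \<in> range Put \<union> {Right, Left, Home, Test}"
  shows "reaches (conf j p1 (i # p2) (xs, x, ys))
    (config_word (rev (map ins p2 @ Separator # map (bit False) xs) @ Ins i True # rev (map ins p1) @ Begin # j)
       (Execute i) (bit True x # map (bit False) ys))"
proof -
  have "act Fetch (Ins i False) = Some (Pass (Ins i True) (Execute i))" using assms by auto
  moreover have "reaches (config_word (Ins i True # rev (map ins p1) @ Begin # j) (Execute i)
       ((map ins p2 @ Separator # map (bit False) xs) @ bit True x # map (bit False) ys))
    (config_word (rev (map ins p2 @ Separator # map (bit False) xs) @ Ins i True # rev (map ins p1) @ Begin # j)
       (Execute i) (bit True x # map (bit False) ys))"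
    by (rule sweep_right) (auto simp: bit_def)
  ultimately show ?thesis unfolding conf_def by (auto intro: reaches_right)
qed

lemma inbound:
  assumes "\<And>i. Ins i True \<notin> set mid" "mid @ r = map ins p2 @ Separator # data_syms d"
  shows "reaches (config_word (rev mid @ Ins i True # rev (map ins p1) @ Begin # j) Return r)
    (conf j (p1 @ [i]) p2 d)"
proof -
  have "act Return x = Some (Pass x Return)" if "x \<in> set mid" for x
  proof (cases x)
    case (Ins i' m)
    then have "\<not> m" using that assms(1) by (metis (full_types))
    then show ?thesis using Ins by simp
  qed auto
  then have "reaches (config_word (rev mid @ Ins i True # rev (map ins p1) @ Begin # j) Return r)
      (config_word (Ins i True # rev (map ins p1) @ Begin # j) Return (mid @ r))"
    by (intro sweep_left) auto
  moreover have "reaches (config_word (Ins i True # rev (map ins p1) @ Begin # j) Return (mid @ r))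
      (conf j (p1 @ [i]) p2 d)"
    using assms(2) by (intro reaches_left[where a = "Turn (Ins i False) Fetch"]) (auto simp: conf_def reaches_refl)
  ultimately show ?thesis by (rule reaches_trans)
qed

lemma exec_Put: "reaches (conf j p1 (Put c # p2) (xs, (b, s), ys)) (conf j (p1 @ [Put c]) p2 (xs, (c, s), ys))"
proof (rule reaches_trans[OF outbound])
  let ?l = "Ins (Put c) True # rev (map ins p1) @ Begin # j" and ?goal = "conf j (p1 @ [Put c]) p2 (xs, (c, s), ys)"
  let ?mid = "map ins p2 @ Separator # map (bit False) xs"
  have "reaches (config_word (rev ?mid @ ?l) Return
      (bit True (c, s) # map (bit False) ys)) ?goal"
    by (rule inbound) (auto simp: bit_def)
  then show "reaches (config_word (rev ?mid @ ?l) (Execute (Put c))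
      (bit True (b, s) # map (bit False) ys)) ?goal"
    by (intro reaches_right[where a = "Turn (bit True (c, s)) Return"]) (auto simp: bit_def)
qed auto

lemma exec_Right: "reaches (conf j p1 (Right # p2) (xs, x, y # ys)) (conf j (p1 @ [Right]) p2 (xs @ [x], y, ys))"
proof (rule reaches_trans[OF outbound])
  let ?l = "Ins Right True # rev (map ins p1) @ Begin # j" and ?goal = "conf j (p1 @ [Right]) p2 (xs @ [x], y, ys)"
  let ?mid = "map ins p2 @ Separator # map (bit False) xs"
  have "reaches (config_word (rev (?mid @ [bit False x]) @ ?l) Return
      (bit True y # map (bit False) ys)) ?goal"
    by (rule inbound) (auto simp: bit_def)
  then have "reaches (config_word (rev (?mid @ [bit False x]) @ ?l) Mark_right
      (bit False y # map (bit False) ys)) ?goal"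
    by (intro reaches_right[where a = "Turn (bit True y) Return"]) (auto simp: bit_def)
  then show "reaches (config_word (rev ?mid @ ?l) (Execute Right)
      (bit True x # map (bit False) (y # ys))) ?goal"
    by (intro reaches_right[where a = "Pass (bit False x) Mark_right"]) (auto simp: bit_def)
qed auto

lemma exec_Left: "reaches (conf j p1 (Left # p2) (xs @ [w], x, ys)) (conf j (p1 @ [Left]) p2 (xs, w, x # ys))"
proof (rule reaches_trans[OF outbound])
  let ?l = "Ins Left True # rev (map ins p1) @ Begin # j" and ?goal = "conf j (p1 @ [Left]) p2 (xs, w, x # ys)"
  let ?mid = "map ins p2 @ Separator # map (bit False) xs"
  have "reaches (config_word (rev ?mid @ ?l) Return
      (bit True w # bit False x # map (bit False) ys)) ?goal"
    by (rule inbound) (auto simp: bit_def)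
  then have "reaches (config_word (bit False w # rev ?mid @ ?l) Mark_left
      (bit False x # map (bit False) ys)) ?goal"
    by (intro reaches_left[where a = "Pass (bit True w) Return"]) (auto simp: bit_def)
  then show "reaches (config_word (rev (map ins p2 @ Separator # map (bit False) (xs @ [w])) @ ?l) (Execute Left)
      (bit True x # map (bit False) ys)) ?goal"
    by (intro reaches_right[where a = "Turn (bit False x) Mark_left"]) (auto simp: bit_def)
qed auto

lemma exec_Left_wall: "reaches (conf j p1 (Left # p2) ([], x, ys)) (conf j (p1 @ [Left]) p2 ([], x, ys))"
proof (rule reaches_trans[OF outbound])
  let ?l = "Ins Left True # rev (map ins p1) @ Begin # j" and ?goal = "conf j (p1 @ [Left]) p2 ([], x, ys)"
  let ?mid = "map ins p2 @ [Separator]"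
  have "reaches (config_word (rev ?mid @ ?l) Return
      (bit True x # map (bit False) ys)) ?goal"
    by (rule inbound) (auto simp: bit_def)
  then have "reaches (config_word (rev ?mid @ ?l) Mark_right
      (bit False x # map (bit False) ys)) ?goal"
    by (intro reaches_right[where a = "Turn (bit True x) Return"]) (auto simp: bit_def)
  then have "reaches (config_word (rev ?mid @ ?l) Mark_left
      (bit False x # map (bit False) ys)) ?goal"
    by (simp, intro reaches_left[where a = "Turn Separator Mark_right"]) auto
  then show "reaches (config_word (rev (map ins p2 @ Separator # map (bit False) []) @ ?l) (Execute Left)
      (bit True x # map (bit False) ys)) ?goal"
    by (intro reaches_right[where a = "Turn (bit False x) Mark_left"]) (auto simp: bit_def)
qed auto

lemma exec_Home_start:
  "reaches (conf j p1 (Home # p2) (xs, (b, True), ys)) (conf j (p1 @ [Home]) p2 (xs, (b, True), ys))"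
proof (rule reaches_trans[OF outbound])
  let ?l = "Ins Home True # rev (map ins p1) @ Begin # j" and ?goal = "conf j (p1 @ [Home]) p2 (xs, (b, True), ys)"
  let ?mid = "map ins p2 @ Separator # map (bit False) xs"
  have "reaches (config_word (rev ?mid @ ?l) Return
      (bit True (b, True) # map (bit False) ys)) ?goal"
    by (rule inbound) (auto simp: bit_def)
  then show "reaches (config_word (rev ?mid @ ?l) (Execute Home)
      (bit True (b, True) # map (bit False) ys)) ?goal"
    by (intro reaches_right[where a = "Turn (bit True (b, True)) Return"]) (auto simp: bit_def)
qed auto

lemma exec_Home:
  assumes "\<forall>y \<in> set zs. \<not> snd y" "\<not> snd x"
  shows "reaches (conf j p1 (Home # p2) (xs @ (b, True) # zs, x, ys)) (conf j (p1 @ [Home]) p2 (xs, (b, True), zs @ x # ys))"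
proof (rule reaches_trans[OF outbound])
  let ?mid = "map ins p2 @ Separator # map (bit False) xs"
  let ?l = "Ins Home True # rev (map ins p1) @ Begin # j"
  let ?goal = "conf j (p1 @ [Home]) p2 (xs, (b, True), zs @ x # ys)"
  have "reaches (config_word (rev ?mid @ ?l) Return
      (bit True (b, True) # map (bit False) (zs @ x # ys))) ?goal"
    by (rule inbound) (auto simp: bit_def)
  then have 1: "reaches (config_word (bit False (b, True) # rev ?mid @ ?l) To_start
      (map (bit False) (zs @ x # ys))) ?goal"
    by (intro reaches_left[where a = "Pass (bit True (b, True)) Return"]) (auto simp: bit_def)
  have "reaches (config_word (rev (map (bit False) zs) @ bit False (b, True) # rev ?mid @ ?l) To_start
      (bit False x # map (bit False) ys)) (config_word (bit False (b, True) # rev ?mid @ ?l) To_start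
      (map (bit False) zs @ bit False x # map (bit False) ys))"
    by (rule sweep_left) (use assms in \<open>auto simp: bit_def\<close>)
  with 1 have "reaches (config_word (rev (map (bit False) zs) @ bit False (b, True) # rev ?mid @ ?l) To_start
      (bit False x # map (bit False) ys)) ?goal"
    by (auto intro: reaches_trans)
  then show "reaches (config_word (rev (map ins p2 @ Separator # map (bit False) (xs @ (b, True) # zs)) @ ?l) (Execute Home)
      (bit True x # map (bit False) ys)) ?goal"
    using assms(2) by (intro reaches_right[where a = "Turn (bit False x) To_start"]) (auto simp: bit_def)
qed auto

lemma exec_Test: "reaches (conf j p1 (Test # p2) (xs, (True, s), ys)) (conf j (p1 @ [Test]) p2 (xs, (True, s), ys))"
proof (rule reaches_trans[OF outbound])
  let ?l = "Ins Test True # rev (map ins p1) @ Begin # j" and ?goal = "conf j (p1 @ [Test]) p2 (xs, (True, s), ys)"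
  let ?mid = "map ins p2 @ Separator # map (bit False) xs"
  have "reaches (config_word (rev ?mid @ ?l) Return
      (bit True (True, s) # map (bit False) ys)) ?goal"
    by (rule inbound) (auto simp: bit_def)
  then show "reaches (config_word (rev ?mid @ ?l) (Execute Test)
      (bit True (True, s) # map (bit False) ys)) ?goal"
    by (intro reaches_right[where a = "Turn (bit True (True, s)) Return"]) (auto simp: bit_def)
qed auto

lemma exec_Test_skip:
  assumes "End_test \<notin> set is"
  shows "reaches (conf j p1 (Test # is @ End_test # p2) (xs, (False, s), ys))
    (conf j (p1 @ Test # is @ [End_test]) p2 (xs, (False, s), ys))"
proof (rule reaches_trans[OF outbound])
  let ?mid = "map ins (is @ End_test # p2) @ Separator # map (bit False) xs"
  let ?l = "rev (map ins p1) @ Begin # j"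
  let ?r = "bit True (False, s) # map (bit False) ys"
  let ?goal = "conf j (p1 @ Test # is @ [End_test]) p2 (xs, (False, s), ys)"
  have "reaches (config_word (rev (map ins is) @ ins Test # ?l) Seek
      (map ins (End_test # p2) @ Separator # map (bit False) xs @ ?r)) ?goal"
    by (simp, intro reaches_right[where a = "Pass (ins End_test) Fetch"]) (auto simp: conf_def reaches_refl)
  moreover have "reaches (config_word (ins Test # ?l) Seek (map ins is @ map ins (End_test # p2) @ Separator # map (bit False) xs @ ?r))
     (config_word (rev (map ins is) @ ins Test # ?l) Seek (map ins (End_test # p2) @ Separator # map (bit False) xs @ ?r))"
    by (rule sweep_right) (use assms in auto)
  ultimately have "reaches (config_word (ins Test # ?l) Seek (?mid @ ?r)) ?goal"
    by (auto intro: reaches_trans)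
  then have 1: "reaches (config_word (Ins Test True # ?l) Return_skip (?mid @ ?r)) ?goal"
    by (intro reaches_left[where a = "Turn (ins Test) Seek"]) auto
  have "reaches (config_word (rev ?mid @ Ins Test True # ?l) Return_skip ?r)
      (config_word (Ins Test True # ?l) Return_skip (?mid @ ?r))"
    by (rule sweep_left) (auto simp: bit_def)
  from reaches_trans[OF this 1]
  show "reaches (config_word (rev ?mid @ Ins Test True # ?l) (Execute Test) ?r) ?goal"
    by (intro reaches_right[where a = "Turn (bit True (False, s)) Return_skip"]) (auto simp: bit_def)
qed auto

lemma exec_Restart: "reaches (conf j p1 (Restart # p2) d) (conf j [] (p1 @ Restart # p2) d)"
proof -
  let ?r = "map ins (Restart # p2) @ Separator # data_syms d"
  have 1: "reaches (config_word (Begin # j) Rewind (map ins p1 @ ?r)) (conf j [] (p1 @ Restart # p2) d)"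
    by (rule reaches_left[where a = "Turn Begin Fetch"]) (auto simp: conf_def reaches_refl)
  have "reaches (config_word (rev (map ins p1) @ Begin # j) Rewind ?r) (config_word (Begin # j) Rewind (map ins p1 @ ?r))"
    by (rule sweep_left) auto
  from reaches_trans[OF this 1] show ?thesis
    unfolding conf_def by (simp, intro reaches_right[where a = "Turn (ins Restart) Rewind"]) auto
qed

lemma exec_Accept: "U.vanishes (conf j p1 (Accept # p2) d)"
proof -
  have "\<not> U.live ((U.next_word ^^ 1) (conf j p1 (Accept # p2) d))"
    using next_right[of Fetch "ins Accept"] by (simp add: conf_def live_config_word)
  then show ?thesis unfolding U.vanishes_def by blast
qed

lemma exec_end: "U.next_word (conf j p1 [] d) = conf j p1 [] d" "U.live (conf j p1 [] d)"
  unfolding conf_def by (simp_all add: next_stuck live_config_word)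

section \<open>Simulating Turing machines by programs\<close>

subsection \<open>Blocks of bits\<close>

definition block :: "bool list \<Rightarrow> (bool \<times> bool) list" where
  "block v = map (\<lambda>i. (v ! i, i = 0)) [0..<length v]"

text \<open>
  The position is bit \<open>k\<close> of block \<open>h\<close>; a block is given by the values of its bits.
\<close>

definition at_bit :: "bool list list \<Rightarrow> nat \<Rightarrow> nat \<Rightarrow> data" where
  "at_bit vs h k = (concat (map block (take h vs)) @ take k (block (vs ! h)), (vs ! h ! k, k = 0),
     drop (Suc k) (block (vs ! h)) @ concat (map block (drop (Suc h) vs)))"

definition runs :: "instr list \<Rightarrow> data \<Rightarrow> data \<Rightarrow> bool" where
  "runs is d d' \<longleftrightarrow> (\<forall>j p1 p2. reaches (conf j p1 (is @ p2) d) (conf j (p1 @ is) p2 d'))"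

lemma length_block [simp]: "length (block v) = length v"
  by (simp add: block_def)

lemma nth_block: "i < length v \<Longrightarrow> block v ! i = (v ! i, i = 0)"
  by (simp add: block_def)

lemma block_Cons: "v \<noteq> [] \<Longrightarrow> block v = (v ! 0, True) # drop (Suc 0) (block v)"
  using Cons_nth_drop_Suc[of 0 "block v"] by (simp add: nth_block)

lemma block_last: "Suc k = length v \<Longrightarrow> block v = take k (block v) @ [(v ! k, k = 0)]"
  using take_Suc_conv_app_nth[of k "block v"] by (simp add: nth_block)

lemma runs_Nil: "runs [] d d"
  by (simp add: runs_def reaches_refl)

lemma runs_append: "runs is d d' \<Longrightarrow> runs is' d' d'' \<Longrightarrow> runs (is @ is') d d''"
  unfolding runs_def using reaches_trans by fastforce

lemma runs_Cons: "runs [i] d d' \<Longrightarrow> runs is d' d'' \<Longrightarrow> runs (i # is) d d''"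
  using runs_append[of "[i]" d d' "is" d''] by simp

lemma runs_Right:
  assumes "Suc k < length (vs ! h)" shows "runs [Right] (at_bit vs h k) (at_bit vs h (Suc k))"
proof -
  have "drop (Suc k) (block (vs ! h)) = (vs ! h ! Suc k, False) # drop (Suc (Suc k)) (block (vs ! h))"
    using assms by (simp add: Cons_nth_drop_Suc[symmetric] nth_block)
  moreover have "take (Suc k) (block (vs ! h)) = take k (block (vs ! h)) @ [(vs ! h ! k, k = 0)]"
    using assms by (simp add: take_Suc_conv_app_nth nth_block)
  ultimately show ?thesis
    using exec_Right[where xs = "concat (map block (take h vs)) @ take k (block (vs ! h))"]
    by (simp add: runs_def at_bit_def)
qed

lemma runs_Rights:
  "k + m < length (vs ! h) \<Longrightarrow> runs (replicate m Right) (at_bit vs h k) (at_bit vs h (k + m))"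
proof (induction m arbitrary: k)
  case (Suc m)
  then show ?case using runs_Cons[OF runs_Right, of k vs h "replicate m Right"] Suc.IH[of "Suc k"] by simp
qed (simp add: runs_Nil)

lemma at_bit_border:
  assumes "Suc h < length vs" "Suc k = length (vs ! h)" "vs ! Suc h \<noteq> []"
  shows "at_bit vs h k = (concat (map block (take h vs)) @ take k (block (vs ! h)), (vs ! h ! k, k = 0),
      (vs ! Suc h ! 0, True) # drop (Suc 0) (block (vs ! Suc h)) @ concat (map block (drop (Suc (Suc h)) vs)))"
    "at_bit vs (Suc h) 0 = ((concat (map block (take h vs)) @ take k (block (vs ! h))) @ [(vs ! h ! k, k = 0)],
      (vs ! Suc h ! 0, True), drop (Suc 0) (block (vs ! Suc h)) @ concat (map block (drop (Suc (Suc h)) vs)))"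
proof -
  have "block (vs ! h) = take k (block (vs ! h)) @ [(vs ! h ! k, k = 0)]"
    using assms(2) by (rule block_last)
  moreover have "block (vs ! Suc h) = (vs ! Suc h ! 0, True) # drop (Suc 0) (block (vs ! Suc h))"
    using assms(3) by (rule block_Cons)
  moreover have "drop (Suc h) vs = vs ! Suc h # drop (Suc (Suc h)) vs"
    using assms by (simp add: Cons_nth_drop_Suc)
  moreover have "take (Suc h) vs = take h vs @ [vs ! h]"
    using assms by (simp add: take_Suc_conv_app_nth)
  ultimately show "at_bit vs h k = (concat (map block (take h vs)) @ take k (block (vs ! h)), (vs ! h ! k, k = 0),
      (vs ! Suc h ! 0, True) # drop (Suc 0) (block (vs ! Suc h)) @ concat (map block (drop (Suc (Suc h)) vs)))"
    "at_bit vs (Suc h) 0 = ((concat (map block (take h vs)) @ take k (block (vs ! h))) @ [(vs ! h ! k, k = 0)],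
      (vs ! Suc h ! 0, True), drop (Suc 0) (block (vs ! Suc h)) @ concat (map block (drop (Suc (Suc h)) vs)))"
    using assms(2) unfolding at_bit_def by simp_all
qed

lemma runs_Right_next:
  assumes "Suc h < length vs" "Suc k = length (vs ! h)" "vs ! Suc h \<noteq> []"
  shows "runs [Right] (at_bit vs h k) (at_bit vs (Suc h) 0)"
  unfolding runs_def at_bit_border[OF assms] append_Cons append_Nil by (intro allI exec_Right)

lemma runs_Left_prev:
  assumes "Suc h < length vs" "Suc k = length (vs ! h)" "vs ! Suc h \<noteq> []"
  shows "runs [Left] (at_bit vs (Suc h) 0) (at_bit vs h k)"
  unfolding runs_def at_bit_border[OF assms] append_Cons append_Nil by (intro allI exec_Left)

lemma runs_Left_wall: "runs [Left] (at_bit vs 0 0) (at_bit vs 0 0)"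
  using exec_Left_wall by (simp add: runs_def at_bit_def)

lemma runs_Home:
  assumes "k < length (vs ! h)" shows "runs [Home] (at_bit vs h k) (at_bit vs h 0)"
proof (cases k)
  case 0
  then show ?thesis using exec_Home_start by (simp add: runs_def at_bit_def)
next
  case (Suc k')
  let ?b = "block (vs ! h)"
  let ?zs = "drop (Suc 0) (take k ?b)"
  have t: "take k ?b = (vs ! h ! 0, True) # ?zs"
    using block_Cons[of "vs ! h"] assms Suc by (metis length_greater_0_conv less_nat_zero_code
        not_gr_zero take_Suc_Cons drop_Suc_Cons drop0)
  have z: "\<forall>y \<in> set ?zs. \<not> snd y"
  proof
    fix y assume "y \<in> set ?zs"
    then obtain i where i: "i < length ?zs" "y = ?zs ! i" by (metis in_set_conv_nth)
    then have "y = ?b ! Suc i" using assms by simp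
    then show "\<not> snd y" using i assms by (simp add: nth_block)
  qed
  have "?b = take k ?b @ (vs ! h ! k, k = 0) # drop (Suc k) ?b"
    using assms id_take_nth_drop[of k ?b] by (simp add: nth_block)
  then have "drop (Suc 0) ?b = drop (Suc 0) (take k ?b @ (vs ! h ! k, k = 0) # drop (Suc k) ?b)" by simp
  also have "\<dots> = ?zs @ (vs ! h ! k, k = 0) # drop (Suc k) ?b"
    using assms Suc by simp
  finally have d: "drop (Suc 0) ?b = ?zs @ (vs ! h ! k, k = 0) # drop (Suc k) ?b" .
  have "at_bit vs h k = (concat (map block (take h vs)) @ (vs ! h ! 0, True) # ?zs, (vs ! h ! k, k = 0),
     drop (Suc k) ?b @ concat (map block (drop (Suc h) vs)))"
    unfolding at_bit_def t[symmetric] by simp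
  moreover have "at_bit vs h 0 = (concat (map block (take h vs)), (vs ! h ! 0, True),
     ?zs @ (vs ! h ! k, k = 0) # drop (Suc k) ?b @ concat (map block (drop (Suc h) vs)))"
    unfolding at_bit_def d by simp
  ultimately show ?thesis using exec_Home[OF z, of "(vs ! h ! k, k = 0)"] Suc by (simp add: runs_def)
qed

lemma runs_Put:
  assumes "h < length vs" "k < length (vs ! h)"
  shows "runs [Put c] (at_bit vs h k) (at_bit (vs[h := (vs ! h)[k := c]]) h k)"
proof -
  have "take k (block ((vs ! h)[k := c])) = take k (block (vs ! h))"
    "drop (Suc k) (block ((vs ! h)[k := c])) = drop (Suc k) (block (vs ! h))"
    by (auto intro!: nth_equalityI simp: nth_block)
  then have "at_bit (vs[h := (vs ! h)[k := c]]) h k =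
    (concat (map block (take h vs)) @ take k (block (vs ! h)), (c, k = 0),
     drop (Suc k) (block (vs ! h)) @ concat (map block (drop (Suc h) vs)))"
    using assms by (simp add: at_bit_def)
  then show ?thesis using exec_Put by (simp add: runs_def at_bit_def)
qed

lemma runs_Test: "vs ! h ! k \<Longrightarrow> runs [Test] (at_bit vs h k) (at_bit vs h k)"
  using exec_Test by (simp add: runs_def at_bit_def)

lemma runs_Test_skip:
  "\<not> vs ! h ! k \<Longrightarrow> End_test \<notin> set is \<Longrightarrow> runs (Test # is @ [End_test]) (at_bit vs h k) (at_bit vs h k)"
  using exec_Test_skip by (simp add: runs_def at_bit_def)

definition go_to :: "nat \<Rightarrow> instr list" where
  "go_to k = Home # replicate k Right"

definition write_bit :: "nat \<Rightarrow> bool \<Rightarrow> instr list" where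
  "write_bit k c = go_to k @ [Put c]"

lemma runs_go_to:
  assumes "k < length (vs ! h)" "m < length (vs ! h)"
  shows "runs (go_to m) (at_bit vs h k) (at_bit vs h m)"
  unfolding go_to_def using runs_Cons[OF runs_Home runs_Rights[of 0 m]] assms by simp

lemma runs_write_bit:
  assumes "k < length (vs ! h)" "m < length (vs ! h)" "h < length vs"
  shows "runs (write_bit m c) (at_bit vs h k) (at_bit (vs[h := (vs ! h)[m := c]]) h m)"
  unfolding write_bit_def using runs_append[OF runs_go_to runs_Put] assms by blast

text \<open>
  Execute \<open>is\<close> if both bits of the current block are on.  A failing test may leave the position
  anywhere in the block, so every access starts with a return to the start of the block
  (\<open>go_to\<close>).
\<close>

definition guarded :: "nat \<Rightarrow> nat \<Rightarrow> instr list \<Rightarrow> instr list" where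
  "guarded k m is = go_to k @ [Test] @ go_to m @ [Test] @ is @ [End_test]"

lemma no_End_test: "End_test \<notin> set (go_to k)" "End_test \<notin> set (write_bit k c)"
  by (auto simp: go_to_def write_bit_def)

lemma runs_guarded_skip:
  assumes "x < length (vs ! h)" "k < length (vs ! h)" "m < length (vs ! h)"
    and "\<not> (vs ! h ! k \<and> vs ! h ! m)" and "End_test \<notin> set is"
  shows "\<exists>y < length (vs ! h). runs (guarded k m is) (at_bit vs h x) (at_bit vs h y)"
proof (cases "vs ! h ! k")
  case False
  have "runs (Test # (go_to m @ [Test] @ is) @ [End_test]) (at_bit vs h k) (at_bit vs h k)"
    using False assms(5) no_End_test by (intro runs_Test_skip) auto
  from runs_append[OF runs_go_to[OF assms(1,2)] this] show ?thesis
    using assms(2) by (auto simp: guarded_def)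
next
  case True
  have "runs (Test # is @ [End_test]) (at_bit vs h m) (at_bit vs h m)"
    using assms True by (intro runs_Test_skip) auto
  from runs_append[OF runs_go_to[OF assms(1,2)] runs_append[OF runs_Test[OF True]
      runs_append[OF runs_go_to[OF assms(2,3)] this]]] show ?thesis
    using assms(3) by (auto simp: guarded_def)
qed

lemma runs_guarded_enter:
  assumes "x < length (vs ! h)" "k < length (vs ! h)" "m < length (vs ! h)" "vs ! h ! k" "vs ! h ! m"
  shows "runs (go_to k @ [Test] @ go_to m @ [Test]) (at_bit vs h x) (at_bit vs h m)"
  by (rule runs_append[OF runs_go_to[OF assms(1,2)] runs_append[OF runs_Test[OF assms(4)]
      runs_append[OF runs_go_to[OF assms(2,3)] runs_Test[OF assms(5)]]]])

subsection \<open>Compiling a Turing machine\<close>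

definition position :: "'b list \<Rightarrow> 'b \<Rightarrow> nat" where
  "position xs x = (LEAST i. i < length xs \<and> xs ! i = x)"

lemma position: "x \<in> set xs \<Longrightarrow> position xs x < length xs \<and> xs ! position xs x = x"
  unfolding position_def in_set_conv_nth by (rule LeastI_ex)

context
  fixes M :: tm
  assumes fin: "finite (states M)" "finite (tape_alphabet M)"
begin

definition qs :: "nat list" where "qs = sorted_list_of_set (states M)"
definition gs :: "nat list" where "gs = sorted_list_of_set (tape_alphabet M)"

text \<open>
  A cell in unary: one bit for each state, on if the head is here in that state, and one bit for each
  symbol.
\<close>

definition content :: "nat option \<Rightarrow> nat \<Rightarrow> bool list" where
  "content so a = map (\<lambda>q. so = Some q) qs @ map (\<lambda>g. a = g) gs"

text \<open>
  The code for state number \<open>i\<close> and symbol number \<open>m\<close>.  The block boundary to the left is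
  crossed by one \<open>Left\<close> from the first bit of the block, which is without effect in the leftmost
  block, exactly as a left move of the Turing machine in cell 0.  To the right a whole block has to be
  crossed.
\<close>

definition action_code :: "nat \<Rightarrow> nat \<Rightarrow> instr list" where
  "action_code i m = (if qs ! i = accept M then [Accept] else
     case delta M (qs ! i) (gs ! m) of (q, b, mv) \<Rightarrow>
       write_bit (length qs + m) False @ write_bit (length qs + position gs b) True @ write_bit i False @
       Home # (case mv of MoveLeft \<Rightarrow> [Left] | MoveRight \<Rightarrow> replicate (length qs + length gs) Right | Stay \<Rightarrow> []) @
       write_bit (position qs q) True @ [Restart])"

text \<open>
  The rejecting state has no code; in it the program is run through to its end.
\<close>

definition table :: "(nat \<times> nat) list" where
  "table = [(i, m) \<leftarrow> List.product [0..<length qs] [0..<length gs]. qs ! i \<noteq> reject M]"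

definition case_code :: "nat \<times> nat \<Rightarrow> instr list" where
  "case_code = (\<lambda>(i, m). guarded i (length qs + m) (action_code i m))"

definition program :: "instr list" where
  "program = concat (map case_code table)"

definition contents :: "nat \<Rightarrow> config \<Rightarrow> bool list list" where
  "contents n c = map (\<lambda>i. content (if i = head c then Some (state c) else None) (tape c i)) [0..<n]"

definition bounded_config :: "nat \<Rightarrow> config \<Rightarrow> bool" where
  "bounded_config n c \<longleftrightarrow> state c \<in> states M \<and> range (tape c) \<subseteq> tape_alphabet M \<and> head c < n"

lemma set_qs [simp]: "set qs = states M" and set_gs [simp]: "set gs = tape_alphabet M"
  and distinct_qs: "distinct qs" and distinct_gs: "distinct gs"
  using fin by (simp_all add: qs_def gs_def)

lemma length_content [simp]: "length (content so a) = length qs + length gs"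
  by (simp add: content_def)

lemma nth_content: "i < length qs \<Longrightarrow> content so a ! i \<longleftrightarrow> so = Some (qs ! i)"
  "m < length gs \<Longrightarrow> content so a ! (length qs + m) \<longleftrightarrow> a = gs ! m"
  by (simp_all add: content_def nth_append)

lemma contents_props [simp]: "length (contents n c) = n"
  "i < n \<Longrightarrow> contents n c ! i = content (if i = head c then Some (state c) else None) (tape c i)"
  by (simp_all add: contents_def)

lemma content_set_symbol:
  assumes "m < length gs" "m' < length gs"
  shows "(content so (gs ! m))[length qs + m := False, length qs + m' := True] = content so (gs ! m')"
  using assms distinct_gs
  by (intro nth_equalityI) (auto simp: content_def nth_append nth_list_update nth_eq_iff_index_eq)

lemma content_clear_state:
  assumes "i < length qs"
  shows "(content (Some (qs ! i)) a)[i := False] = content None a"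
  using assms distinct_qs
  by (intro nth_equalityI) (auto simp: content_def nth_append nth_list_update nth_eq_iff_index_eq)

lemma content_set_state:
  assumes "i < length qs"
  shows "(content None a)[i := True] = content (Some (qs ! i)) a"
  using assms distinct_qs
  by (intro nth_equalityI) (auto simp: content_def nth_append nth_list_update nth_eq_iff_index_eq)

lemma action_code_no_End_test: "End_test \<notin> set (action_code i m)"
  using no_End_test by (auto simp: action_code_def split: prod.splits move.splits)

lemma runs_cases_skip:
  assumes "h < n" "x < length qs + length gs" "set ps \<subseteq> {0..<length qs} \<times> {0..<length gs}"
    and "\<And>i m. (i, m) \<in> set ps \<Longrightarrow> \<not> (qs ! i = state c \<and> gs ! m = tape c h)" and "h = head c"
  shows "\<exists>y < length qs + length gs. runs (concat (map case_code ps)) (at_bit (contents n c) h x) (at_bit (contents n c) h y)"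
  using assms(2-4)
proof (induction ps arbitrary: x)
  case Nil then show ?case by (intro exI[of _ x]) (simp add: runs_Nil)
next
  case (Cons p ps)
  obtain i m where p: "p = (i, m)" by fastforce
  have im: "i < length qs" "m < length gs" "\<not> (qs ! i = state c \<and> gs ! m = tape c h)"
    using Cons.prems p by auto
  obtain y where y: "y < length qs + length gs" "runs (case_code p) (at_bit (contents n c) h x) (at_bit (contents n c) h y)"
    using runs_guarded_skip[of x "contents n c" h i "length qs + m" "action_code i m"] Cons.prems(1) im assms(1,5)
      action_code_no_End_test by (auto simp: p case_code_def nth_content)
  obtain y' where y': "y' < length qs + length gs" "runs (concat (map case_code ps)) (at_bit (contents n c) h y) (at_bit (contents n c) h y')"
    using Cons.IH[OF y(1)] Cons.prems by auto
  then show ?case using runs_append[OF y(2) y'(2)] by (intro exI[of _ y']) simp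
qed

text \<open>
  Since states and symbols are listed without repetition, exactly one guard is satisfied, and all
  guards before it are skipped.
\<close>

lemma enter_case:
  assumes b: "bounded_config n c" and x: "x < length qs + length gs" and nr: "state c \<noteq> reject M"
  obtains p1 p2 i m where "i < length qs" "m < length gs" "qs ! i = state c" "gs ! m = tape c (head c)"
    "program = p1 @ action_code i m @ p2"
    "\<And>j. reaches (conf j [] program (at_bit (contents n c) (head c) x))
       (conf j p1 (action_code i m @ p2) (at_bit (contents n c) (head c) (length qs + m)))"
proof -
  define i where "i = position qs (state c)"
  define m where "m = position gs (tape c (head c))"
  have i: "i < length qs" "qs ! i = state c"
    using position[of "state c" qs] b by (auto simp: i_def bounded_config_def)
  have m: "m < length gs" "gs ! m = tape c (head c)"
    using position[of "tape c (head c)" gs] b by (auto simp: m_def bounded_config_def)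
  have h: "head c < n" using b by (simp add: bounded_config_def)
  have "(i, m) \<in> set table" using i m nr by (auto simp: table_def)
  then obtain ps1 ps2 where ps: "table = ps1 @ (i, m) # ps2" "(i, m) \<notin> set ps1"
    by (meson split_list_first)
  have sub: "set ps1 \<subseteq> {0..<length qs} \<times> {0..<length gs}"
  proof -
    have "set table \<subseteq> {0..<length qs} \<times> {0..<length gs}" by (auto simp: table_def)
    then show ?thesis using ps(1) by auto
  qed
  have "\<not> (qs ! i' = state c \<and> gs ! m' = tape c (head c))" if "(i', m') \<in> set ps1" for i' m'
  proof
    assume *: "qs ! i' = state c \<and> gs ! m' = tape c (head c)"
    have "i' < length qs" "m' < length gs" using sub that by auto
    with * i m have "i' = i" "m' = m"
      using distinct_qs distinct_gs by (auto simp: nth_eq_iff_index_eq[symmetric])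
    with ps(2) that show False by simp
  qed
  then obtain y where y: "y < length qs + length gs"
    "runs (concat (map case_code ps1)) (at_bit (contents n c) (head c) x) (at_bit (contents n c) (head c) y)"
    using runs_cases_skip[OF h x sub, of c] by blast
  let ?enter = "go_to i @ [Test] @ go_to (length qs + m) @ [Test]"
  have "runs ?enter (at_bit (contents n c) (head c) y) (at_bit (contents n c) (head c) (length qs + m))"
    using y(1) i m h by (intro runs_guarded_enter) (auto simp: nth_content)
  from runs_append[OF y(2) this]
  have R: "runs (concat (map case_code ps1) @ ?enter) (at_bit (contents n c) (head c) x)
      (at_bit (contents n c) (head c) (length qs + m))" .
  let ?p1 = "concat (map case_code ps1) @ ?enter"
  let ?p2 = "[End_test] @ concat (map case_code ps2)"
  have P: "program = ?p1 @ action_code i m @ ?p2"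
    by (simp add: program_def ps(1) case_code_def guarded_def)
  have "reaches (conf j [] program (at_bit (contents n c) (head c) x))
       (conf j ?p1 (action_code i m @ ?p2) (at_bit (contents n c) (head c) (length qs + m)))" for j
    using R[unfolded runs_def, rule_format, of j "[]" "action_code i m @ ?p2"] unfolding P by simp
  with that i m P show thesis by blast
qed

lemma accepting_config_vanishes:
  assumes b: "bounded_config n c" and x: "x < length qs + length gs"
    and "state c = accept M" "accept M \<noteq> reject M"
  shows "U.vanishes (conf j [] program (at_bit (contents n c) (head c) x))"
proof -
  obtain p1 p2 i m where *: "qs ! i = state c"
    "reaches (conf j [] program (at_bit (contents n c) (head c) x))
       (conf j p1 (action_code i m @ p2) (at_bit (contents n c) (head c) (length qs + m)))"
    using enter_case[OF b x] assms(3,4) by metis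
  have "U.vanishes (conf j p1 (action_code i m @ p2) (at_bit (contents n c) (head c) (length qs + m)))"
    using exec_Accept assms(3) *(1) by (simp add: action_code_def)
  with *(2) show ?thesis unfolding reaches_def using U.vanishes_pow by metis
qed

lemma rejecting_config_survives:
  assumes b: "bounded_config n c" and x: "x < length qs + length gs" and r: "state c = reject M"
  shows "\<not> U.vanishes (conf j [] program (at_bit (contents n c) (head c) x))"
proof -
  have "\<exists>y < length qs + length gs. runs (concat (map case_code table)) (at_bit (contents n c) (head c) x) (at_bit (contents n c) (head c) y)"
    using b x r by (intro runs_cases_skip) (auto simp: bounded_config_def table_def)
  then obtain y where R: "runs program (at_bit (contents n c) (head c) x) (at_bit (contents n c) (head c) y)"
    by (auto simp: program_def)
  let ?w = "conf j program [] (at_bit (contents n c) (head c) y)"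
  have "reaches (conf j [] program (at_bit (contents n c) (head c) x)) ?w"
    using R[unfolded runs_def, rule_format, of j "[]" "[]"] by simp
  moreover have "(U.next_word ^^ i) ?w = ?w" for i
    by (induction i) (simp_all add: exec_end)
  then have "\<not> U.vanishes ?w" by (simp add: U.vanishes_def exec_end)
  ultimately show ?thesis unfolding reaches_def using U.vanishes_pow by metis
qed

text \<open>
  One round through the program, from its first instruction to \<open>Restart\<close>.  Between rounds the
  position within the block of the head is arbitrary.
\<close>

lemma simulate_step:
  assumes b: "bounded_config n c" and b': "bounded_config n (tm_step M c)" and nh: "\<not> halted M c"
    and x: "x < length qs + length gs"
  shows "\<exists>y < length qs + length gs. reaches (conf j [] program (at_bit (contents n c) (head c) x))
     (conf j [] program (at_bit (contents n (tm_step M c)) (head (tm_step M c)) y))"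
proof -
  have nr: "state c \<noteq> reject M" "state c \<noteq> accept M" using nh by (auto simp: halted_def)
  obtain p1 p2 i m where im: "i < length qs" "m < length gs" "qs ! i = state c" "gs ! m = tape c (head c)"
    "program = p1 @ action_code i m @ p2"
    and enter: "reaches (conf j [] program (at_bit (contents n c) (head c) x))
       (conf j p1 (action_code i m @ p2) (at_bit (contents n c) (head c) (length qs + m)))"
    using enter_case[OF b x nr(1)] by metis
  obtain q a mv where d: "delta M (state c) (tape c (head c)) = (q, a, mv)" by (metis prod_cases3)
  let ?h = "head c" and ?h' = "move_head mv (head c)"
  have c': "tm_step M c = \<lparr>state = q, head = ?h', tape = (tape c)(?h := a)\<rparr>"
    using nh by (simp add: tm_step_def d)
  have qa: "q \<in> states M" "a \<in> tape_alphabet M" "?h' < n" "?h < n"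
    using b b' by (auto simp: bounded_config_def c')
  define i' where "i' = position qs q"
  define m' where "m' = position gs a"
  have i': "i' < length qs" "qs ! i' = q" using position[of q qs] qa by (auto simp: i'_def)
  have m': "m' < length gs" "gs ! m' = a" using position[of a gs] qa by (auto simp: m'_def)
  define B where "B = length qs + length gs"
  let ?move = "case mv of MoveLeft \<Rightarrow> [Left] | MoveRight \<Rightarrow> replicate B Right | Stay \<Rightarrow> []"
  let ?main = "write_bit (length qs + m) False @ write_bit (length qs + m') True @ write_bit i False @
     [Home] @ ?move @ write_bit i' True"
  have code: "action_code i m = ?main @ [Restart]"
    using nr im d by (cases mv) (simp_all add: action_code_def i'_def m'_def B_def)
  define vs where "vs = contents n c"
  have vs: "length vs = n" "length (vs ! k) = B" if "k < n" for k
    using that by (simp_all add: vs_def B_def)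
  define vs1 where "vs1 = vs[?h := content None a]"
  have vs1: "length vs1 = n" "k < n \<Longrightarrow> length (vs1 ! k) = B" for k
    using vs[of k] qa by (auto simp: vs1_def nth_list_update B_def vs(1)[OF qa(4)])
  have idx: "length qs + m < B" "length qs + m' < B" "i < B" "i' < B" "0 < B"
    using im i' m' by (auto simp: B_def)
  \<comment> \<open>the first three writes replace the symbol and take the head off the cell\<close>
  have e1: "(vs ! ?h)[length qs + m := False, length qs + m' := True, i := False] = content None a"
  proof -
    have "vs ! ?h = content (Some (qs ! i)) (gs ! m)" using im qa by (simp add: vs_def)
    then show ?thesis
      using content_set_symbol[OF im(2) m'(1)] content_clear_state[OF im(1)] m' by simp
  qed
  have w1: "runs (write_bit (length qs + m) False @ write_bit (length qs + m') True @ write_bit i False)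
     (at_bit vs ?h (length qs + m)) (at_bit vs1 ?h i)"
  proof -
    let ?u1 = "vs[?h := (vs ! ?h)[length qs + m := False]]"
    let ?u2 = "vs[?h := (vs ! ?h)[length qs + m := False, length qs + m' := True]]"
    have len: "length (vs ! ?h) = B" "length vs = n" using vs[OF qa(4)] by auto
    have 1: "runs (write_bit (length qs + m) False) (at_bit vs ?h (length qs + m)) (at_bit ?u1 ?h (length qs + m))"
      using runs_write_bit[of "length qs + m" vs ?h "length qs + m" False] len idx qa by simp
    have 2: "runs (write_bit (length qs + m') True) (at_bit ?u1 ?h (length qs + m)) (at_bit ?u2 ?h (length qs + m'))"
      using runs_write_bit[of "length qs + m" ?u1 ?h "length qs + m'" True] len idx qa by simp
    have 3: "runs (write_bit i False) (at_bit ?u2 ?h (length qs + m')) (at_bit vs1 ?h i)"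
      using runs_write_bit[of "length qs + m'" ?u2 ?h i False] len idx qa e1 by (simp add: vs1_def)
    show ?thesis by (rule runs_append[OF 1 runs_append[OF 2 3]])
  qed
  have w2: "runs [Home] (at_bit vs1 ?h i) (at_bit vs1 ?h 0)"
    using runs_Home[of i vs1 ?h] vs1 idx qa by simp
  have w3: "\<exists>k<B. runs ?move (at_bit vs1 ?h 0) (at_bit vs1 ?h' k)"
  proof (cases mv)
    case Stay
    then show ?thesis using idx by (intro exI[of _ 0]) (simp add: runs_Nil)
  next
    case MoveLeft
    show ?thesis
    proof (cases ?h)
      case 0
      then show ?thesis using MoveLeft runs_Left_wall idx by (intro exI[of _ 0]) simp
    next
      case (Suc h)
      have "vs1 ! Suc h \<noteq> []" using vs1(2)[of "Suc h"] qa Suc idx by auto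
      moreover have "Suc (B - 1) = length (vs1 ! h)" using vs1(2)[of h] qa Suc idx by auto
      ultimately have "runs [Left] (at_bit vs1 (Suc h) 0) (at_bit vs1 h (B - 1))"
        using vs1(1) qa Suc by (intro runs_Left_prev) auto
      then show ?thesis using MoveLeft Suc idx by (intro exI[of _ "B - 1"]) simp
    qed
  next
    case MoveRight
    then have h: "Suc ?h < n" using qa by simp
    have R: "replicate B Right = replicate (B - 1) Right @ [Right]"
      using idx by (metis Suc_pred' replicate_Suc replicate_append_same)
    have 1: "runs (replicate (B - 1) Right) (at_bit vs1 ?h 0) (at_bit vs1 ?h (B - 1))"
      using runs_Rights[of 0 "B - 1" vs1 ?h] vs1(2)[OF qa(4)] idx by simp
    have "vs1 ! Suc ?h \<noteq> []" using vs1(2)[OF h] idx by auto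
    moreover have "Suc (B - 1) = length (vs1 ! ?h)" using vs1(2)[OF qa(4)] idx by auto
    ultimately have 2: "runs [Right] (at_bit vs1 ?h (B - 1)) (at_bit vs1 (Suc ?h) 0)"
      using vs1(1) h by (intro runs_Right_next) auto
    show ?thesis using runs_append[OF 1 2] MoveRight idx R by (intro exI[of _ 0]) simp
  qed
  then obtain k where k: "k < B" "runs ?move (at_bit vs1 ?h 0) (at_bit vs1 ?h' k)" by blast
  \<comment> \<open>the last write puts the head, in its new state, on the cell it has moved to\<close>
  have e2: "vs1[?h' := (vs1 ! ?h')[i' := True]] = contents n (tm_step M c)"
  proof (rule nth_equalityI)
    show "length (vs1[?h' := (vs1 ! ?h')[i' := True]]) = length (contents n (tm_step M c))"
      using vs1 by simp
  next
    fix l assume "l < length (vs1[?h' := (vs1 ! ?h')[i' := True]])"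
    then have l: "l < n" using vs1 by simp
    have v: "vs1 ! l = content None (((tape c)(?h := a)) l)"
      using l vs(1)[OF l] by (auto simp: vs1_def nth_list_update vs_def)
    show "vs1[?h' := (vs1 ! ?h')[i' := True]] ! l = contents n (tm_step M c) ! l"
    proof (cases "l = ?h'")
      case True
      then show ?thesis using l vs1(1) v content_set_state[OF i'(1)] i'(2) by (simp add: c')
    next
      case False
      then show ?thesis using l vs1(1) v by (simp add: c')
    qed
  qed
  have w4: "runs (write_bit i' True) (at_bit vs1 ?h' k) (at_bit (contents n (tm_step M c)) ?h' i')"
    using runs_write_bit[of k vs1 ?h' i' True] k idx vs1 qa e2 by simp
  have "runs ?main (at_bit vs ?h (length qs + m)) (at_bit (contents n (tm_step M c)) ?h' i')"
    using runs_append[OF w1 runs_append[OF w2 runs_append[OF k(2) w4]]] by simp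
  then have "reaches (conf j p1 (?main @ [Restart] @ p2) (at_bit vs ?h (length qs + m)))
      (conf j (p1 @ ?main) ([Restart] @ p2) (at_bit (contents n (tm_step M c)) ?h' i'))"
    unfolding runs_def by blast
  moreover have "reaches (conf j (p1 @ ?main) ([Restart] @ p2) (at_bit (contents n (tm_step M c)) ?h' i'))
      (conf j [] program (at_bit (contents n (tm_step M c)) ?h' i'))"
    using exec_Restart[of j "p1 @ ?main" p2] im(5) code by simp
  ultimately have "reaches (conf j p1 (action_code i m @ p2) (at_bit vs ?h (length qs + m)))
      (conf j [] program (at_bit (contents n (tm_step M c)) ?h' i'))"
    unfolding code by (simp only: append_assoc) (rule reaches_trans)
  from reaches_trans[OF enter[folded vs_def] this]
  show ?thesis using idx(4) by (auto simp: c' B_def vs_def intro!: exI[of _ i'])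
qed

end

text \<open>
  Dead words stay dead.  Hence in the rejecting case it is enough that the orbit arrives at a live
  fixed point.
\<close>

theorem simulation:
  assumes wf: "wf_tm \<Sigma> M" and w: "w \<in> lists \<Sigma>" and bd: "\<And>t. head (run M w t) < n"
    and halts: "\<exists>t. state (run M w t) = (if acc then accept M else reject M)"
  shows "U.vanishes (conf j [] (program M) (at_bit (contents M n (run M w 0)) 0 0)) \<longleftrightarrow> acc"
proof -
  let ?init = "conf j [] (program M) (at_bit (contents M n (run M w 0)) 0 0)"
  let ?conf = "\<lambda>t y. conf j [] (program M) (at_bit (contents M n (run M w t)) (head (run M w t)) y)"
  have fin: "finite (states M)" "finite (tape_alphabet M)" using wf by (auto simp: wf_tm_def)
  let ?B = "length (qs M) + length (gs M)"
  have q0: "start M \<in> states M" and g0: "blank \<in> tape_alphabet M" and ar: "accept M \<noteq> reject M"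
    using wf by (auto simp: wf_tm_def)
  have B: "0 < ?B" using set_qs[OF fin] q0 by (cases "qs M") auto
  have inv: "bounded_config M n (run M w t)" for t
  proof (induction t)
    case 0
    have "range (tape_of w) \<subseteq> tape_alphabet M"
      using w wf nth_mem[of _ w] g0 by (fastforce simp: tape_of_def wf_tm_def)
    then show ?case using bd[of 0] q0 by (simp add: bounded_config_def[OF fin] run_def)
  next
    case (Suc t)
    let ?c = "run M w t"
    have s: "run M w (Suc t) = tm_step M ?c" by (simp add: run_def)
    show ?case
    proof (cases "halted M ?c")
      case True
      then show ?thesis using Suc s by (simp add: tm_step_def)
    next
      case False
      obtain q a mv where d: "delta M (state ?c) (tape ?c (head ?c)) = (q, a, mv)" by (metis prod_cases3)
      have "state ?c \<in> states M - {accept M, reject M}" "tape ?c (head ?c) \<in> tape_alphabet M"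
        using Suc False by (auto simp: bounded_config_def[OF fin] halted_def)
      then have "q \<in> states M" "a \<in> tape_alphabet M"
        using wf d unfolding wf_tm_def by (metis SigmaE2 d mem_Sigma_iff)+
      then show ?thesis using Suc bd[of "Suc t"] False
        by (auto simp: bounded_config_def[OF fin] s tm_step_def d)
    qed
  qed
  have sim: "\<exists>y < ?B. reaches ?init (?conf t y)" for t
  proof (induction t)
    case 0
    have "head (run M w 0) = 0" by (simp add: run_def)
    then show ?case using B by (intro exI[of _ 0]) (simp add: reaches_refl)
  next
    case (Suc t)
    then obtain y where y: "y < ?B" "reaches ?init (?conf t y)" by blast
    have s: "run M w (Suc t) = tm_step M (run M w t)" by (simp add: run_def)
    show ?case
    proof (cases "halted M (run M w t)")
      case True
      then have "run M w (Suc t) = run M w t" by (simp add: s tm_step_def)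
      then show ?thesis using y by auto
    next
      case False
      obtain y' where y': "y' < ?B" "reaches (?conf t y)
         (?conf (Suc t) y')"
        using simulate_step[OF fin inv inv[of "Suc t", unfolded s] False y(1), of j] unfolding s by blast
      then show ?thesis using reaches_trans[OF y(2) y'(2)] by blast
    qed
  qed
  obtain t where t: "state (run M w t) = (if acc then accept M else reject M)" using halts by blast
  obtain y where y: "y < ?B" "reaches ?init (?conf t y)"
    using sim by blast
  have "U.vanishes (?conf t y) \<longleftrightarrow> acc"
    using accepting_config_vanishes[OF fin inv y(1)] rejecting_config_survives[OF fin inv y(1)] t ar
    by (cases acc) auto
  with y(2) show ?thesis unfolding reaches_def using U.vanishes_pow by metis
qed

section \<open>Reducing PSPACE to one word problem\<close>

lemma poly_nat_bound: "\<exists>c d. \<forall>n. poly (p :: nat poly) n \<le> c * (n + 1) ^ d"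
proof (induction p)
  case (pCons a p)
  then obtain c d where cd: "\<And>n. poly p n \<le> c * (n + 1) ^ d" by blast
  have "poly (pCons a p) n \<le> (a + c) * (n + 1) ^ Suc d" for n
  proof -
    have "n * poly p n \<le> (n + 1) * (c * (n + 1) ^ d)" using cd by (intro mult_le_mono) auto
    moreover have "a * 1 \<le> a * (n + 1) ^ Suc d" by (intro mult_le_mono2 one_le_power) simp
    ultimately show ?thesis by (simp add: algebra_simps)
  qed
  then show ?case by blast
qed auto

text \<open>
  Binomial coefficients dominate every polynomial up to a constant factor.
\<close>

lemma power_le_binomial: "(n + 1) ^ d \<le> Suc d ^ Suc d * ((n + Suc d) choose Suc d)"
proof -
  let ?k = "Suc d"
  have "(real (n + ?k) / real ?k) ^ ?k \<le> real ((n + ?k) choose ?k)"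
    by (rule binomial_ge_n_over_k_pow_k) simp
  then have "real (n + ?k) ^ ?k \<le> real ((n + ?k) choose ?k) * real ?k ^ ?k"
    by (subst pos_divide_le_eq[symmetric]) (simp_all only: power_divide zero_less_power of_nat_0_less_iff zero_less_Suc)
  then have "(n + ?k) ^ ?k \<le> ((n + ?k) choose ?k) * ?k ^ ?k"
    by (simp only: of_nat_power[symmetric] of_nat_mult[symmetric] of_nat_le_iff)
  moreover have "(n + 1) ^ d \<le> (n + 1) ^ ?k" by (rule power_increasing) auto
  moreover have "(n + 1) ^ ?k \<le> (n + ?k) ^ ?k" by (rule power_mono) auto
  ultimately show ?thesis by (simp add: mult.commute)
qed

subsection \<open>Odometer\<close>

text \<open>
  The number of steps of an odometer with \<open>m\<close> digits that all have to rise by \<open>j\<close>, where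
  the digits remain non-increasing from left to right: a carry sets the digits to the left of the
  raised one to its new value and not to zero.  The recursion first exhausts the other \<open>m - 1\<close>
  digits, then raises the last digit and with it all of them, and continues.  Counting non-increasing
  words gives a binomial coefficient, which makes the odometer a polynomial clock whose degree is the
  largest digit.
\<close>

fun ticks :: "nat \<Rightarrow> nat \<Rightarrow> nat" where
  "ticks 0 j = 0"
| "ticks (Suc m) 0 = 0"
| "ticks (Suc m) (Suc j) = ticks m (Suc j) + 1 + ticks (Suc m) j"

lemma ticks_binomial: "Suc (ticks m j) = (m + j) choose j"
  by (induction m j rule: ticks.induct) auto

subsection \<open>The word of an input\<close>

definition code :: "letter \<Rightarrow> nat" where
  "code a = to_nat a + 2"

definition right_codes :: "sym list \<Rightarrow> nat list" where
  "right_codes xs = map (\<lambda>x. code (After x)) xs"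

definition first_cell :: "tm \<Rightarrow> nat \<Rightarrow> sym list" where
  "first_cell M a = (let v = content M (Some (start M)) a in
     bit True (v ! 0, True) # map (bit False) (drop (Suc 0) (block v)))"

definition later_cell :: "tm \<Rightarrow> nat \<Rightarrow> sym list" where
  "later_cell M a = map (bit False) (block (content M None a))"

definition prefix_codes :: "tm \<Rightarrow> nat list" where
  "prefix_codes M = code (Before Begin) # code (At Fetch) # right_codes (map ins (program M) @ [Separator])"

definition suffix_codes :: "nat list" where
  "suffix_codes = [1, code Zero]"

text \<open>
  The output starts with one junk letter for each input cell.  The input is overwritten in place with
  these letters, while everything else is appended behind it.
\<close>

definition reduction :: "tm \<Rightarrow> nat \<Rightarrow> nat \<Rightarrow> nat list \<Rightarrow> nat list" where
  "reduction M c k w = replicate (length w) (code (Before Separator)) @ prefix_codes M @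
     (case w of [] \<Rightarrow> right_codes (first_cell M 0)
      | a # v \<Rightarrow> right_codes (first_cell M a) @ concat (map (\<lambda>a. right_codes (later_cell M a)) v)) @
     concat (replicate (Suc (ticks (length w) k)) (concat (replicate c (right_codes (later_cell M 0))))) @
     suffix_codes"

definition input_word :: "tm \<Rightarrow> nat \<Rightarrow> nat list \<Rightarrow> letter list" where
  "input_word M n w =
     conf (replicate (length w) Separator) [] (program M) (at_bit (contents M n (run M w 0)) 0 0)"

lemma concat_replicate_concat: "concat (replicate m (concat (replicate c xs))) = concat (replicate (m * c) xs)"
  by (induction m) (simp_all add: replicate_add)

text \<open>
  The number of blocks: one for each input symbol, at least one for the head, and \<open>c\<close> for each
  tick of the odometer and once more at its overflow.
\<close>

lemma reduction_input_word:
  assumes fin: "finite (states M)" "finite (tape_alphabet M)"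
    and ne: "content M (Some (start M)) (tape_of w 0) \<noteq> []"
  shows "reduction M c k w =
    map code (input_word M ((if w = [] then 1 else length w) + Suc (ticks (length w) k) * c) w) @ suffix_codes"
proof -
  define P where "P = Suc (ticks (length w) k) * c"
  define n where "n = (if w = [] then 1 else length w) + P"
  define v where "v = (if w = [] then [] else tl w)"
  define a where "a = tape_of w 0"
  let ?v0 = "content M (Some (start M)) a"
  have t: "map (tape_of w) [0..<n] = a # v @ replicate P 0"
    by (rule nth_equalityI) 
      (auto simp: n_def v_def a_def tape_of_def nth_Cons' nth_append nth_tl)
  have contents: "contents M n (run M w 0) = ?v0 # map (content M None) (v @ replicate P 0)"
  proof (rule nth_equalityI)
    show "length (contents M n (run M w 0)) = length (?v0 # map (content M None) (v @ replicate P 0))"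
      using fin by (simp add: contents_props n_def v_def)
  next
    fix i assume "i < length (contents M n (run M w 0))"
    then have i: "i < n" using fin by (simp add: contents_props)
    then have "tape_of w i = (a # v @ replicate P 0) ! i" using t by (metis length_upt map_nth minus_nat.diff_0 nth_map nth_upt plus_nat.add_0)
    then show "contents M n (run M w 0) ! i = (?v0 # map (content M None) (v @ replicate P 0)) ! i"
      using i fin by (cases i) (auto simp: contents_props run_def n_def v_def simp del: map_append map_replicate split: if_splits)
  qed
  have "data_syms (at_bit (contents M n (run M w 0)) 0 0) =
      first_cell M a @ concat (map (later_cell M) (v @ replicate P 0))"
    using ne by (simp add: contents at_bit_def first_cell_def Let_def a_def later_cell_def[abs_def] map_concat o_def)
  then have "map code (input_word M n w) = replicate (length w) (code (Before Separator)) @ prefix_codes M @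
     right_codes (first_cell M a) @ concat (map (\<lambda>a. right_codes (later_cell M a)) (v @ replicate P 0))"
    by (simp add: input_word_def conf_def config_word_def prefix_codes_def right_codes_def
        map_concat o_def rev_replicate)
  moreover have "concat (map (\<lambda>a. right_codes (later_cell M a)) (replicate P 0)) =
      concat (replicate (Suc (ticks (length w) k)) (concat (replicate c (right_codes (later_cell M 0)))))"
    by (simp only: concat_replicate_concat P_def map_replicate)
  moreover have "(case w of [] \<Rightarrow> right_codes (first_cell M 0)
      | a # v \<Rightarrow> right_codes (first_cell M a) @ concat (map (\<lambda>a. right_codes (later_cell M a)) v)) =
     right_codes (first_cell M a) @ concat (map (\<lambda>a. right_codes (later_cell M a)) v)"
    by (cases w) (auto simp: a_def v_def tape_of_def)
  ultimately show ?thesis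
    unfolding reduction_def n_def[symmetric] P_def[symmetric] by simp
qed

subsection \<open>The reducing machine\<close>

datatype item = Pending nat | Digit nat

text \<open>
  First the input symbols are copied one per sweep, as blocks; a copied symbol is replaced by the digit
  0.  When no symbol is pending, the digits form the odometer: \<open>Carry\<close> looks for the first digit
  that can be raised, and \<open>Reset v\<close> lowers the full digits in front of it to \<open>v\<close>.
\<close>

datatype job = First | Find bool | Found bool nat | Go_back | Start_count | Carry | Ticked nat
| Reset nat | Final

instance item :: countable by countable_datatype
instance job :: countable by countable_datatype

locale reducer =
  fixes M :: tm and c k :: nat and \<Sigma> :: "nat set"
  assumes wf: "wf_tm \<Sigma> M"
begin

fun work_right :: "job \<Rightarrow> item \<Rightarrow> job \<times> item" where
  "work_right (Find f) (Pending a) = (Found f a, Digit 0)"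
| "work_right Carry (Digit v) = (if v < k then (Ticked (Suc v), Digit (Suc v)) else (Carry, Digit v))"
| "work_right s d = (s, d)"

fun work_left :: "job \<Rightarrow> item \<Rightarrow> job \<times> item" where
  "work_left (Reset v) (Digit x) = (Reset v, Digit (if x = k then v else x))"
| "work_left s d = (s, d)"

definition padding :: "nat list" where
  "padding = concat (replicate c (right_codes (later_cell M 0)))"

fun emit :: "job \<Rightarrow> nat list \<times> job" where
  "emit (Found f a) = (if f then prefix_codes M @ right_codes (first_cell M a)
     else right_codes (later_cell M a), Go_back)"
| "emit (Find f) = ([], Start_count)"
| "emit (Ticked v) = (padding, Reset v)"
| "emit Carry = (padding @ suffix_codes, Final)"
| "emit s = ([], s)"

fun turn :: "job \<Rightarrow> bool + job" where
  "turn First = Inr (Find True)"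
| "turn Go_back = Inr (Find False)"
| "turn Start_count = Inr Carry"
| "turn (Reset v) = Inr Carry"
| "turn Final = Inl True"
| "turn s = Inr s"

definition symbols :: "nat set" where
  "symbols = insert 1 (range code \<union> \<Sigma>)"

definition top :: nat where "top = Max symbols"

definition jobs :: "job set" where
  "jobs = {First, Go_back, Start_count, Carry, Final} \<union> range Find \<union> case_prod Found ` (UNIV \<times> {..top}) \<union>
     Ticked ` {..k} \<union> Reset ` {..k}"

definition items :: "item set" where
  "items = Pending ` {..top} \<union> Digit ` {..k}"

definition longest :: nat where
  "longest = Max (insert (length (reduction M c k [])) ((\<lambda>s. length (fst (emit s))) ` jobs))"

lemma finite_jobs: "finite jobs"
  by (simp add: jobs_def)

lemma finite_symbols: "finite symbols"
proof -
  have "finite \<Sigma>" using wf finite_subset[of \<Sigma> "tape_alphabet M"] by (auto simp: wf_tm_def)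
  then show ?thesis by (simp add: symbols_def)
qed

lemma symbols_top: "symbols \<subseteq> {1..top}"
proof
  fix x assume x: "x \<in> symbols"
  then have "x \<le> top" using finite_symbols by (simp add: top_def)
  moreover have "x \<noteq> 0" using x wf by (auto simp: symbols_def code_def wf_tm_def)
  ultimately show "x \<in> {1..top}" by simp
qed

lemma right_codes_symbols: "set (right_codes xs) \<subseteq> symbols"
  by (auto simp: right_codes_def symbols_def)

lemma prefix_codes_symbols: "set (prefix_codes M) \<subseteq> symbols"
  using right_codes_symbols by (auto simp: prefix_codes_def symbols_def)

lemma suffix_codes_symbols: "set suffix_codes \<subseteq> symbols"
  by (auto simp: suffix_codes_def symbols_def)

lemma padding_symbols: "set padding \<subseteq> symbols"
  by (auto simp: padding_def dest: subsetD[OF right_codes_symbols])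

lemma emit_symbols: "set (fst (emit s)) \<subseteq> symbols"
  using right_codes_symbols prefix_codes_symbols suffix_codes_symbols padding_symbols
  by (cases s rule: emit.cases) auto

lemma reduction_empty:
  "reduction M c k [] = prefix_codes M @ right_codes (first_cell M 0) @ padding @ suffix_codes"
  by (simp add: reduction_def padding_def)

lemma reducer_sweeper:
  "sweeper jobs items longest top \<Sigma> Pending First work_left turn work_right emit
     (\<lambda>_. code (Before Separator)) (reduction M c k [])"
proof
  show "finite jobs" by (rule finite_jobs)
  show "finite items" by (simp add: items_def)
  show "First \<in> jobs" by (simp add: jobs_def)
  show "\<Sigma> \<subseteq> {1..top}" using symbols_top by (auto simp: symbols_def)
  show "Pending a \<in> items" if "a \<le> top" for a using that by (simp add: items_def)
  show "work_left s d \<in> jobs \<times> items" if "s \<in> jobs" "d \<in> items" for s d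
    using that by (cases "(s, d)" rule: work_left.cases) (auto simp: jobs_def items_def)
  show "work_right s d \<in> jobs \<times> items" if "s \<in> jobs" "d \<in> items" for s d
    using that by (cases "(s, d)" rule: work_right.cases) (auto simp: jobs_def items_def)
  show "s' \<in> jobs" if "s \<in> jobs" "turn s = Inr s'" for s s'
    using that by (cases s rule: turn.cases) (auto simp: jobs_def)
  show "emit s \<in> {e \<in> lists {1..top}. length e \<le> longest} \<times> jobs" if "s \<in> jobs" for s
  proof -
    have "length (fst (emit s)) \<le> longest"
      unfolding longest_def using that finite_jobs by (intro Max_ge) auto
    moreover have "snd (emit s) \<in> jobs" using that by (cases s rule: emit.cases) (auto simp: jobs_def)
    moreover have "fst (emit s) \<in> lists {1..top}" using emit_symbols[of s] symbols_top by auto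
    ultimately show ?thesis by (simp add: mem_Times_iff)
  qed
  have "code (Before Separator) \<in> symbols" by (simp add: symbols_def)
  then show "code (Before Separator) \<in> {1..top}" using symbols_top by blast
  show "reduction M c k [] \<in> lists {1..top}"
    using prefix_codes_symbols suffix_codes_symbols padding_symbols right_codes_symbols[of "first_cell M 0"] symbols_top
    unfolding reduction_empty by auto
  show "length (reduction M c k []) \<le> longest"
    unfolding longest_def using finite_jobs by (intro Max_ge) auto
qed

interpretation red: sweeper jobs items longest top \<Sigma> Pending First work_left turn work_right emit
  "\<lambda>_. code (Before Separator)" "reduction M c k []" True
  by (rule reducer_sweeper)

lemma rmealy_id: "(\<And>d. work_left s d = (s, d)) \<Longrightarrow> rmealy work_left s ds = (s, ds)"
  using rmealy_stable[of ds work_left s id id] by simp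

lemma mealy_id: "(\<And>d. d \<in> set ds \<Longrightarrow> work_right s d = (s, d)) \<Longrightarrow> mealy work_right s ds = (s, ds)"
  using mealy_stable[of ds work_right s id id] by simp

lemma mealy_Find:
  "mealy work_right (Find f) (replicate m (Digit 0) @ Pending a # ds) =
     (Found f a, replicate (Suc m) (Digit 0) @ ds)"
proof -
  have 1: "mealy work_right (Find f) (replicate m (Digit 0)) = (Find f, replicate m (Digit 0))"
    by (rule mealy_id) auto
  have 2: "mealy work_right (Found f a) ds = (Found f a, ds)"
    by (rule mealy_id) auto
  show ?thesis by (simp add: mealy_append 1 2 replicate_app_Cons_same)
qed

lemma copy_cells:
  "(red.sweep ^^ Suc (length v)) (Go_back, replicate m (Digit 0) @ map Pending v, xs)
     (Start_count, replicate (m + length v) (Digit 0),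
      xs @ concat (map (\<lambda>a. right_codes (later_cell M a)) v))"
proof (induction v arbitrary: m xs)
  case Nil
  have 1: "rmealy work_left Go_back ds = (Go_back, ds)" for ds by (rule rmealy_id) simp
  have 2: "mealy work_right (Find False) (replicate m (Digit 0)) = (Find False, replicate m (Digit 0))"
    by (rule mealy_id) auto
  show ?case using red.sweep.intros[OF 1 _ 2, of "[]" Start_count xs] by (simp add: eq_OO)
next
  case (Cons a v)
  have 1: "rmealy work_left Go_back ds = (Go_back, ds)" for ds by (rule rmealy_id) simp
  have "red.sweep (Go_back, replicate m (Digit 0) @ Pending a # map Pending v, xs)
    (Go_back, replicate (Suc m) (Digit 0) @ map Pending v, xs @ right_codes (later_cell M a))"
    by (rule red.sweep.intros[OF 1 _ mealy_Find]) auto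
  from relpowp_Suc_I2[of red.sweep, OF this Cons.IH[of "Suc m" "xs @ right_codes (later_cell M a)"]]
  show ?case by (simp del: relpowp.simps replicate_Suc)
qed

text \<open>
  The odometer shows \<open>vs\<close> at the left end, before the next tick.
\<close>

definition ready :: "job \<times> item list \<times> nat list \<Rightarrow> nat list \<Rightarrow> nat list \<Rightarrow> bool" where
  "ready cf vs xs \<longleftrightarrow> (\<exists>s ds s1. cf = (s, ds, xs) \<and> rmealy work_left s ds = (s1, map Digit vs) \<and>
     turn s1 = Inr Carry)"

text \<open>
  The digits behind the raised one are not full, so resetting full digits only affects those in front
  of it.
\<close>

lemma tick:
  assumes "ready cf (replicate m k @ v # vs) xs" "v < k" "\<forall>x \<in> set vs. x < k"
  shows "\<exists>cf'. red.sweep cf cf' \<and> ready cf' (replicate (Suc m) (Suc v) @ vs) (xs @ padding)"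
proof -
  obtain s ds s1 where cf: "cf = (s, ds, xs)" "rmealy work_left s ds = (s1, map Digit (replicate m k @ v # vs))"
    "turn s1 = Inr Carry" using assms(1) by (auto simp: ready_def)
  have 1: "mealy work_right Carry (replicate m (Digit k)) = (Carry, replicate m (Digit k))"
    by (rule mealy_id) auto
  have 2: "mealy work_right (Ticked x) ys = (Ticked x, ys)" for x ys by (rule mealy_id) simp
  have R: "mealy work_right Carry (map Digit (replicate m k @ v # vs)) =
      (Ticked (Suc v), map Digit (replicate m k @ Suc v # vs))"
    using assms(2) by (simp add: mealy_append 1 2)
  have "red.sweep cf (Reset (Suc v), map Digit (replicate m k @ Suc v # vs), xs @ padding)"
    unfolding cf(1) by (rule red.sweep.intros[OF cf(2,3) R]) simp
  moreover have "ready (Reset (Suc v), map Digit (replicate m k @ Suc v # vs), xs @ padding)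
      (replicate (Suc m) (Suc v) @ vs) (xs @ padding)"
  proof -
    have "rmealy work_left (Reset (Suc v)) (map Digit (replicate m k @ Suc v # vs)) =
       (Reset (Suc v), map (\<lambda>x. Digit (if x = k then Suc v else x)) (replicate m k @ Suc v # vs))"
      by (rule rmealy_stable) simp
    moreover have "map (\<lambda>x. Digit (if x = k then Suc v else x)) (replicate m k @ Suc v # vs) =
       map Digit (replicate (Suc m) (Suc v) @ vs)"
      using assms(3) by (auto simp: replicate_app_Cons_same[symmetric] map_replicate_const)
    ultimately show ?thesis by (auto simp: ready_def)
  qed
  ultimately show ?thesis by blast
qed

lemma count:
  assumes "ready cf (replicate m v @ vs) xs" "v + j = k" "j > 0 \<Longrightarrow> \<forall>x \<in> set vs. x < k"
  shows "\<exists>cf'. (red.sweep ^^ ticks m j) cf cf' \<and>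
    ready cf' (replicate m k @ vs) (xs @ concat (replicate (ticks m j) padding))"
  using assms
proof (induction m j arbitrary: cf v vs xs rule: ticks.induct)
  case (1 j) then show ?case by auto
next
  case (2 m) then show ?case by auto
next
  case (3 m j)
  have v: "v < k" using 3(4) by simp
  have comm: "concat (replicate t padding) @ padding = padding @ concat (replicate t padding)" for t
    by (induction t) simp_all
  have "ready cf (replicate m v @ v # vs) xs" using 3(3) by (simp add: replicate_app_Cons_same)
  from 3(1)[OF this 3(4)] 3(5) v obtain cf1 where 1: "(red.sweep ^^ ticks m (Suc j)) cf cf1"
    "ready cf1 (replicate m k @ v # vs) (xs @ concat (replicate (ticks m (Suc j)) padding))" by auto
  obtain cf2 where 2: "red.sweep cf1 cf2" "ready cf2 (replicate (Suc m) (Suc v) @ vs)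
      ((xs @ concat (replicate (ticks m (Suc j)) padding)) @ padding)"
    using tick[OF 1(2) v] 3(5) by blast
  from 3(2)[OF 2(2)] 3(4,5) obtain cf3 where 3: "(red.sweep ^^ ticks (Suc m) j) cf2 cf3"
    "ready cf3 (replicate (Suc m) k @ vs) (((xs @ concat (replicate (ticks m (Suc j)) padding)) @ padding) @
       concat (replicate (ticks (Suc m) j) padding))" by auto
  have "(red.sweep ^^ (ticks m (Suc j) + 1)) cf cf2"
    using 1(1) 2(1) by auto
  then have "(red.sweep ^^ ticks (Suc m) (Suc j)) cf cf3"
    using 3(1) by (simp only: ticks.simps) (rule relpowp_trans)
  moreover have "((xs @ concat (replicate (ticks m (Suc j)) padding)) @ padding) @
       concat (replicate (ticks (Suc m) j) padding) = xs @ concat (replicate (ticks (Suc m) (Suc j)) padding)"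
    by (simp add: replicate_add comm)
  ultimately show ?case using 3(2) by metis
qed

lemma reducer_run:
  assumes "w \<noteq> []"
  shows "\<exists>m s ds xs s1 ds1. (red.sweep ^^ m) (First, map Pending w, []) (s, ds, xs) \<and>
     rmealy work_left s ds = (s1, ds1) \<and> turn s1 = Inl True \<and>
     reduction M c k w = map (\<lambda>_. code (Before Separator)) ds1 @ xs \<and> m = length w + 2 + ticks (length w) k"
proof -
  obtain a v where w: "w = a # v" using assms by (cases w) auto
  have 0: "rmealy work_left First ds = (First, ds)" for ds by (rule rmealy_id) simp
  have s1: "red.sweep (First, map Pending w, [])
     (Go_back, replicate 1 (Digit 0) @ map Pending v, prefix_codes M @ right_codes (first_cell M a))"
    using red.sweep.intros[OF 0 _ mealy_Find[of True 0 a "map Pending v"], of _ Go_back "[]"] by (simp add: w)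
  let ?xs = "prefix_codes M @ right_codes (first_cell M a) @ concat (map (\<lambda>a. right_codes (later_cell M a)) v)"
  have c2: "(red.sweep ^^ (Suc (Suc (length v)))) (First, map Pending w, [])
     (Start_count, replicate (length w) (Digit 0), ?xs)"
    using relpowp_Suc_I2[of red.sweep, OF s1 copy_cells] by (simp add: w del: relpowp.simps replicate_Suc)
  have "rmealy work_left Start_count ds = (Start_count, ds)" for ds by (rule rmealy_id) simp
  then have "ready (Start_count, replicate (length w) (Digit 0), ?xs) (replicate (length w) 0 @ []) ?xs"
    by (simp add: ready_def)
  from count[OF this, of k] obtain cf where cf: "(red.sweep ^^ ticks (length w) k)
     (Start_count, replicate (length w) (Digit 0), ?xs) cf"
    "ready cf (replicate (length w) k @ []) (?xs @ concat (replicate (ticks (length w) k) padding))" by auto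
  let ?ys = "?xs @ concat (replicate (ticks (length w) k) padding)"
  obtain s ds s1 where cf': "cf = (s, ds, ?ys)" "rmealy work_left s ds = (s1, map Digit (replicate (length w) k @ []))"
    "turn s1 = Inr Carry" using cf(2) by (auto simp: ready_def)
  have "mealy work_right Carry (map Digit (replicate (length w) k @ [])) = (Carry, map Digit (replicate (length w) k @ []))"
    by (rule mealy_id) auto
  from red.sweep.intros[OF cf'(2,3) this, of "padding @ suffix_codes" Final ?ys]
  have "red.sweep cf (Final, map Digit (replicate (length w) k @ []), ?ys @ padding @ suffix_codes)"
    by (simp add: cf'(1))
  with cf(1) have "(red.sweep ^^ Suc (ticks (length w) k)) (Start_count, replicate (length w) (Digit 0), ?xs)
      (Final, map Digit (replicate (length w) k @ []), ?ys @ padding @ suffix_codes)" by auto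
  from relpowp_trans[OF c2 this]
  \<comment> \<open>\<open>length w\<close> sweeps copy the symbols, one finds none left, each tick takes one, and the last one is the overflow\<close>
  have run: "(red.sweep ^^ (length w + 2 + ticks (length w) k)) (First, map Pending w, [])
      (Final, map Digit (replicate (length w) k @ []), ?ys @ padding @ suffix_codes)"
    by (simp add: w del: relpowp.simps)
  have "concat (replicate (Suc m) padding) = concat (replicate m padding) @ padding" for m
    by (induction m) auto
  then have "reduction M c k w = map (\<lambda>_. code (Before Separator)) (map Digit (replicate (length w) k @ [])) @
      ?ys @ padding @ suffix_codes"
    by (simp only: reduction_def padding_def[symmetric]) (simp add: w map_replicate_const)
  moreover have "rmealy work_left Final ds = (Final, ds)" for ds by (rule rmealy_id) simp
  ultimately show ?thesis using run by fastforce
qed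

lemma reduction_computable:
  "poly_time_computable \<Sigma> (word_problem_alphabet U.generators) (reduction M c k)"
proof (rule red.sweeper_poly_time_computable)
  let ?A = "word_problem_alphabet U.generators"
  have A: "code a \<in> ?A" "1 \<in> ?A" for a
    by (simp_all add: word_problem_alphabet_def U.generators_def code_def)
  fix w :: "nat list"
  show "reduction M c k w \<in> lists ?A"
  proof -
    have r: "set (right_codes xs) \<subseteq> ?A" for xs using A by (auto simp: right_codes_def)
    have "set padding \<subseteq> ?A" using r by (auto simp: padding_def dest: subsetD[OF r])
    then have p: "set (concat (replicate m padding)) \<subseteq> ?A" for m by (induction m) auto
    have "set (prefix_codes M) \<subseteq> ?A" "set suffix_codes \<subseteq> ?A"
      using A r by (auto simp: prefix_codes_def suffix_codes_def)
    moreover have "set (case w of [] \<Rightarrow> right_codes (first_cell M 0)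
      | a # v \<Rightarrow> right_codes (first_cell M a) @ concat (map (\<lambda>a. right_codes (later_cell M a)) v)) \<subseteq> ?A"
      using r by (cases w) (auto dest: subsetD[OF r])
    moreover have "set (replicate (length w) (code (Before Separator))) \<subseteq> ?A" using A by auto
    ultimately show ?thesis
      using p unfolding reduction_def padding_def[symmetric] in_lists_conv_set set_append by blast
  qed
  assume w: "w \<in> lists \<Sigma>" "w \<noteq> []"
  define K :: "nat poly" where "K = [:2, 1:] + [:k, 1:] ^ k"
  define X :: "nat poly" where "X = K * [:longest:]"
  obtain m s ds xs s1 ds1 where run: "(red.sweep ^^ m) (First, map Pending w, []) (s, ds, xs)"
     "rmealy work_left s ds = (s1, ds1)" "turn s1 = Inl True"
     "reduction M c k w = map (\<lambda>_. code (Before Separator)) ds1 @ xs" "m = length w + 2 + ticks (length w) k"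
    using reducer_run[OF w(2)] by blast
  have "ticks (length w) k \<le> (length w + k) choose k"
    using ticks_binomial[of "length w" k] by simp
  also have "\<dots> \<le> (length w + k) ^ k" by (rule binomial_le_pow) simp
  finally have "m \<le> poly K (length w)"
    by (simp add: K_def run(5) add.commute)
  moreover have "First \<in> jobs" "set (map Pending w) \<subseteq> items"
    using w symbols_top by (auto simp: jobs_def items_def symbols_def)
  then have "red.proper (First, map Pending w, [])"
    using w by (simp add: red.proper_def)
  from red.sweep_length[OF run(1) this] have "length xs \<le> m * longest" by simp
  moreover from calculation have "m * longest \<le> poly X (length w)" by (simp add: X_def)
  ultimately have "m \<le> poly K (length w) \<and> length xs \<le> poly X (length w)" by linarith
  with run show "\<exists>m s ds xs s1 ds1 r. (red.sweep ^^ m) (First, map Pending w, []) (s, ds, xs) \<and>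
      rmealy work_left s ds = (s1, ds1) \<and> turn s1 = Inl r \<and>
      reduction M c k w = map (\<lambda>_. code (Before Separator)) ds1 @ xs \<and>
      m \<le> poly ([:2, 1:] + [:k, 1:] ^ k) (length w) \<and>
      length xs \<le> poly (([:2, 1:] + [:k, 1:] ^ k) * [:longest:]) (length w)"
    unfolding K_def X_def by blast
qed simp

end

subsection \<open>Completeness\<close>

lemma word_problem_codes:
  assumes W: "W = lists U.generators \<or> W = nonempty_words U.generators" and ne: "u \<noteq> []" "v \<noteq> []"
  shows "map code u @ [1] @ map code v \<in> word_problem W U.relators \<longleftrightarrow> U.equivalent u v"
proof -
  have c: "map code x = map (\<lambda>a. a + 2) (map to_nat x)" for x :: "letter list"
    by (simp add: code_def)
  have mem: "map to_nat x \<in> W" if "x \<noteq> []" for x :: "letter list"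
    using W that by (auto simp: U.generators_def)
  show ?thesis
  proof
    assume "map code u @ [1] @ map code v \<in> word_problem W U.relators"
    then obtain x y where xy: "map code u @ 1 # map code v = map (\<lambda>a. a + 2) x @ 1 # map (\<lambda>a. a + 2) y"
      "x \<in> W" "y \<in> W" "equal_in W U.relators x y"
      by (auto simp: word_problem_def)
    obtain x' y' :: "letter list" where xy': "x = map to_nat x'" "y = map to_nat y'"
      using xy(2,3) W U.generators_words by (metis DiffD1)
    have "map code u = map (\<lambda>a. a + 2) (map to_nat x') \<and> v = y'"
      using xy(1) unfolding c xy' by (rule U.codes_split)
    then have "u = x' \<and> v = y'" using U.codes_inject by (simp add: c)
    then show "U.equivalent u v" using xy xy' U.equal_in_relators[OF W] by blast
  next
    assume "U.equivalent u v"
    then have "equal_in W U.relators (map to_nat u) (map to_nat v)"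
      using U.equal_in_relators[OF W] mem ne by blast
    then show "map code u @ [1] @ map code v \<in> word_problem W U.relators"
      unfolding word_problem_def c using mem ne by blast
  qed
qed

text \<open>
  The zero letter itself is dead.
\<close>

lemma equivalent_Zero: "U.equivalent u [Zero] \<longleftrightarrow> U.vanishes u"
proof -
  have "\<not> U.live ((U.next_word ^^ 0) [Zero])" by (simp add: U.live_def)
  then have "U.vanishes [Zero]" unfolding U.vanishes_def by blast
  then show ?thesis using U.equivalent_vanishes unfolding U.equivalent_def by blast
qed

text \<open>
  With \<open>p n \<le> c0 * (n + 1) ^ d\<close> digits up to \<open>d + 1\<close> suffice; the constant \<open>c\<close> makes
  up for the factor lost in \<open>power_le_binomial\<close>.
\<close>

theorem PSPACE_hard:
  assumes W: "W = lists U.generators \<or> W = nonempty_words U.generators" and X: "in_PSPACE \<Sigma> X"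
  shows "poly_time_reducible \<Sigma> X (word_problem_alphabet U.generators) (word_problem W U.relators)"
proof -
  obtain M p where wf: "wf_tm \<Sigma> M" and M: "\<And>w. w \<in> lists \<Sigma> \<Longrightarrow>
      (\<exists>t. state (run M w t) = (if w \<in> X then accept M else reject M)) \<and>
      (\<forall>t. head (run M w t) < poly p (length w))"
    using X unfolding in_PSPACE_def by blast
  obtain c0 d where p: "\<And>n. poly p n \<le> c0 * (n + 1) ^ d" using poly_nat_bound by blast
  define k where "k = Suc d"
  define c where "c = c0 * k ^ k"
  have space: "poly p n \<le> Suc (ticks n k) * c" for n
  proof -
    have "poly p n \<le> c0 * (n + 1) ^ d" by (rule p)
    also have "\<dots> \<le> c0 * (k ^ k * ((n + k) choose k))"
      unfolding k_def by (intro mult_le_mono2 power_le_binomial)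
    finally show ?thesis by (simp only: ticks_binomial c_def mult_ac)
  qed
  interpret reducer M c k \<Sigma> by unfold_locales (rule wf)
  have fin: "finite (states M)" "finite (tape_alphabet M)" and st: "start M \<in> states M"
    using wf by (auto simp: wf_tm_def)
  have "content M (Some (start M)) a \<noteq> []" for a
    using set_qs[OF fin] st by (auto simp: content_def[OF fin])
  note red = reduction_input_word[OF fin this]
  have "w \<in> X \<longleftrightarrow> reduction M c k w \<in> word_problem W U.relators" if w: "w \<in> lists \<Sigma>" for w
  proof -
    define n where "n = (if w = [] then 1 else length w) + Suc (ticks (length w) k) * c"
    have "head (run M w t) < n" for t
      using M[OF w] space[of "length w"] unfolding n_def by (meson le_add2 less_le_trans)
    from simulation[OF wf w this] M[OF w]
    have sim: "U.vanishes (input_word M n w) \<longleftrightarrow> w \<in> X" unfolding input_word_def by blast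
    have "input_word M n w \<noteq> []" by (simp add: input_word_def conf_def config_word_def)
    from word_problem_codes[OF W this, of "[Zero]"]
    show ?thesis unfolding red n_def[symmetric] using sim by (simp add: suffix_codes_def equivalent_Zero)
  qed
  then show ?thesis unfolding poly_time_reducible_def using reduction_computable by blast
qed

theorem corollary1p5:
  "(\<exists>(A :: nat set) R.
      finite_semigroup_presentation A R \<and>
      PSPACE_complete (word_problem_alphabet A) (word_problem (nonempty_words A) R) \<and>
      polynomial_function (space_function (nonempty_words A) R)) \<and>
   (\<exists>(A :: nat set) R.
      finite_monoid_presentation A R \<and>
      PSPACE_complete (word_problem_alphabet A) (word_problem (lists A) R) \<and>
      polynomial_function (space_function (lists A) R))"
proof (intro conjI exI)
  show "finite_semigroup_presentation U.generators U.relators"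
    "finite_monoid_presentation U.generators U.relators"
    by (rule U.presentation)+
  show "PSPACE_complete (word_problem_alphabet U.generators) (word_problem (nonempty_words U.generators) U.relators)"
    unfolding PSPACE_complete_def
    using U.word_problem_in_PSPACE[of "nonempty_words U.generators" False] PSPACE_hard by simp
  show "PSPACE_complete (word_problem_alphabet U.generators) (word_problem (lists U.generators) U.relators)"
    unfolding PSPACE_complete_def
    using U.word_problem_in_PSPACE[of "lists U.generators" True] PSPACE_hard by simp
  show "polynomial_function (space_function (nonempty_words U.generators) U.relators)"
    "polynomial_function (space_function (lists U.generators) U.relators)"
    by (rule U.polynomial_space; simp)+
qed

end
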